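(* Let $\Lambda>1$ and let $\bar a,\delta,\gamma>0$ satisfy \[ 1-\delta>\frac1\Lambda,\qquad \gamma<\frac{\Lambda-1}{\Lambda+1},\qquad \bar a>\frac{\Lambda}{\Lambda-1}+10,\qquad \frac1{\bar a}<\delta . \] Take any $b\in\mathbb{R}$ and any $\bar X=\begin{pmatrix}\bar x_0&\bar x_1\\ \bar y_0&\bar y_1\end{pmatrix}\in\mathscr{U}_{\bar a,\delta,\gamma}$, and set $l(x):=\left\langle\begin{pmatrix}\bar x_0\\ \bar x_1\end{pmatrix},x\right\rangle_{\mathbb{R}^2}+b$ for $x\in\mathbb{R}^2$. Fix any $\alpha\in(0,1)$ and any regular domain $\Omega\subset\mathbb{R}^2$. Then there exist $u\in W^{1,2}(\Omega,\mathbb{R})\cap C^\alpha(\overline{\Omega},\mathbb{R})$ and a bounded, measurable, diagonal-matrix-valued function $A(x)=\begin{pmatrix}\lambda_1(x)&0\\0&\lambda_2(x)\end{pmatrix}$ with $\frac1\Lambda\le\lambda_1(x),\lambda_2(x)\le\Lambda$ for a.e. $x\in\Omega$, such that: \begin{enumerate} \item $u(x)=l(x)$ for $x\in\partial\Omega$; \item $\operatorname{div}(A\nabla u)=0$ in the distributional sense in $\Omega$; \item $\nabla u\in L^{\frac{2\Lambda}{\Lambda-1},\infty}(\Omega)$; \item $\nabla u\notin L^{\frac{2\Lambda}{\Lambda-1},r}(\Omega)$ for any $0<r<\infty$; in particular $\nabla u\notin L^{\frac{2\Lambda}{\Lambda-1}}(\Omega)$. \end{enumerate}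
   Context: Regular domain: a set $\Omega\subset\mathbb{R}^2$ that is open, bounded, connected (in particular nonempty) and whose boundary has zero Lebesgue measure. The set $\mathscr{U}_{\bar a,\delta,\gamma}$ is \[ \mathscr{U}_{\bar a,\delta,\gamma}:=\left\{\begin{pmatrix}a&b\\-c&d\end{pmatrix}\in\mathbb{R}^{2\times2}:\ a,d>\bar a,\ \left|1-\frac ad\right|<\delta,\ |1-b|<\gamma,\ |1-c|<\gamma\right\}. \] Lorentz spaces: for $1<p<\infty$ and $0<r<\infty$, $f\in L^{p,r}(\Omega)$ means that $f$ is measurable and $\int_0^\infty|\{x\in\Omega:|f(x)|>t\}|^{r/p}\,t^{r}\,\frac{dt}{t}<\infty$; $f\in L^{p,\infty}(\Omega)$ means $\sup_{t>0}t^p|\{x\in\Omega:|f(x)|>t\}|<\infty$. In particular $L^{p,p}=L^p$. *)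

theory Defs
  imports "HOL-Analysis.Analysis"
begin

definition regular_domain :: "(real^2) set \<Rightarrow> bool" where
  "regular_domain \<Omega> \<longleftrightarrow> open \<Omega> \<and> bounded \<Omega> \<and> connected \<Omega> \<and> \<Omega> \<noteq> {} \<and>
     frontier \<Omega> \<in> null_sets lebesgue"

definition mat2 :: "real \<Rightarrow> real \<Rightarrow> real \<Rightarrow> real \<Rightarrow> real^2^2" where
  "mat2 a b c d = vector [vector [a, b], vector [c, d]]"

definition U_set :: "real \<Rightarrow> real \<Rightarrow> real \<Rightarrow> (real^2^2) set" where
  "U_set abar \<delta> \<gamma> = {mat2 a b (- c) d | a b c d.
     a > abar \<and> d > abar \<and> \<bar>1 - a / d\<bar> < \<delta> \<and> \<bar>1 - b\<bar> < \<gamma> \<and> \<bar>1 - c\<bar> < \<gamma>}"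

fun C_k :: "nat \<Rightarrow> (real^'n \<Rightarrow> real) \<Rightarrow> bool" where
  "C_k 0 f \<longleftrightarrow> continuous_on UNIV f"
| "C_k (Suc k) f \<longleftrightarrow> (\<forall>x. f differentiable (at x)) \<and>
     (\<forall>v. C_k k (\<lambda>x. frechet_derivative f (at x) v))"

text \<open>Elements of \<open>C\<^sub>c\<^sup>\<infinity>(\<Omega>)\<close> are represented by their extension by zero to the whole space.\<close>

definition test_function :: "(real^'n) set \<Rightarrow> (real^'n \<Rightarrow> real) \<Rightarrow> bool" where
  "test_function \<Omega> \<phi> \<longleftrightarrow> (\<forall>k. C_k k \<phi>) \<and>
     compact (closure {x. \<phi> x \<noteq> 0}) \<and> closure {x. \<phi> x \<noteq> 0} \<subseteq> \<Omega>"

definition gradient :: "(real^'n \<Rightarrow> real) \<Rightarrow> real^'n \<Rightarrow> real^'n" where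
  "gradient \<phi> x = (\<chi> i. frechet_derivative \<phi> (at x) (axis i 1))"

definition locally_integrable ::
  "(real^'n) set \<Rightarrow> (real^'n \<Rightarrow> 'b::euclidean_space) \<Rightarrow> bool" where
  "locally_integrable \<Omega> f \<longleftrightarrow> (\<forall>K. compact K \<and> K \<subseteq> \<Omega> \<longrightarrow> set_integrable lebesgue K f)"

text \<open>A weak gradient is determined only up to null sets, so it is expressed as a relation
  between \<open>u\<close> and a representative \<open>G\<close>; values outside \<open>\<Omega>\<close> are irrelevant.\<close>

definition weak_gradient ::
  "(real^'n) set \<Rightarrow> (real^'n \<Rightarrow> real) \<Rightarrow> (real^'n \<Rightarrow> real^'n) \<Rightarrow> bool" where
  "weak_gradient \<Omega> u G \<longleftrightarrow> locally_integrable \<Omega> u \<and> locally_integrable \<Omega> G \<and>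
     (\<forall>\<phi>. test_function \<Omega> \<phi> \<longrightarrow>
        (LINT x:\<Omega>|lebesgue. u x *\<^sub>R gradient \<phi> x) = - (LINT x:\<Omega>|lebesgue. \<phi> x *\<^sub>R G x))"

definition distributional_div ::
  "(real^'n) set \<Rightarrow> (real^'n \<Rightarrow> real^'n) \<Rightarrow> (real^'n \<Rightarrow> real) \<Rightarrow> bool" where
  "distributional_div \<Omega> F g \<longleftrightarrow> locally_integrable \<Omega> F \<and> locally_integrable \<Omega> g \<and>
     (\<forall>\<phi>. test_function \<Omega> \<phi> \<longrightarrow>
        (LINT x:\<Omega>|lebesgue. F x \<bullet> gradient \<phi> x) = - (LINT x:\<Omega>|lebesgue. g x * \<phi> x))"

definition in_Lp ::
  "real \<Rightarrow> (real^'n) set \<Rightarrow> (real^'n \<Rightarrow> 'b::euclidean_space) \<Rightarrow> bool" where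
  "in_Lp p \<Omega> f \<longleftrightarrow> set_borel_measurable lebesgue \<Omega> f \<and>
     set_integrable lebesgue \<Omega> (\<lambda>x. norm (f x) powr p)"

definition in_W1p :: "real \<Rightarrow> (real^'n) set \<Rightarrow> (real^'n \<Rightarrow> real) \<Rightarrow> bool" where
  "in_W1p p \<Omega> u \<longleftrightarrow> in_Lp p \<Omega> u \<and> (\<exists>G. weak_gradient \<Omega> u G \<and> in_Lp p \<Omega> G)"

definition holder_on ::
  "real \<Rightarrow> (real^'n) set \<Rightarrow> (real^'n \<Rightarrow> real) \<Rightarrow> bool" where
  "holder_on \<alpha> S u \<longleftrightarrow> bounded (u ` S) \<and>
     (\<exists>C. \<forall>x\<in>S. \<forall>y\<in>S. \<bar>u x - u y\<bar> \<le> C * dist x y powr \<alpha>)"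

text \<open>\<open>measure\<close> is \<open>0\<close> on sets of infinite measure, hence the separate finiteness clause; it is
  implied by finiteness of the extended-valued integral.\<close>

definition in_Lorentz ::
  "real \<Rightarrow> real \<Rightarrow> (real^'n) set \<Rightarrow> (real^'n \<Rightarrow> 'b::euclidean_space) \<Rightarrow> bool" where
  "in_Lorentz p r \<Omega> f \<longleftrightarrow> set_borel_measurable lebesgue \<Omega> f \<and>
     (\<forall>t>0. emeasure lebesgue {x\<in>\<Omega>. norm (f x) > t} < \<infinity>) \<and>
     (\<integral>\<^sup>+ t\<in>{0<..}. ennreal (measure lebesgue {x\<in>\<Omega>. norm (f x) > t} powr (r / p)
        * t powr r / t) \<partial>lborel) < \<infinity>"

definition in_weak_Lp ::
  "real \<Rightarrow> (real^'n) set \<Rightarrow> (real^'n \<Rightarrow> 'b::euclidean_space) \<Rightarrow> bool" where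
  "in_weak_Lp p \<Omega> f \<longleftrightarrow> set_borel_measurable lebesgue \<Omega> f \<and>
     (SUP t\<in>{0<..}. ennreal (t powr p) * emeasure lebesgue {x\<in>\<Omega>. norm (f x) > t}) < \<infinity>"

end

theory Submission
  imports Defs
begin

text \<open>Write \<open>p = 2 \<Lambda> / (\<Lambda> - 1)\<close>.  A diagonal matrix field with entries \<open>\<lambda>\<^sub>1, \<lambda>\<^sub>2\<close> solves
\<open>div (A \<nabla>u) = 0\<close> as soon as \<open>A \<nabla>u\<close> is the rotated gradient \<open>(v\<^sub>y, - v\<^sub>x)\<close> of some function \<open>v\<close>.
So it suffices to find a pair \<open>(u, v)\<close> for which both quotients \<open>v\<^sub>y / u\<^sub>x\<close> and \<open>- v\<^sub>x / u\<^sub>y\<close> lie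
in \<open>[1/\<Lambda>, \<Lambda>]\<close> almost everywhere; they are then taken as \<open>\<lambda>\<^sub>1\<close> and \<open>\<lambda>\<^sub>2\<close>.

The pair is built as a staircase.  It starts affine on \<open>\<Omega>\<close>, with \<open>(u\<^sub>x, v\<^sub>y) = (a, a + 1)\<close> and
\<open>u\<^sub>y = - v\<^sub>x = b\<close>, where \<open>(a, b)\<close> is the gradient of the boundary datum.  Before stage \<open>k\<close> there is
an open set \<open>U\<^sub>k\<close> on which one of \<open>u\<^sub>x, v\<^sub>y\<close> (they alternate) equals \<open>a + k\<close> and the other one
\<open>a + k + 1\<close>.  The smaller one is split: on an open part \<open>U\<^sub>k\<^sub>+\<^sub>1\<close> of \<open>U\<^sub>k\<close> it is raised to
\<open>a + k + 2\<close>, and on the rest it drops to \<open>(a + k + 1) / \<Lambda>\<close>.  There the quotient \<open>v\<^sub>y / u\<^sub>x\<close> is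
exactly \<open>\<Lambda>\<close> or \<open>1 / \<Lambda>\<close>, and nothing is changed any more.  Since the modification has mean
zero, the part kept has the fraction \<open>y\<^sub>k / (y\<^sub>k + p)\<close> of the area, with
\<open>y\<^sub>k = a + k + 1 - \<Lambda> / (\<Lambda> - 1)\<close>.  By Bernoulli's inequality the product of these fractions lies
between two multiples of \<open>k\<close> to the power \<open>- p\<close> (\<open>mass_lower\<close>, \<open>mass_upper\<close>), while \<open>|\<nabla>u|\<close> is
comparable to \<open>k\<close> on the part that stops at stage \<open>k\<close>.  Hence \<open>|{|\<nabla>u| > t}|\<close> is comparable to
\<open>t\<close> to the power \<open>- p\<close> for large \<open>t\<close>, which is membership in the weak space and excludes all Lorentz spaces with
finite second exponent.

A single splitting changes only one of the two functions, so it is a scalar problem: find a small Lipschitz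
function vanishing outside a given open set whose derivative in one direction takes two
prescribed values of opposite sign and whose derivative in the other direction is at most
\<open>\<epsilon>\<close> in modulus.  The tent \<open>min (1 + s z\<^sub>i) (1 - s' z\<^sub>i) - \<epsilon> |z\<^sub>j|\<close> does this exactly on the kite where it
is positive, and by Vitali's theorem scaled copies of the kite fill the open set up to a null
set (\<open>kite_splitting\<close>).  The transversal errors \<open>\<epsilon>\<^sub>k\<close> are summable with a sum so small that
\<open>- v\<^sub>x / u\<^sub>y\<close> stays in \<open>[1/\<Lambda>, \<Lambda>]\<close>.  The amplitudes can be chosen as small as one likes, which
makes the limit Hoelder continuous without affecting the estimates for its gradient.

The infinite sums have the sums of the gradients as weak gradients because the \<open>L\<^sup>1\<close> norms of
the latter are summable (\<open>whole_weak_gradient_suminf\<close>), and the rotated weak gradient of \<open>v\<close> is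
divergence free because weak gradients are curl free (\<open>whole_weak_gradient_curl_free\<close>).\<close>

section \<open>Weak gradients on the whole space\<close>

lemma difference_quotient_LIMSEQ:
  fixes F :: "'a::euclidean_space \<Rightarrow> real"
  assumes "(F has_derivative (\<lambda>h. v \<bullet> h)) (at x)"
  shows "(\<lambda>n. (F (x + (1 / real (Suc n)) *\<^sub>R e) - F x) * real (Suc n)) \<longlonglongrightarrow> v \<bullet> e"
proof -
  have "((\<lambda>h. F (x + h *\<^sub>R e)) has_derivative (\<lambda>h. v \<bullet> (h *\<^sub>R e))) (at 0)"
    by (rule has_derivative_compose[where f="\<lambda>h. x + h *\<^sub>R e" and g = F and x=0])
      (use assms in \<open>auto intro!: derivative_eq_intros\<close>)
  then have "((\<lambda>h. F (x + h *\<^sub>R e)) has_field_derivative (v \<bullet> e)) (at 0)"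
    by (simp add: has_field_derivative_def mult_commute_abs)
  then have "((\<lambda>h. (F (x + h *\<^sub>R e) - F x) / h) \<longlongrightarrow> v \<bullet> e) (at 0)"
    by (simp add: DERIV_def)
  moreover have "filterlim (\<lambda>n. 1 / real (Suc n)) (at 0) sequentially"
    using LIMSEQ_Suc[OF lim_inverse_n'] by (auto simp: filterlim_at)
  ultimately have "(\<lambda>n. (F (x + (1 / real (Suc n)) *\<^sub>R e) - F x) / (1 / real (Suc n))) \<longlonglongrightarrow> v \<bullet> e"
    by (rule filterlim_compose)
  then show ?thesis by simp
qed

lemma difference_quotient_bound:
  fixes F :: "'a::real_normed_vector \<Rightarrow> real"
  assumes "\<And>x y. \<bar>F x - F y\<bar> \<le> L * norm (x - y)"
  shows "\<bar>(F (x + (1 / real (Suc n)) *\<^sub>R e) - F x) * real (Suc n)\<bar> \<le> L * norm e"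
proof -
  have "\<bar>F (x + (1 / real (Suc n)) *\<^sub>R e) - F x\<bar> \<le> L * (norm e / real (Suc n))"
    using assms[of "x + (1 / real (Suc n)) *\<^sub>R e" x] by simp
  then have "\<bar>F (x + (1 / real (Suc n)) *\<^sub>R e) - F x\<bar> * real (Suc n) \<le> L * (norm e / real (Suc n)) * real (Suc n)"
    by (rule mult_right_mono) simp
  then show ?thesis by (simp add: abs_mult)
qed

text \<open>The integral of a translate of \<open>F\<close> is that of \<open>F\<close>, so all difference quotients of \<open>F\<close> have integral
zero, and they are dominated by the Lipschitz constant on a ball.  No integration along lines is
involved, which is why a derivative almost everywhere is enough.\<close>

lemma integral_derivative_zero:
  fixes F :: "'a::euclidean_space \<Rightarrow> real"
  assumes lip: "\<And>x y. \<bar>F x - F y\<bar> \<le> L * norm (x - y)"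
    and supp: "\<And>x. R < norm x \<Longrightarrow> F x = 0"
    and der: "AE x in lborel. (F has_derivative (\<lambda>h. g x \<bullet> h)) (at x)"
    and g: "g \<in> borel_measurable borel"
  shows "(\<integral>x. g x \<bullet> e \<partial>lborel) = 0"
proof -
  have L: "0 \<le> L * norm e"
    using lip[of e 0] by auto
  have "L-lipschitz_on UNIV F" if "0 \<le> L"
    using lip that by (auto simp: lipschitz_on_def dist_norm)
  moreover have "F = (\<lambda>x. F 0)" if "L < 0"
  proof
    fix x show "F x = F 0"
      using lip[of x 0] that by (smt (verit) mult_nonneg_nonneg norm_ge_zero mult_nonpos_nonneg)
  qed
  ultimately have contF: "continuous_on UNIV F"
    by (metis continuous_on_const lipschitz_on_continuous_on not_le)
  then have F[measurable]: "F \<in> borel_measurable borel"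
    by (simp add: borel_measurable_continuous_onI)
  define D where "D n x = (F (x + (1 / real (Suc n)) *\<^sub>R e) - F x) * real (Suc n)" for n x
  have F_int: "integrable lborel F"
  proof -
    have "integrable lborel (\<lambda>x. indicator (cball 0 R) x *\<^sub>R F x)"
      by (rule borel_integrable_compact)
        (auto intro: continuous_on_subset[OF contF])
    also have "(\<lambda>x. indicator (cball 0 R) x *\<^sub>R F x) = F"
      using supp by (auto simp: indicator_def fun_eq_iff)
    finally show ?thesis .
  qed
  have shift: "integrable lborel (\<lambda>x. F (x + c))" "(\<integral>x. F (x + c) \<partial>lborel) = (\<integral>x. F x \<partial>lborel)" for c
  proof -
    have "integrable (distr lborel borel ((+) c)) F" using F_int by (simp add: lborel_distr_plus)
    then show "integrable lborel (\<lambda>x. F (x + c))"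
      by (subst (asm) integrable_distr_eq) (auto simp: add.commute)
    have "(\<integral>x. F x \<partial>lborel) = (\<integral>x. F x \<partial>distr lborel borel ((+) c))" by (simp add: lborel_distr_plus)
    also have "\<dots> = (\<integral>x. F (c + x) \<partial>lborel)" by (subst integral_distr) auto
    finally show "(\<integral>x. F (x + c) \<partial>lborel) = (\<integral>x. F x \<partial>lborel)" by (simp add: add.commute)
  qed
  have D0: "(\<integral>x. D n x \<partial>lborel) = 0" for n
    unfolding D_def using shift[of "(1 / real (Suc n)) *\<^sub>R e"] F_int by simp
  have bound: "norm (D n x) \<le> L * norm e * indicator (cball 0 (R + norm e)) x" for n x
  proof (cases "norm x \<le> R + norm e")
    case True
    have "norm (D n x) \<le> L * norm e"
      unfolding D_def real_norm_def by (rule difference_quotient_bound[OF lip])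
    then show ?thesis using True by simp
  next
    case False
    have "norm ((1 / real (Suc n)) *\<^sub>R e) \<le> norm e" by (simp add: divide_le_eq mult_left_le field_simps)
    then have "norm (x + (1 / real (Suc n)) *\<^sub>R e) > R"
      using False norm_triangle_ineq2[of x "-((1 / real (Suc n)) *\<^sub>R e)"] by (simp only: norm_minus_cancel) simp
    moreover have "norm x > R" using False norm_ge_zero[of e] by linarith
    ultimately have "D n x = 0" unfolding D_def using supp by auto
    then show ?thesis using False by simp
  qed
  have lim: "AE x in lborel. (\<lambda>n. D n x) \<longlonglongrightarrow> g x \<bullet> e"
    using der unfolding D_def by eventually_elim (rule difference_quotient_LIMSEQ)
  have "(\<lambda>n. \<integral>x. D n x \<partial>lborel) \<longlonglongrightarrow> (\<integral>x. g x \<bullet> e \<partial>lborel)"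
  proof (rule integral_dominated_convergence[where w="\<lambda>x. L * norm e * indicator (cball 0 (R + norm e)) x"])
    show "integrable lborel (\<lambda>x::'a. L * norm e * indicator (cball 0 (R + norm e)) x)"
      using emeasure_bounded_finite[of "cball (0::'a) (R + norm e)"]
      by (intro integrable_mult_right integrable_real_indicator) auto
    show "(\<lambda>x. g x \<bullet> e) \<in> borel_measurable lborel" using g by measurable
    show "D n \<in> borel_measurable lborel" for n
      unfolding D_def by measurable
  qed (use lim bound in auto)
  then show ?thesis using D0 by (simp add: LIMSEQ_const_iff)
qed

text \<open>The class of functions against which weak gradients on the whole space are tested.  The decay at
infinity is left to the differentiated functions, so that the constant \<open>1\<close> is among the tests and
weak gradients have mean zero; this is how areas are computed later on.\<close>

definition tame :: "(real^'n \<Rightarrow> real) \<Rightarrow> bool" where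
  "tame \<psi> \<longleftrightarrow> (\<forall>x. \<psi> differentiable (at x)) \<and> continuous_on UNIV (gradient \<psi>) \<and>
     (\<exists>B. \<forall>x. \<bar>\<psi> x\<bar> \<le> B \<and> norm (gradient \<psi> x) \<le> B)"

lemma has_derivative_gradient:
  fixes \<psi> :: "real^'n \<Rightarrow> real"
  assumes "\<psi> differentiable (at x)"
  shows "(\<psi> has_derivative (\<lambda>h. gradient \<psi> x \<bullet> h)) (at x)"
proof -
  let ?D = "frechet_derivative \<psi> (at x)"
  have D: "(\<psi> has_derivative ?D) (at x)"
    using assms frechet_derivative_works by blast
  then interpret bounded_linear ?D by (rule has_derivative_bounded_linear)
  have "?D h = gradient \<psi> x \<bullet> h" for h
  proof -
    have "?D h = ?D (\<Sum>i\<in>UNIV. h $ i *\<^sub>R axis i 1)"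
      using basis_expansion[of h] by (simp add: scalar_mult_eq_scaleR)
    also have "\<dots> = (\<Sum>i\<in>UNIV. h $ i * ?D (axis i 1))"
      by (simp add: sum scaleR)
    finally show ?thesis by (simp add: inner_vec_def gradient_def mult.commute)
  qed
  with D show ?thesis by (metis (no_types, lifting) ext)
qed

lemma gradient_eqI:
  fixes \<psi> :: "real^'n \<Rightarrow> real"
  assumes "(\<psi> has_derivative (\<lambda>h. v \<bullet> h)) (at x)"
  shows "gradient \<psi> x = v"
proof -
  have "frechet_derivative \<psi> (at x) = (\<lambda>h. v \<bullet> h)"
    using frechet_derivative_at[OF assms] by simp
  then show ?thesis by (simp add: gradient_def vec_eq_iff inner_axis)
qed

lemma tame_lipschitz:
  fixes \<psi> :: "real^'n \<Rightarrow> real"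
  assumes "tame \<psi>"
  obtains B where "0 \<le> B" "\<And>x. \<bar>\<psi> x\<bar> \<le> B" "\<And>x. norm (gradient \<psi> x) \<le> B"
    "\<And>x y. \<bar>\<psi> x - \<psi> y\<bar> \<le> B * norm (x - y)"
proof -
  from assms obtain B where d: "\<And>x. \<psi> differentiable (at x)"
    and B: "\<And>x. \<bar>\<psi> x\<bar> \<le> B" "\<And>x. norm (gradient \<psi> x) \<le> B" by (auto simp: tame_def)
  have "norm (\<psi> x - \<psi> y) \<le> B * norm (x - y)" for x y
  proof (rule differentiable_bound[of UNIV \<psi> "\<lambda>x h. gradient \<psi> x \<bullet> h"])
    show "onorm (\<lambda>h. gradient \<psi> x \<bullet> h) \<le> B" for x
    proof (rule onorm_le)
      fix h
      have "norm (gradient \<psi> x \<bullet> h) \<le> norm (gradient \<psi> x) * norm h"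
        by (simp add: Cauchy_Schwarz_ineq2)
      also have "\<dots> \<le> B * norm h" by (rule mult_right_mono[OF B(2)]) simp
      finally show "norm (gradient \<psi> x \<bullet> h) \<le> B * norm h" .
    qed
  qed (auto simp: has_derivative_gradient[OF d])
  with B show ?thesis by (intro that[of B]) (auto intro: order_trans[OF norm_ge_zero B(2)])
qed

lemma tame_measurable:
  assumes "tame \<psi>"
  shows "\<psi> \<in> borel_measurable borel" "gradient \<psi> \<in> borel_measurable borel"
proof -
  have "continuous_on UNIV \<psi>"
    using assms by (auto simp: tame_def intro!: differentiable_imp_continuous_on simp: differentiable_on_def)
  then show "\<psi> \<in> borel_measurable borel" by (rule borel_measurable_continuous_onI)
  show "gradient \<psi> \<in> borel_measurable borel"
    using assms by (auto simp: tame_def intro!: borel_measurable_continuous_onI)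
qed

definition whole_weak_gradient :: "(real^'n \<Rightarrow> real) \<Rightarrow> (real^'n \<Rightarrow> real^'n) \<Rightarrow> bool" where
  "whole_weak_gradient \<phi> g \<longleftrightarrow> integrable lborel \<phi> \<and> integrable lborel g \<and>
     (\<forall>\<psi>. tame \<psi> \<longrightarrow> (\<integral>x. \<phi> x *\<^sub>R gradient \<psi> x \<partial>lborel) = - (\<integral>x. \<psi> x *\<^sub>R g x \<partial>lborel))"

lemma integrable_bounded_scaleR:
  fixes f :: "'a::euclidean_space \<Rightarrow> 'b::euclidean_space"
  assumes "integrable lborel \<phi>" "f \<in> borel_measurable borel" "\<And>x. norm (f x) \<le> B"
  shows "integrable lborel (\<lambda>x. (\<phi> x :: real) *\<^sub>R f x)"
proof (rule Bochner_Integration.integrable_bound[of _ "\<lambda>x. B * \<phi> x"])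
  show "integrable lborel (\<lambda>x. B * \<phi> x)" using assms by simp
  show "(\<lambda>x. \<phi> x *\<^sub>R f x) \<in> borel_measurable lborel"
    using assms(1,2) borel_measurable_integrable[OF assms(1)] by measurable
  have "0 \<le> B" using assms(3) norm_ge_zero order_trans by blast
  show "AE x in lborel. norm (\<phi> x *\<^sub>R f x) \<le> norm (B * \<phi> x)"
    using assms(3) \<open>0 \<le> B\<close> by (auto intro!: AE_I2 simp: abs_mult mult.commute[of _ "\<bar>\<phi> _\<bar>"] intro: mult_left_mono)
qed

lemma integrable_bounded_scaleR':
  fixes g :: "'a::euclidean_space \<Rightarrow> 'b::euclidean_space"
  assumes "integrable lborel g" "f \<in> borel_measurable borel" "\<And>x. \<bar>f x\<bar> \<le> B"
  shows "integrable lborel (\<lambda>x. (f x :: real) *\<^sub>R g x)"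
proof (rule Bochner_Integration.integrable_bound[of _ "\<lambda>x. B *\<^sub>R g x"])
  show "integrable lborel (\<lambda>x. B *\<^sub>R g x)" using assms by simp
  show "(\<lambda>x. f x *\<^sub>R g x) \<in> borel_measurable lborel"
    using assms(1,2) borel_measurable_integrable[OF assms(1)] by measurable
  have "0 \<le> B" using assms(3) abs_ge_zero order_trans by blast
  show "AE x in lborel. norm (f x *\<^sub>R g x) \<le> norm (B *\<^sub>R g x)"
    using assms(3) \<open>0 \<le> B\<close> by (auto intro!: AE_I2 simp: mult_right_mono)
qed

text \<open>The product \<open>\<phi> \<psi>\<close> is Lipschitz with bounded support, hence its gradient \<open>\<psi> g + \<phi> \<nabla>\<psi>\<close> has integral zero.\<close>

lemma whole_weak_gradient_lipschitz:
  fixes \<phi> :: "real^'n \<Rightarrow> real"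
  assumes lip: "\<And>x y. \<bar>\<phi> x - \<phi> y\<bar> \<le> L * norm (x - y)"
    and bd: "\<And>x. \<bar>\<phi> x\<bar> \<le> M" "\<And>x. norm (g x) \<le> M"
    and supp: "\<And>x. R < norm x \<Longrightarrow> \<phi> x = 0" "\<And>x. R < norm x \<Longrightarrow> g x = 0"
    and der: "AE x in lborel. (\<phi> has_derivative (\<lambda>h. g x \<bullet> h)) (at x)"
    and \<phi>[measurable]: "\<phi> \<in> borel_measurable borel" and g[measurable]: "g \<in> borel_measurable borel"
  shows "whole_weak_gradient \<phi> g"
proof -
  have fin: "emeasure lborel (cball (0::real^'n) R) < \<infinity>"
    by (rule emeasure_bounded_finite) auto
  have i1: "integrable lborel \<phi>"
  proof (rule Bochner_Integration.integrable_bound[of _ "\<lambda>x. M * indicator (cball 0 R) x"])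
    show "AE x in lborel. norm (\<phi> x) \<le> norm (M * indicator (cball 0 R) x)"
      using bd(1) supp(1) by (intro AE_I2) (auto simp: indicator_def not_le intro: order_trans[OF _ abs_ge_self])
  qed (auto intro!: integrable_mult_right integrable_real_indicator simp: fin[simplified])
  have i2: "integrable lborel g"
  proof (rule Bochner_Integration.integrable_bound[of _ "\<lambda>x. M * indicator (cball 0 R) x"])
    show "AE x in lborel. norm (g x) \<le> norm (M * indicator (cball 0 R) x)"
      using bd(2) supp(2) by (intro AE_I2) (auto simp: indicator_def not_le intro: order_trans[OF _ abs_ge_self])
  qed (auto intro!: integrable_mult_right integrable_real_indicator simp: fin[simplified])
  have "(\<integral>x. \<phi> x *\<^sub>R gradient \<psi> x \<partial>lborel) = - (\<integral>x. \<psi> x *\<^sub>R g x \<partial>lborel)" if t: "tame \<psi>" for \<psi>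
  proof -
    obtain B where B: "0 \<le> B" "\<And>x. \<bar>\<psi> x\<bar> \<le> B" "\<And>x. norm (gradient \<psi> x) \<le> B"
      "\<And>x y. \<bar>\<psi> x - \<psi> y\<bar> \<le> B * norm (x - y)" by (rule tame_lipschitz[OF t]) blast
    note [measurable] = tame_measurable[OF t]
    define F where "F x = \<phi> x * \<psi> x" for x
    define G where "G x = \<psi> x *\<^sub>R g x + \<phi> x *\<^sub>R gradient \<psi> x" for x
    have M: "0 \<le> M" using bd(1) abs_ge_zero order_trans by blast
    have "\<bar>F x - F y\<bar> \<le> (M * B + B * L) * norm (x - y)" for x y
    proof -
      have "F x - F y = \<phi> x * (\<psi> x - \<psi> y) + \<psi> y * (\<phi> x - \<phi> y)"
        by (simp add: F_def algebra_simps)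
      then have "\<bar>F x - F y\<bar> \<le> \<bar>\<phi> x\<bar> * \<bar>\<psi> x - \<psi> y\<bar> + \<bar>\<psi> y\<bar> * \<bar>\<phi> x - \<phi> y\<bar>"
        by (metis abs_mult abs_triangle_ineq)
      also have "\<dots> \<le> M * (B * norm (x - y)) + B * (L * norm (x - y))"
        by (intro add_mono mult_mono bd B lip M) auto
      finally show ?thesis by (simp add: algebra_simps)
    qed
    then have z: "(\<integral>x. G x \<bullet> e \<partial>lborel) = 0" for e
    proof (rule integral_derivative_zero[of F _ R])
      show "AE x in lborel. (F has_derivative (\<lambda>h. G x \<bullet> h)) (at x)"
        using der
      proof eventually_elim
        case (elim x)
        have "(\<psi> has_derivative (\<lambda>h. gradient \<psi> x \<bullet> h)) (at x)"
          using t by (auto simp: tame_def intro: has_derivative_gradient)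
        then show ?case unfolding F_def G_def
          by (auto intro!: derivative_eq_intros elim simp: inner_add_left algebra_simps)
      qed
      show "G \<in> borel_measurable borel" unfolding G_def by measurable
    qed (auto simp: F_def supp)
    have j1: "integrable lborel (\<lambda>x. \<psi> x *\<^sub>R g x)"
      by (rule integrable_bounded_scaleR'[OF i2 _ B(2)]) measurable
    have j2: "integrable lborel (\<lambda>x. \<phi> x *\<^sub>R gradient \<psi> x)"
      by (rule integrable_bounded_scaleR[OF i1 _ B(3)]) measurable
    have "(\<integral>x. G x \<partial>lborel) \<bullet> e = 0" for e
      using z[of e] Bochner_Integration.integrable_add[OF j1 j2] by (subst integral_inner_left[symmetric]) (auto simp: G_def[abs_def])
    then have "(\<integral>x. G x \<partial>lborel) = 0" by (metis inner_eq_zero_iff)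
    then show ?thesis using j1 j2 by (simp add: G_def add_eq_0_iff)
  qed
  with i1 i2 show ?thesis by (auto simp: whole_weak_gradient_def)
qed

text \<open>Both sides of the defining identity may be summed term by term, since a tame function and its
gradient are bounded.\<close>

lemma whole_weak_gradient_suminf:
  fixes \<phi> :: "nat \<Rightarrow> real^'n \<Rightarrow> real"
  assumes w: "\<And>k. whole_weak_gradient (\<phi> k) (g k)"
    and s1: "AE x in lborel. summable (\<lambda>k. \<bar>\<phi> k x\<bar>)" and s2: "AE x in lborel. summable (\<lambda>k. norm (g k x))"
    and t1: "summable (\<lambda>k. \<integral>x. \<bar>\<phi> k x\<bar> \<partial>lborel)" and t2: "summable (\<lambda>k. \<integral>x. norm (g k x) \<partial>lborel)"
  shows "whole_weak_gradient (\<lambda>x. \<Sum>k. \<phi> k x) (\<lambda>x. \<Sum>k. g k x)"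
proof -
  have i: "integrable lborel (\<phi> k)" "integrable lborel (g k)" for k
    using w by (auto simp: whole_weak_gradient_def)
  have "(\<integral>x. (\<Sum>k. \<phi> k x) *\<^sub>R gradient \<psi> x \<partial>lborel) = - (\<integral>x. \<psi> x *\<^sub>R (\<Sum>k. g k x) \<partial>lborel)"
    if t: "tame \<psi>" for \<psi>
  proof -
    obtain B where B: "0 \<le> B" "\<And>x. \<bar>\<psi> x\<bar> \<le> B" "\<And>x. norm (gradient \<psi> x) \<le> B"
      by (rule tame_lipschitz[OF t]) blast
    note m[measurable] = tame_measurable[OF t]
    have j1: "integrable lborel (\<lambda>x. \<phi> k x *\<^sub>R gradient \<psi> x)" for k
      by (rule integrable_bounded_scaleR[OF i(1) m(2) B(3)])
    have j2: "integrable lborel (\<lambda>x. \<psi> x *\<^sub>R g k x)" for k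
      by (rule integrable_bounded_scaleR'[OF i(2) m(1) B(2)])
    have a1: "AE x in lborel. summable (\<lambda>k. norm (\<phi> k x *\<^sub>R gradient \<psi> x))"
      using s1 by eventually_elim (simp add: summable_mult2)
    have a2: "AE x in lborel. summable (\<lambda>k. norm (\<psi> x *\<^sub>R g k x))"
      using s2 by eventually_elim (simp add: summable_mult)
    have b1: "summable (\<lambda>k. \<integral>x. norm (\<phi> k x *\<^sub>R gradient \<psi> x) \<partial>lborel)"
    proof (rule summable_comparison_test'[OF summable_mult[OF t1, of B]])
      fix k
      have "(\<integral>x. norm (\<phi> k x *\<^sub>R gradient \<psi> x) \<partial>lborel) \<le> (\<integral>x. B * \<bar>\<phi> k x\<bar> \<partial>lborel)"
      proof (rule integral_mono)
        show "norm (\<phi> k x *\<^sub>R gradient \<psi> x) \<le> B * \<bar>\<phi> k x\<bar>" for x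
          using mult_right_mono[OF B(3)[of x], of "\<bar>\<phi> k x\<bar>"] by (simp add: mult.commute)
      qed (auto intro!: integrable_norm j1 integrable_mult_right integrable_abs i simp del: norm_scaleR)
      then show "norm (\<integral>x. norm (\<phi> k x *\<^sub>R gradient \<psi> x) \<partial>lborel) \<le> B * (\<integral>x. \<bar>\<phi> k x\<bar> \<partial>lborel)"
        by (simp del: norm_scaleR)
    qed
    have b2: "summable (\<lambda>k. \<integral>x. norm (\<psi> x *\<^sub>R g k x) \<partial>lborel)"
    proof (rule summable_comparison_test'[OF summable_mult[OF t2, of B]])
      fix k
      have "(\<integral>x. norm (\<psi> x *\<^sub>R g k x) \<partial>lborel) \<le> (\<integral>x. B * norm (g k x) \<partial>lborel)"
      proof (rule integral_mono)
        show "norm (\<psi> x *\<^sub>R g k x) \<le> B * norm (g k x)" for x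
          using mult_right_mono[OF B(2)[of x], of "norm (g k x)"] by simp
      qed (auto intro!: integrable_norm j2 integrable_mult_right i simp del: norm_scaleR)
      then show "norm (\<integral>x. norm (\<psi> x *\<^sub>R g k x) \<partial>lborel) \<le> B * (\<integral>x. norm (g k x) \<partial>lborel)"
        by (simp del: norm_scaleR)
    qed
    have "(\<integral>x. (\<Sum>k. \<phi> k x) *\<^sub>R gradient \<psi> x \<partial>lborel) = (\<integral>x. (\<Sum>k. \<phi> k x *\<^sub>R gradient \<psi> x) \<partial>lborel)"
      by (rule integral_cong_AE)
        (use s1 i in \<open>auto intro!: borel_measurable_suminf simp: borel_measurable_integrable m
          intro: suminf_scaleR_left summable_rabs_cancel elim!: eventually_mono\<close>)
    also have "\<dots> = (\<Sum>k. \<integral>x. \<phi> k x *\<^sub>R gradient \<psi> x \<partial>lborel)"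
      by (rule integral_suminf[OF j1 a1 b1])
    also have "\<dots> = (\<Sum>k. - (\<integral>x. \<psi> x *\<^sub>R g k x \<partial>lborel))"
      using w t by (simp add: whole_weak_gradient_def)
    also have "\<dots> = - (\<Sum>k. \<integral>x. \<psi> x *\<^sub>R g k x \<partial>lborel)"
      by (rule suminf_minus) (use sums_integral[OF j2 a2 b2] sums_summable in blast)
    also have "(\<Sum>k. \<integral>x. \<psi> x *\<^sub>R g k x \<partial>lborel) = (\<integral>x. (\<Sum>k. \<psi> x *\<^sub>R g k x) \<partial>lborel)"
      by (rule integral_suminf[OF j2 a2 b2, symmetric])
    also have "\<dots> = (\<integral>x. \<psi> x *\<^sub>R (\<Sum>k. g k x) \<partial>lborel)"
      by (rule integral_cong_AE)
        (use s2 i in \<open>auto intro!: borel_measurable_suminf simp: borel_measurable_integrable m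
          intro: suminf_scaleR_right[symmetric] summable_norm_cancel elim!: eventually_mono\<close>)
    finally show ?thesis .
  qed
  moreover have "integrable lborel (\<lambda>x. \<Sum>k. \<phi> k x)"
    by (rule integrable_suminf[OF i(1)]) (use s1 t1 in auto)
  moreover have "integrable lborel (\<lambda>x. \<Sum>k. g k x)"
    by (rule integrable_suminf[OF i(2) s2 t2])
  ultimately show "whole_weak_gradient (\<lambda>x. \<Sum>k. \<phi> k x) (\<lambda>x. \<Sum>k. g k x)"
    by (auto simp: whole_weak_gradient_def)
qed

lemma tame_difference_quotient:
  fixes \<psi> :: "real^'n \<Rightarrow> real"
  assumes "tame \<psi>"
  shows "tame (\<lambda>x. (\<psi> (x + c) - \<psi> x) * r)"
    and "gradient (\<lambda>x. (\<psi> (x + c) - \<psi> x) * r) x = r *\<^sub>R (gradient \<psi> (x + c) - gradient \<psi> x)"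
proof -
  have d: "((\<lambda>x. (\<psi> (x + c) - \<psi> x) * r) has_derivative
      (\<lambda>h. (r *\<^sub>R (gradient \<psi> (x + c) - gradient \<psi> x)) \<bullet> h)) (at x)" for x
  proof -
    have 1: "(\<psi> has_derivative (\<lambda>h. gradient \<psi> x \<bullet> h)) (at x)" for x
      using assms by (auto simp: tame_def intro: has_derivative_gradient)
    have 2: "((\<lambda>x. \<psi> (x + c)) has_derivative (\<lambda>h. gradient \<psi> (x + c) \<bullet> h)) (at x)"
      by (rule has_derivative_compose[OF _ 1]) (auto intro!: derivative_eq_intros)
    show ?thesis
      by (rule has_derivative_eq_rhs[OF has_derivative_mult_left[OF has_derivative_diff[OF 2 1]]])
        (auto simp: inner_diff_left algebra_simps)
  qed
  show g: "gradient (\<lambda>x. (\<psi> (x + c) - \<psi> x) * r) x = r *\<^sub>R (gradient \<psi> (x + c) - gradient \<psi> x)" for x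
    by (rule gradient_eqI[OF d])
  obtain B where B: "0 \<le> B" "\<And>x. \<bar>\<psi> x\<bar> \<le> B" "\<And>x. norm (gradient \<psi> x) \<le> B"
    by (rule tame_lipschitz[OF assms]) blast
  have "continuous_on UNIV (gradient \<psi>)" using assms by (simp add: tame_def)
  then have "continuous_on UNIV (\<lambda>x. gradient \<psi> (x + c))"
    by (rule continuous_on_compose2) (auto intro!: continuous_intros)
  moreover have "\<bar>(\<psi> (x + c) - \<psi> x) * r\<bar> \<le> 2 * B * \<bar>r\<bar>" for x
    unfolding abs_mult using B(2)[of x] B(2)[of "x + c"] by (intro mult_right_mono) auto
  moreover have "norm (r *\<^sub>R (gradient \<psi> (x + c) - gradient \<psi> x)) \<le> 2 * B * \<bar>r\<bar>" for x
    using norm_triangle_ineq4[of "gradient \<psi> (x + c)" "gradient \<psi> x"] B(3)[of x] B(3)[of "x + c"]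
    by (simp add: mult.commute[of "2 * B"] mult_left_mono)
  ultimately show "tame (\<lambda>x. (\<psi> (x + c) - \<psi> x) * r)"
    unfolding tame_def using assms d
    by (auto simp: differentiable_def g fun_eq_iff tame_def intro!: continuous_intros exI[of _ "2 * B * \<bar>r\<bar>"])
qed

text \<open>Dominated convergence; the quotients are bounded by the Lipschitz constant of \<open>\<psi>\<close>.\<close>

lemma difference_quotient_integral_LIMSEQ:
  fixes \<psi> :: "real^'n \<Rightarrow> real"
  assumes t: "tame \<psi>" and f: "integrable lborel f"
  shows "(\<lambda>n. \<integral>x. f x * ((\<psi> (x + (1 / real (Suc n)) *\<^sub>R e) - \<psi> x) * real (Suc n)) \<partial>lborel)
     \<longlonglongrightarrow> (\<integral>x. f x * (gradient \<psi> x \<bullet> e) \<partial>lborel)"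
proof -
  obtain B where B: "0 \<le> B" "\<And>x y. \<bar>\<psi> x - \<psi> y\<bar> \<le> B * norm (x - y)"
    by (rule tame_lipschitz[OF t]) blast
  note [measurable] = tame_measurable[OF t] borel_measurable_integrable[OF f]
  have f[measurable]: "integrable lborel f" "f \<in> borel_measurable borel" using f by auto
  show ?thesis
  proof (rule integral_dominated_convergence[where w="\<lambda>x. B * norm e * \<bar>f x\<bar>"])
    show "integrable lborel (\<lambda>x. B * norm e * \<bar>f x\<bar>)" using f by auto
    show "AE x in lborel. (\<lambda>n. f x * ((\<psi> (x + (1 / real (Suc n)) *\<^sub>R e) - \<psi> x) * real (Suc n)))
      \<longlonglongrightarrow> f x * (gradient \<psi> x \<bullet> e)"
    proof (intro AE_I2 tendsto_mult tendsto_const)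
      fix x
      show "(\<lambda>n. (\<psi> (x + (1 / real (Suc n)) *\<^sub>R e) - \<psi> x) * real (Suc n)) \<longlonglongrightarrow> gradient \<psi> x \<bullet> e"
        by (rule difference_quotient_LIMSEQ) (use t in \<open>auto simp: tame_def intro: has_derivative_gradient\<close>)
    qed
    show "AE x in lborel. norm (f x * ((\<psi> (x + (1 / real (Suc n)) *\<^sub>R e) - \<psi> x) * real (Suc n)))
         \<le> B * norm e * \<bar>f x\<bar>" for n
    proof (rule AE_I2)
      fix x
      have "\<bar>(\<psi> (x + (1 / real (Suc n)) *\<^sub>R e) - \<psi> x) * real (Suc n)\<bar> \<le> B * norm e"
        by (rule difference_quotient_bound[OF B(2)])
      from mult_left_mono[OF this, of "\<bar>f x\<bar>"]
      show "norm (f x * ((\<psi> (x + (1 / real (Suc n)) *\<^sub>R e) - \<psi> x) * real (Suc n))) \<le> B * norm e * \<bar>f x\<bar>"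
        by (simp only: real_norm_def abs_mult abs_of_nat mult.commute mult.left_commute)
    qed
  qed measurable
qed

text \<open>Formally both sides are minus the integral of \<open>\<phi>\<close> times a mixed second derivative of \<open>\<psi>\<close>.  One of the two derivatives is
first replaced by a difference quotient \<open>D\<^sub>n \<psi>\<close>, for which commutation is obvious: the \<open>j\<close>-th derivative of \<open>D\<^sub>n \<psi>\<close> is the difference quotient of the \<open>j\<close>-th derivative of \<open>\<psi>\<close>.\<close>

lemma whole_weak_gradient_curl_free:
  fixes \<psi> :: "real^'n \<Rightarrow> real"
  assumes w: "whole_weak_gradient \<phi> g" and t: "tame \<psi>" and tj: "tame (\<lambda>x. gradient \<psi> x $ j)"
  shows "(\<integral>x. g x $ j * gradient \<psi> x $ i \<partial>lborel) = (\<integral>x. g x $ i * gradient \<psi> x $ j \<partial>lborel)"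
proof -
  from w have i: "integrable lborel \<phi>" "integrable lborel g" by (auto simp: whole_weak_gradient_def)
  have ij: "integrable lborel (\<lambda>x. g x $ k)" for k
    by (rule integrable_bounded_linear[OF bounded_linear_vec_nth i(2)])
  have weak: "(\<integral>x. \<phi> x * gradient \<eta> x $ k \<partial>lborel) = - (\<integral>x. g x $ k * \<eta> x \<partial>lborel)" if "tame \<eta>" for \<eta> k
  proof -
    obtain B where B: "0 \<le> B" "\<And>x. \<bar>\<eta> x\<bar> \<le> B" "\<And>x. norm (gradient \<eta> x) \<le> B"
      using tame_lipschitz[OF \<open>tame \<eta>\<close>] by metis
    note m = tame_measurable[OF that]
    have "(\<integral>x. \<phi> x *\<^sub>R gradient \<eta> x \<partial>lborel) $ k = - (\<integral>x. \<eta> x *\<^sub>R g x \<partial>lborel) $ k"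
      using w that by (simp add: whole_weak_gradient_def)
    then show ?thesis
      using integral_bounded_linear[OF bounded_linear_vec_nth integrable_bounded_scaleR[OF i(1) m(2) B(3)], of k]
        integral_bounded_linear[OF bounded_linear_vec_nth integrable_bounded_scaleR'[OF i(2) m(1) B(2)], of k]
      by (simp add: mult.commute)
  qed
  define h where "h n = (1 / real (Suc n)) *\<^sub>R (axis i 1 :: real^'n)" for n
  define D where "D n x = (\<psi> (x + h n) - \<psi> x) * real (Suc n)" for n x
  have "tame (D n)" "\<And>x. gradient (D n) x = real (Suc n) *\<^sub>R (gradient \<psi> (x + h n) - gradient \<psi> x)" for n
    unfolding D_def using tame_difference_quotient[OF t] by auto
  with weak[of "D n" j for n] have e: "(\<integral>x. \<phi> x * ((gradient \<psi> (x + h n) $ j - gradient \<psi> x $ j) * real (Suc n)) \<partial>lborel)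
      = - (\<integral>x. g x $ j * D n x \<partial>lborel)" for n
    by (simp add: mult.commute)
  have "(\<lambda>n. \<integral>x. g x $ j * D n x \<partial>lborel) \<longlonglongrightarrow> (\<integral>x. g x $ j * (gradient \<psi> x \<bullet> axis i 1) \<partial>lborel)"
    unfolding D_def h_def by (rule difference_quotient_integral_LIMSEQ[OF t ij])
  moreover have "(\<lambda>n. - (\<integral>x. g x $ j * D n x \<partial>lborel)) \<longlonglongrightarrow> (\<integral>x. \<phi> x * (gradient (\<lambda>x. gradient \<psi> x $ j) x \<bullet> axis i 1) \<partial>lborel)"
    unfolding e[symmetric] h_def by (rule difference_quotient_integral_LIMSEQ[OF tj i(1)])
  ultimately have "(\<integral>x. \<phi> x * (gradient (\<lambda>x. gradient \<psi> x $ j) x \<bullet> axis i 1) \<partial>lborel) = - (\<integral>x. g x $ j * (gradient \<psi> x \<bullet> axis i 1) \<partial>lborel)"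
    using tendsto_minus LIMSEQ_unique by blast
  moreover have "(\<integral>x. \<phi> x * gradient (\<lambda>x. gradient \<psi> x $ j) x $ i \<partial>lborel) = - (\<integral>x. g x $ i * gradient \<psi> x $ j \<partial>lborel)"
    by (rule weak[OF tj])
  ultimately show ?thesis by (simp add: inner_axis)
qed

lemma test_function_gradient_support:
  fixes \<psi> :: "real^'n \<Rightarrow> real"
  assumes "x \<notin> closure {x. \<psi> x \<noteq> 0}"
  shows "gradient \<psi> x = 0"
proof (rule gradient_eqI)
  have "((\<lambda>x. 0) has_derivative (\<lambda>h. 0 \<bullet> h)) (at x :: (real^'n) filter)" by simp
  then show "(\<psi> has_derivative (\<lambda>h. 0 \<bullet> h)) (at x)"
    by (rule has_derivative_transform_within_open[where s="- closure {x. \<psi> x \<noteq> 0}"])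
      (use assms closure_subset[of "{x. \<psi> x \<noteq> 0}"] in auto)
qed

lemma test_function_tame:
  fixes \<psi> :: "real^'n \<Rightarrow> real"
  assumes "test_function \<Omega> \<psi>"
  shows "tame \<psi>"
proof -
  let ?S = "closure {x. \<psi> x \<noteq> 0}"
  have C: "C_k (Suc 0) \<psi>" and S: "compact ?S" using assms unfolding test_function_def by blast+
  from C have d: "\<psi> differentiable (at x)"
    and c: "continuous_on UNIV (\<lambda>x. frechet_derivative \<psi> (at x) v)" for x v by auto
  have c1: "continuous_on UNIV \<psi>"
    using d by (auto intro!: differentiable_imp_continuous_on simp: differentiable_on_def)
  have c2: "continuous_on UNIV (gradient \<psi>)"
    unfolding gradient_def[abs_def] by (intro continuous_on_vec_lambda c)
  obtain B1 where B1: "\<And>x. x \<in> ?S \<Longrightarrow> norm (\<psi> x) \<le> B1"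
    using compact_imp_bounded[OF compact_continuous_image[OF continuous_on_subset[OF c1] S]]
    by (auto simp: bounded_iff)
  obtain B2 where B2: "\<And>x. x \<in> ?S \<Longrightarrow> norm (gradient \<psi> x) \<le> B2"
    using compact_imp_bounded[OF compact_continuous_image[OF continuous_on_subset[OF c2] S]]
    by (auto simp: bounded_iff)
  have "\<bar>\<psi> x\<bar> \<le> \<bar>B1\<bar> + \<bar>B2\<bar> \<and> norm (gradient \<psi> x) \<le> \<bar>B1\<bar> + \<bar>B2\<bar>" for x
  proof (cases "x \<in> ?S")
    case True
    with B1[of x] B2[of x] show ?thesis by auto
  next
    case False
    then have "\<psi> x = 0" using closure_subset[of "{x. \<psi> x \<noteq> 0}"] by auto
    with test_function_gradient_support[OF False] show ?thesis by simp
  qed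
  with d c2 show ?thesis by (auto simp: tame_def)
qed

lemma test_function_gradient:
  fixes \<psi> :: "real^'n \<Rightarrow> real"
  assumes "test_function \<Omega> \<psi>"
  shows "test_function \<Omega> (\<lambda>x. gradient \<psi> x $ i)"
proof -
  have "C_k (Suc k) \<psi>" for k using assms unfolding test_function_def by blast
  then have "C_k k (\<lambda>x. gradient \<psi> x $ i)" for k
    by (auto simp: gradient_def)
  moreover have "{x. gradient \<psi> x $ i \<noteq> 0} \<subseteq> closure {x. \<psi> x \<noteq> 0}"
    using test_function_gradient_support[of _ \<psi>] by fastforce
  then have "closure {x. gradient \<psi> x $ i \<noteq> 0} \<subseteq> closure {x. \<psi> x \<noteq> 0}"
    by (simp add: closure_minimal)
  ultimately show ?thesis using assms unfolding test_function_def
    by (metis (no_types, lifting) closed_closure closed_Int_compact inf.absorb_iff1 order_trans)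
qed

lemma tame_one: "tame (\<lambda>x::real^'n. 1)" and gradient_one: "gradient (\<lambda>x::real^'n. 1) x = 0"
proof -
  have g: "gradient (\<lambda>x::real^'n. 1) x = 0" for x
    by (rule gradient_eqI) simp
  then show "gradient (\<lambda>x::real^'n. 1) x = 0" .
  show "tame (\<lambda>x::real^'n. 1)"
    by (auto simp: tame_def g fun_eq_iff continuous_on_cong[OF refl g] intro!: exI[of _ 1])
qed

text \<open>Test with the constant \<open>1\<close>.\<close>

lemma whole_weak_gradient_integral_0:
  fixes g :: "real^'n \<Rightarrow> real^'n"
  assumes "whole_weak_gradient \<phi> g"
  shows "(\<integral>x. g x \<partial>lborel) = 0"
proof -
  have "(\<integral>x. \<phi> x *\<^sub>R gradient (\<lambda>x. 1) x \<partial>lborel) = - (\<integral>x. 1 *\<^sub>R g x \<partial>lborel)"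
    using assms tame_one unfolding whole_weak_gradient_def by blast
  then show ?thesis by (simp add: gradient_one)
qed

lemma test_function_support:
  fixes \<psi> :: "real^'n \<Rightarrow> real"
  assumes "test_function \<Omega> \<psi>"
  obtains R where "0 \<le> R" "\<And>z. R < norm z \<Longrightarrow> \<psi> z = 0" "\<And>z. R < norm z \<Longrightarrow> gradient \<psi> z = 0"
    "\<And>z. z \<notin> \<Omega> \<Longrightarrow> \<psi> z = 0" "\<And>z. z \<notin> \<Omega> \<Longrightarrow> gradient \<psi> z = 0"
proof -
  let ?S = "closure {z. \<psi> z \<noteq> 0}"
  have S: "compact ?S" "?S \<subseteq> \<Omega>" using assms by (auto simp: test_function_def)
  obtain R where R: "R > 0" "\<And>z. z \<in> ?S \<Longrightarrow> norm z \<le> R"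
    using compact_imp_bounded[OF S(1)] by (auto simp: bounded_pos)
  have z: "\<psi> z = 0" "gradient \<psi> z = 0" if "z \<notin> ?S" for z
    using that closure_subset[of "{z. \<psi> z \<noteq> 0}"] test_function_gradient_support[OF that] by auto
  show ?thesis
  proof (rule that[of R])
    show "\<psi> z = 0" "gradient \<psi> z = 0" if "R < norm z" for z
      using z[of z] R(2)[of z] that by force+
    show "\<psi> z = 0" "gradient \<psi> z = 0" if "z \<notin> \<Omega>" for z
      using z[of z] S(2) that by blast+
  qed (use R(1) in simp)
qed

lemma test_function_weak_gradient:
  fixes \<psi> :: "real^'n \<Rightarrow> real"
  assumes t: "test_function \<Omega> \<psi>"
  shows "whole_weak_gradient \<psi> (gradient \<psi>)"
proof -
  have tm: "tame \<psi>" by (rule test_function_tame[OF t])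
  obtain R where R: "\<And>z. R < norm z \<Longrightarrow> \<psi> z = 0" "\<And>z. R < norm z \<Longrightarrow> gradient \<psi> z = 0"
    by (rule test_function_support[OF t]) blast
  obtain B where B: "\<And>x. \<bar>\<psi> x\<bar> \<le> B" "\<And>x. norm (gradient \<psi> x) \<le> B"
    "\<And>x y. \<bar>\<psi> x - \<psi> y\<bar> \<le> B * norm (x - y)" by (rule tame_lipschitz[OF tm]) blast
  show ?thesis
    by (rule whole_weak_gradient_lipschitz[OF B(3) B(1) B(2) R])
      (use tm tame_measurable[OF tm] in \<open>auto simp: tame_def intro: has_derivative_gradient\<close>)
qed

text \<open>The affine function is unbounded, but it is bounded and Lipschitz where the test function lives, so the
product is again Lipschitz with bounded support.\<close>

lemma affine_weak_gradient:
  fixes \<psi> :: "real^'n \<Rightarrow> real"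
  assumes t: "test_function \<Omega> \<psi>"
  shows "integrable lborel (\<lambda>z. (\<zeta> \<bullet> z + c) *\<^sub>R gradient \<psi> z)"
    and "integrable lborel (\<lambda>z. \<psi> z *\<^sub>R \<zeta>)"
    and "(\<integral>z. (\<zeta> \<bullet> z + c) *\<^sub>R gradient \<psi> z \<partial>lborel) = - (\<integral>z. \<psi> z *\<^sub>R \<zeta> \<partial>lborel)"
proof -
  have tm: "tame \<psi>" by (rule test_function_tame[OF t])
  note [measurable] = tame_measurable[OF tm]
  obtain R where R: "0 \<le> R" "\<And>z. R < norm z \<Longrightarrow> \<psi> z = 0" "\<And>z. R < norm z \<Longrightarrow> gradient \<psi> z = 0"
    by (rule test_function_support[OF t]) blast
  obtain B where B: "0 \<le> B" "\<And>x. \<bar>\<psi> x\<bar> \<le> B" "\<And>x. norm (gradient \<psi> x) \<le> B"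
    "\<And>x y. \<bar>\<psi> x - \<psi> y\<bar> \<le> B * norm (x - y)" by (rule tame_lipschitz[OF tm]) blast
  let ?l = "\<lambda>z. \<zeta> \<bullet> z + c"
  define M where "M = norm \<zeta> * R + \<bar>c\<bar>"
  have M0: "0 \<le> M" using R(1) by (simp add: M_def)
  have M: "\<bar>?l z\<bar> \<le> M" if "norm z \<le> R" for z
  proof -
    have "\<bar>\<zeta> \<bullet> z\<bar> \<le> norm \<zeta> * R"
      using Cauchy_Schwarz_ineq2[of \<zeta> z] mult_left_mono[OF that, of "norm \<zeta>"] norm_ge_zero[of \<zeta>] by linarith
    then show ?thesis by (simp add: M_def)
  qed
  from test_function_weak_gradient[OF t] have i: "integrable lborel \<psi>" "integrable lborel (gradient \<psi>)"
    by (auto simp: whole_weak_gradient_def)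
  show i1: "integrable lborel (\<lambda>z. ?l z *\<^sub>R gradient \<psi> z)"
  proof (rule Bochner_Integration.integrable_bound[of _ "\<lambda>z. M *\<^sub>R gradient \<psi> z"])
    show "AE z in lborel. norm (?l z *\<^sub>R gradient \<psi> z) \<le> norm (M *\<^sub>R gradient \<psi> z)"
    proof (rule AE_I2)
      fix z show "norm (?l z *\<^sub>R gradient \<psi> z) \<le> norm (M *\<^sub>R gradient \<psi> z)"
        using M[of z] R(3)[of z] M0 by (cases "norm z \<le> R") (auto intro: mult_right_mono)
    qed
  qed (use i in auto)
  show i2: "integrable lborel (\<lambda>z. \<psi> z *\<^sub>R \<zeta>)" using i(1) by (rule integrable_scaleR_left)
  define F where "F z = ?l z * \<psi> z" for z
  define D where "D z = \<psi> z *\<^sub>R \<zeta> + ?l z *\<^sub>R gradient \<psi> z" for z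
  have F1: "\<bar>F z - F w\<bar> \<le> (M * B + B * norm \<zeta>) * norm (z - w)" if z: "norm z \<le> R" for z w
  proof -
    have "F z - F w = ?l z * (\<psi> z - \<psi> w) + \<psi> w * (\<zeta> \<bullet> (z - w))"
      by (simp add: F_def algebra_simps inner_diff_right)
    then have "\<bar>F z - F w\<bar> \<le> \<bar>?l z\<bar> * \<bar>\<psi> z - \<psi> w\<bar> + \<bar>\<psi> w\<bar> * \<bar>\<zeta> \<bullet> (z - w)\<bar>"
      by (metis abs_mult abs_triangle_ineq)
    also have "\<dots> \<le> M * (B * norm (z - w)) + B * (norm \<zeta> * norm (z - w))"
      by (intro add_mono mult_mono M z B M0 Cauchy_Schwarz_ineq2) auto
    finally show ?thesis by (simp add: algebra_simps)
  qed
  have "\<bar>F z - F w\<bar> \<le> (M * B + B * norm \<zeta>) * norm (z - w)" for z w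
  proof (cases "norm z \<le> R \<or> norm w \<le> R")
    case True
    then show ?thesis using F1[of z w] F1[of w z] by (auto simp: norm_minus_commute abs_minus_commute)
  next
    case False
    then have "F z = 0" "F w = 0" using R(2) by (auto simp: F_def)
    then show ?thesis using M0 B(1) by simp
  qed
  then have z0: "(\<integral>z. D z \<bullet> e \<partial>lborel) = 0" for e
  proof (rule integral_derivative_zero[of F _ R])
    show "AE z in lborel. (F has_derivative (\<lambda>h. D z \<bullet> h)) (at z)"
    proof (rule AE_I2)
      fix z
      have "(\<psi> has_derivative (\<lambda>h. gradient \<psi> z \<bullet> h)) (at z)"
        using tm by (auto simp: tame_def intro: has_derivative_gradient)
      then show "(F has_derivative (\<lambda>h. D z \<bullet> h)) (at z)" unfolding F_def D_def
        by (auto intro!: derivative_eq_intros simp: inner_add_left algebra_simps)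
    qed
    show "D \<in> borel_measurable borel" unfolding D_def by measurable
  qed (auto simp: F_def R)
  have "(\<integral>z. D z \<partial>lborel) \<bullet> e = 0" for e
    using z0[of e] Bochner_Integration.integrable_add[OF i2 i1] by (subst integral_inner_left[symmetric]) (auto simp: D_def[abs_def])
  then have "(\<integral>z. D z \<partial>lborel) = 0" by (metis inner_eq_zero_iff)
  then show "(\<integral>z. ?l z *\<^sub>R gradient \<psi> z \<partial>lborel) = - (\<integral>z. \<psi> z *\<^sub>R \<zeta> \<partial>lborel)"
    using i1 i2 by (simp add: D_def add_eq_0_iff)
qed

text \<open>All functions constructed below are Borel measurable, which allows one to compute with Lebesgue-Borel
measure instead of its completion.\<close>

lemma set_integrable_lebesgue_borel:
  fixes f :: "'a::euclidean_space \<Rightarrow> 'b::euclidean_space"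
  assumes "f \<in> borel_measurable borel" "S \<in> sets borel"
  shows "set_integrable lebesgue S f \<longleftrightarrow> integrable lborel (\<lambda>z. indicator S z *\<^sub>R f z)"
    and "(LINT z:S|lebesgue. f z) = (\<integral>z. indicator S z *\<^sub>R f z \<partial>lborel)"
    and "set_borel_measurable lebesgue S f"
proof -
  have m: "(\<lambda>z. indicator S z *\<^sub>R f z) \<in> borel_measurable lborel"
    using assms by measurable
  show "set_integrable lebesgue S f \<longleftrightarrow> integrable lborel (\<lambda>z. indicator S z *\<^sub>R f z)"
    unfolding set_integrable_def by (rule integrable_completion[OF m])
  show "(LINT z:S|lebesgue. f z) = (\<integral>z. indicator S z *\<^sub>R f z \<partial>lborel)"
    unfolding set_lebesgue_integral_def by (rule integral_completion[OF m])
  show "set_borel_measurable lebesgue S f"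
    unfolding set_borel_measurable_def using measurable_completion[OF m] .
qed

lemma weak_gradient_affine_plus:
  fixes \<Phi> :: "real^'n \<Rightarrow> real"
  assumes w: "whole_weak_gradient \<Phi> \<Gamma>" and [measurable]: "\<Phi> \<in> borel_measurable borel" "\<Gamma> \<in> borel_measurable borel"
    and \<Omega>: "open \<Omega>"
  shows "weak_gradient \<Omega> (\<lambda>z. \<zeta> \<bullet> z + c + \<Phi> z) (\<lambda>z. \<zeta> + \<Gamma> z)"
  unfolding weak_gradient_def
proof (intro conjI allI impI)
  have i: "integrable lborel \<Phi>" "integrable lborel \<Gamma>" using w by (auto simp: whole_weak_gradient_def)
  have \<Omega>m[measurable]: "\<Omega> \<in> sets borel" using \<Omega> by simp
  show "locally_integrable \<Omega> (\<lambda>z. \<zeta> \<bullet> z + c + \<Phi> z)"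
    unfolding locally_integrable_def
  proof (intro allI impI)
    fix K assume K: "compact K \<and> K \<subseteq> \<Omega>"
    then have [measurable]: "K \<in> sets borel" by (simp add: borel_compact)
    have "integrable lborel (\<lambda>z. indicator K z *\<^sub>R (\<zeta> \<bullet> z + c) + indicator K z *\<^sub>R \<Phi> z)"
      by (intro Bochner_Integration.integrable_add borel_integrable_compact integrable_mult_indicator i)
        (use K in \<open>auto intro!: continuous_intros\<close>)
    then show "set_integrable lebesgue K (\<lambda>z. \<zeta> \<bullet> z + c + \<Phi> z)"
      by (subst set_integrable_lebesgue_borel) (auto simp: distrib_left)
  qed
  show "locally_integrable \<Omega> (\<lambda>z. \<zeta> + \<Gamma> z)"
    unfolding locally_integrable_def
  proof (intro allI impI)
    fix K assume K: "compact K \<and> K \<subseteq> \<Omega>"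
    then have [measurable]: "K \<in> sets borel" by (simp add: borel_compact)
    have "integrable lborel (\<lambda>z. indicator K z *\<^sub>R \<zeta> + indicator K z *\<^sub>R \<Gamma> z)"
      by (intro Bochner_Integration.integrable_add borel_integrable_compact integrable_mult_indicator i)
        (use K in \<open>auto intro!: continuous_intros\<close>)
    then show "set_integrable lebesgue K (\<lambda>z. \<zeta> + \<Gamma> z)"
      by (subst set_integrable_lebesgue_borel) (auto simp: scaleR_add_right)
  qed
  fix \<psi> assume t: "test_function \<Omega> \<psi>"
  have tm: "tame \<psi>" by (rule test_function_tame[OF t])
  note tmm[measurable] = tame_measurable[OF tm]
  obtain B where B: "\<And>x. \<bar>\<psi> x\<bar> \<le> B" "\<And>x. norm (gradient \<psi> x) \<le> B"
    by (rule tame_lipschitz[OF tm]) blast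
  have out: "z \<notin> \<Omega> \<Longrightarrow> \<psi> z = 0" "z \<notin> \<Omega> \<Longrightarrow> gradient \<psi> z = 0" for z
    by (rule test_function_support[OF t], blast)+
  have j1: "integrable lborel (\<lambda>z. \<Phi> z *\<^sub>R gradient \<psi> z)" by (rule integrable_bounded_scaleR[OF i(1) tmm(2) B(2)])
  have j2: "integrable lborel (\<lambda>z. \<psi> z *\<^sub>R \<Gamma> z)" by (rule integrable_bounded_scaleR'[OF i(2) tmm(1) B(1)])
  note aff = affine_weak_gradient[OF t, of \<zeta>]
  have "(LINT z:\<Omega>|lebesgue. (\<zeta> \<bullet> z + c + \<Phi> z) *\<^sub>R gradient \<psi> z)
      = (\<integral>z. indicator \<Omega> z *\<^sub>R ((\<zeta> \<bullet> z + c + \<Phi> z) *\<^sub>R gradient \<psi> z) \<partial>lborel)"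
    by (rule set_integrable_lebesgue_borel(2)) measurable
  also have "\<dots> = (\<integral>z. (\<zeta> \<bullet> z + c) *\<^sub>R gradient \<psi> z + \<Phi> z *\<^sub>R gradient \<psi> z \<partial>lborel)"
    by (rule Bochner_Integration.integral_cong) (use out in \<open>auto simp: indicator_def scaleR_add_left\<close>)
  also have "\<dots> = - (\<integral>z. \<psi> z *\<^sub>R \<zeta> \<partial>lborel) + - (\<integral>z. \<psi> z *\<^sub>R \<Gamma> z \<partial>lborel)"
    using w tm by (subst Bochner_Integration.integral_add[OF aff(1) j1]) (simp add: aff(3) whole_weak_gradient_def)
  also have "\<dots> = - (\<integral>z. \<psi> z *\<^sub>R \<zeta> + \<psi> z *\<^sub>R \<Gamma> z \<partial>lborel)"
    by (subst Bochner_Integration.integral_add[OF aff(2) j2]) simp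
  also have "(\<integral>z. \<psi> z *\<^sub>R \<zeta> + \<psi> z *\<^sub>R \<Gamma> z \<partial>lborel) = (\<integral>z. indicator \<Omega> z *\<^sub>R (\<psi> z *\<^sub>R (\<zeta> + \<Gamma> z)) \<partial>lborel)"
    by (rule Bochner_Integration.integral_cong) (use out in \<open>auto simp: indicator_def scaleR_add_right\<close>)
  also have "\<dots> = (LINT z:\<Omega>|lebesgue. \<psi> z *\<^sub>R (\<zeta> + \<Gamma> z))"
    by (rule set_integrable_lebesgue_borel(2)[symmetric]) measurable
  finally show "(LINT z:\<Omega>|lebesgue. (\<zeta> \<bullet> z + c + \<Phi> z) *\<^sub>R gradient \<psi> z) = - (LINT z:\<Omega>|lebesgue. \<psi> z *\<^sub>R (\<zeta> + \<Gamma> z))" .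
qed

lemma component_measurable:
  fixes f :: "'a \<Rightarrow> real^'n"
  assumes "f \<in> borel_measurable M"
  shows "(\<lambda>z. f z $ i) \<in> borel_measurable M"
  by (rule measurable_compose[OF assms borel_measurable_continuous_onI[OF continuous_on_component[OF continuous_on_id]]])

section \<open>Filling open sets with scaled copies of a convex shape\<close>

text \<open>Vitali's theorem fills \<open>U\<close> up to a null set with countably many disjoint balls; finitely many of them
already have half the measure.  Finiteness keeps the complement of the balls in \<open>U\<close> open, so
that the selection can be iterated.\<close>

lemma finite_disjoint_cballs_fill_half:
  fixes U :: "'a::euclidean_space set"
  assumes U: "open U" "bounded U" and \<rho>: "0 < \<rho>"
  obtains F where "finite F" "\<And>c r. (c, r) \<in> F \<Longrightarrow> 0 < r \<and> r \<le> \<rho> \<and> cball c r \<subseteq> U"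
    "pairwise (\<lambda>p q. disjnt (cball (fst p) (snd p)) (cball (fst q) (snd q))) F"
    "measure lebesgue U \<le> 2 * (\<Sum>p\<in>F. measure lebesgue (cball (fst p) (snd p)))"
proof (cases "measure lebesgue U = 0")
  case True
  then show ?thesis by (intro that[of "{}"]) auto
next
  case False
  then have pos: "measure lebesgue U > 0" by (simp add: zero_less_measure_iff)
  let ?B = "\<lambda>p :: 'a \<times> real. cball (fst p) (snd p)"
  define K where "K = {(c, r). 0 < r \<and> r \<le> \<rho> \<and> cball c r \<subseteq> U}"
  have fine: "\<exists>p. p \<in> K \<and> x \<in> cball (fst p) (snd p) \<and> snd p < d" if "x \<in> U" "0 < d" for x d
  proof -
    from U(1) \<open>x \<in> U\<close> obtain e where e: "e > 0" "cball x e \<subseteq> U" by (meson open_contains_cball)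
    define r where "r = min (min e \<rho>) (d / 2)"
    have "0 < r" "r < d" "r \<le> \<rho>" "r \<le> e" using e \<rho> \<open>0 < d\<close> by (auto simp: r_def)
    then show ?thesis
      using e by (intro exI[of _ "(x, r)"]) (auto simp: K_def)
  qed
  have Kpos: "0 < snd p" if "p \<in> K" for p using that by (auto simp: K_def)
  obtain C where C: "countable C" "C \<subseteq> K" "pairwise (\<lambda>p q. disjnt (?B p) (?B q)) C"
    "negligible (U - (\<Union>p\<in>C. ?B p))"
    by (rule Vitali_covering_theorem_cballs[of K snd U fst, OF Kpos fine]) blast+
  have sub: "(\<Union>p\<in>C. ?B p) \<subseteq> U" using C(2) unfolding K_def by fastforce
  have mU: "U \<in> lmeasurable" using U lmeasurable_open by blast
  have "measure lebesgue (\<Union>p\<in>C. ?B p) = measure lebesgue U"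
  proof (rule measure_negligible_symdiff[OF mU])
    show "negligible (U - (\<Union>p\<in>C. ?B p) \<union> ((\<Union>p\<in>C. ?B p) - U))" using C(4) sub
      by (simp add: Diff_eq_empty_iff[THEN iffD2])
  qed
  moreover
  obtain D where D: "finite D" "D \<subseteq> ?B ` C"
    "measure lebesgue (\<Union>(?B ` C)) - measure lebesgue U / 2 < measure lebesgue (\<Union>D)"
  proof (rule measure_countable_Union_approachable[of "?B ` C" "measure lebesgue U / 2" "measure lebesgue U"])
    show "countable (?B ` C)" using C(1) by blast
    show "measure lebesgue U / 2 > 0" using pos by simp
    show "d \<in> lmeasurable" if "d \<in> ?B ` C" for d using that by auto
    show "measure lebesgue (\<Union>D') \<le> measure lebesgue U" if "D' \<subseteq> ?B ` C" "finite D'" for D'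
    proof (rule measure_mono_fmeasurable)
      show "\<Union>D' \<subseteq> U" using that sub by blast
      show "\<Union>D' \<in> sets lebesgue" using that by (intro sets.finite_Union) auto
    qed (rule mU)
  qed auto
  moreover obtain F where F: "finite F" "F \<subseteq> C" "D = ?B ` F"
    using finite_subset_image[OF D(1,2)] by blast
  moreover have "measure lebesgue (\<Union>p\<in>F. ?B p) = (\<Sum>p\<in>F. measure lebesgue (?B p))"
    by (rule measure_UNION') (use F C(3) in \<open>auto intro: pairwise_subset\<close>)
  ultimately have "measure lebesgue U \<le> 2 * (\<Sum>p\<in>F. measure lebesgue (?B p))" by simp
  then show ?thesis using F C(2,3)
    by (intro that[of F]) (auto simp: K_def intro: pairwise_subset)
qed

text \<open>The image of \<open>S\<close> under the homothety with ratio \<open>r\<close> that maps the origin to \<open>c\<close>.\<close>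

definition copy :: "'a::euclidean_space \<Rightarrow> real \<Rightarrow> 'a set \<Rightarrow> 'a set" where
  "copy c r S = (\<lambda>z. r *\<^sub>R z + c) ` S"

lemma measure_copy: "measure lebesgue (copy c r (S::'a::euclidean_space set)) = \<bar>r\<bar> ^ DIM('a) * measure lebesgue S"
  unfolding copy_def by (rule measure_lebesgue_affine)

lemma compact_copy: "compact S \<Longrightarrow> compact (copy c r S)"
  unfolding copy_def by (intro compact_continuous_image continuous_intros)

lemma open_copy:
  assumes "open S" "r \<noteq> 0" shows "open (copy c r S)"
proof -
  have "copy c r S = (+) c ` ((*\<^sub>R) r ` S)" by (auto simp: copy_def image_image add.commute)
  then show ?thesis using open_translation[OF open_scaling[OF assms(2,1)]] by simp
qed

lemma mem_copy: "0 < r \<Longrightarrow> z \<in> copy c r S \<longleftrightarrow> (1 / r) *\<^sub>R (z - c) \<in> S"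
  by (force simp: copy_def image_iff)

lemma negligible_copy:
  assumes "negligible S"
  shows "negligible (copy c r (S :: 'a::euclidean_space set))"
proof -
  show ?thesis unfolding copy_def
    by (rule negligible_differentiable_image_negligible[OF _ assms])
      (auto intro!: derivative_intros simp: differentiable_on_def)
qed

text \<open>A copy of \<open>K\<close> inscribed in a ball occupies a fixed fraction \<open>\<theta>\<close> of the ball.  Inscribing copies in a finite
family of disjoint balls that fills half of \<open>U\<close>, and removing their closures, leaves an open set of
measure at most \<open>(1 - \<theta> / 2) |U|\<close>.  Repeating this with the remainder exhausts \<open>U\<close> up to a null
set; the boundaries of the copies are null sets by convexity.\<close>

lemma vitali_covering_scaled_copies:
  fixes K U :: "'a::euclidean_space set"
  assumes K: "open K" "K \<noteq> {}" "convex K" "bounded K" and U: "open U" "bounded U" and \<rho>: "0 < \<rho>"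
  obtains C where "countable C" "\<And>c r. (c, r) \<in> C \<Longrightarrow> 0 < r \<and> r \<le> \<rho> \<and> copy c r (closure K) \<subseteq> U"
    "\<And>p q. p \<in> C \<Longrightarrow> q \<in> C \<Longrightarrow> p \<noteq> q \<Longrightarrow>
        copy (fst p) (snd p) (closure K) \<inter> copy (fst q) (snd q) (closure K) = {}"
    "negligible (U - (\<Union>(c, r)\<in>C. copy c r K))"
proof -
  let ?\<mu> = "measure lebesgue"
  obtain b where b: "b > 0" "\<And>x. x \<in> closure K \<Longrightarrow> norm x \<le> b"
    using K(4) by (metis bounded_closure bounded_pos)
  have cK: "compact (closure K)" using K(4) by simp
  define P where "P V F \<longleftrightarrow> finite F \<and> (\<forall>c r. (c, r) \<in> F \<longrightarrow> 0 < r \<and> r \<le> \<rho> * b \<and> cball c r \<subseteq> V) \<and>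
    pairwise (\<lambda>p q. disjnt (cball (fst p) (snd p)) (cball (fst q) (snd q))) F \<and>
    ?\<mu> V \<le> 2 * (\<Sum>p\<in>F. ?\<mu> (cball (fst p) (snd p)))" for V :: "'a set" and F
  define ch where "ch V = (SOME F. P V F)" for V
  have "\<exists>F. P V F" if "open V" "bounded V" for V
  proof -
    have \<rho>b: "0 < \<rho> * b" using \<rho> b(1) by simp
    show ?thesis
      by (rule finite_disjoint_cballs_fill_half[OF that \<rho>b]) (rule exI, unfold P_def, blast)
  qed
  then have ch: "P V (ch V)" if "open V" "bounded V" for V
    unfolding ch_def using that by (meson someI_ex)
  let ?cp = "\<lambda>p. copy (fst p) (snd p / b) (closure K)"
  define W where "W n = ((\<lambda>V. V - (\<Union>p\<in>ch V. ?cp p)) ^^ n) U" for n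
  have W0: "W 0 = U" and WS: "W (Suc n) = W n - (\<Union>p\<in>ch (W n). ?cp p)" for n
    by (simp_all add: W_def)
  have W: "open (W n) \<and> bounded (W n)" for n
  proof (induction n)
    case (Suc n)
    then have "finite (ch (W n))" using ch[of "W n"] by (simp add: P_def)
    then have "closed (\<Union>p\<in>ch (W n). ?cp p)"
      by (intro closed_UN ballI compact_imp_closed compact_copy cK)
    with Suc show ?case by (auto simp: WS intro: bounded_subset)
  qed (use U W0 in auto)
  have P: "P (W n) (ch (W n))" for n using W ch by blast
  have Wmono: "W n \<subseteq> W m" if "m \<le> n" for m n
    using that by (induction rule: dec_induct) (auto simp: WS)
  have cpb: "?cp p \<subseteq> cball (fst p) (snd p)" if "p \<in> ch (W n)" for p n
  proof -
    have r: "0 < snd p" using P[of n] that by (cases p) (auto simp: P_def)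
    have "norm ((snd p / b) *\<^sub>R z) \<le> snd p" if "z \<in> closure K" for z
      using b(2)[OF that] b(1) r by (simp add: field_simps)
    then show ?thesis unfolding copy_def by (intro image_subsetI) (simp add: dist_norm)
  qed
  have cpW: "?cp p \<subseteq> W n" if "p \<in> ch (W n)" for p n
    using cpb[OF that] P[of n] that by (cases p) (auto simp: P_def)
  define \<theta> where "\<theta> = ?\<mu> (closure K) / ?\<mu> (cball (0::'a) b)"
  have ball_pos: "?\<mu> (cball (0::'a) b) > 0" using b(1) by (simp add: content_cball_pos)
  have Kpos: "?\<mu> (closure K) > 0"
  proof -
    have "\<not> negligible K" by (rule open_not_negligible[OF K(1,2)])
    then have "\<not> negligible (closure K)" using negligible_subset[OF _ closure_subset] by metis
    then show ?thesis using lmeasurable_compact[OF cK] by (simp add: negligible_iff_measure zero_less_measure_iff)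
  qed
  have "closure K \<subseteq> cball 0 b" using b by auto
  then have "?\<mu> (closure K) \<le> ?\<mu> (cball (0::'a) b)"
    by (rule measure_mono_fmeasurable) (use lmeasurable_compact[OF cK] in auto)
  then have \<theta>: "0 < \<theta>" "\<theta> \<le> 1" using Kpos ball_pos by (auto simp: \<theta>_def)
  have cpm: "?\<mu> (?cp p) = \<theta> * ?\<mu> (cball (fst p) (snd p))" if "p \<in> ch (W n)" for p n
  proof -
    have r: "0 < snd p" using P[of n] that by (cases p) (auto simp: P_def)
    have "cball (fst p) (snd p) = copy (fst p) (snd p / b) (cball 0 b)"
    proof -
      have "(*\<^sub>R) (snd p / b) ` cball (0::'a) b = cball 0 (snd p)"
        using cball_scale[of "snd p / b" "0::'a" b] r b(1) by simp
      moreover have "(\<lambda>x. x + fst p) ` cball (0::'a) (snd p) = cball (fst p) (snd p)"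
        using cball_translation[of "fst p" 0 "snd p"] by (simp add: add.commute image_def)
      ultimately show ?thesis by (metis (no_types, lifting) copy_def image_cong image_image)
    qed
    then have "?\<mu> (cball (fst p) (snd p)) = \<bar>snd p / b\<bar> ^ DIM('a) * ?\<mu> (cball (0::'a) b)"
      by (simp only: measure_copy)
    then show ?thesis using ball_pos by (simp add: measure_copy \<theta>_def)
  qed
  have Wm: "W n \<in> lmeasurable" for n using W lmeasurable_open by blast
  have decay: "?\<mu> (W n) \<le> (1 - \<theta> / 2) ^ n * ?\<mu> U" for n
  proof (induction n)
    case (Suc n)
    let ?F = "ch (W n)"
    have fin: "finite ?F" and half: "?\<mu> (W n) \<le> 2 * (\<Sum>p\<in>?F. ?\<mu> (cball (fst p) (snd p)))"
      and pw: "pairwise (\<lambda>p q. disjnt (cball (fst p) (snd p)) (cball (fst q) (snd q))) ?F"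
      using P[of n] by (auto simp: P_def)
    have lm: "(\<Union>p\<in>?F. ?cp p) \<in> lmeasurable"
      using fin by (intro fmeasurable.finite_UN lmeasurable_compact compact_copy cK)
    have sub: "(\<Union>p\<in>?F. ?cp p) \<subseteq> W n" by (rule UN_least) (rule cpW)
    have "?\<mu> (W (Suc n)) = ?\<mu> (W n) - ?\<mu> (\<Union>p\<in>?F. ?cp p)"
      unfolding WS by (rule measurable_measure_Diff[OF Wm fmeasurableD[OF lm] sub])
    also have "?\<mu> (\<Union>p\<in>?F. ?cp p) = (\<Sum>p\<in>?F. ?\<mu> (?cp p))"
    proof (rule measure_UNION'[OF fin])
      show "pairwise (\<lambda>p q. disjnt (?cp p) (?cp q)) ?F"
      proof (rule pairwiseI)
        fix p q assume pq: "p \<in> ?F" "q \<in> ?F" "p \<noteq> q"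
        show "disjnt (?cp p) (?cp q)"
          by (rule disjnt_subset1[OF disjnt_subset2[OF pairwiseD[OF pw pq] cpb[OF pq(2)]] cpb[OF pq(1)]])
      qed
    qed (auto intro: lmeasurable_compact compact_copy cK)
    also have "\<dots> = \<theta> * (\<Sum>p\<in>?F. ?\<mu> (cball (fst p) (snd p)))"
      by (simp add: cpm sum_distrib_left)
    finally have eq: "?\<mu> (W (Suc n)) = ?\<mu> (W n) - \<theta> * (\<Sum>p\<in>?F. ?\<mu> (cball (fst p) (snd p)))" .
    have "\<theta> / 2 * ?\<mu> (W n) \<le> \<theta> / 2 * (2 * (\<Sum>p\<in>?F. ?\<mu> (cball (fst p) (snd p))))"
      using half \<theta> by (intro mult_left_mono) auto
    then have "\<theta> / 2 * ?\<mu> (W n) \<le> \<theta> * (\<Sum>p\<in>?F. ?\<mu> (cball (fst p) (snd p)))" by simp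
    with eq have "?\<mu> (W (Suc n)) \<le> (1 - \<theta> / 2) * ?\<mu> (W n)"
      unfolding left_diff_distrib by linarith
    also have "(1 - \<theta> / 2) * ?\<mu> (W n) \<le> (1 - \<theta> / 2) * ((1 - \<theta> / 2) ^ n * ?\<mu> U)"
      using Suc \<theta> by (intro mult_left_mono) auto
    finally show ?case by simp
  qed (simp add: W0)
  define C where "C = (\<Union>n. (\<lambda>p. (fst p, snd p / b)) ` ch (W n))"
  show ?thesis
  proof (rule that[of C])
    have "finite (ch (W n))" for n using P[of n] by (simp add: P_def)
    then show cC: "countable C" unfolding C_def by (auto intro: countable_finite)
    show C: "0 < r \<and> r \<le> \<rho> \<and> copy c r (closure K) \<subseteq> U" if cr: "(c, r) \<in> C" for c r
    proof -
      obtain n p where n: "p \<in> ch (W n)" "c = fst p" "r = snd p / b" using cr by (auto simp: C_def)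
      moreover have "0 < snd p" "snd p \<le> \<rho> * b" using P[of n] n(1) by (cases p; auto simp: P_def)+
      moreover have "0 < snd p / b" "snd p / b \<le> \<rho>" using calculation b(1) by (auto simp: pos_divide_le_eq)
      moreover have "?cp p \<subseteq> U" using cpW[OF n(1)] Wmono[of 0 n] W0 by simp
      ultimately show ?thesis by simp
    qed
    have dis: "?cp p \<inter> ?cp q = {}" if "p \<in> ch (W n)" "q \<in> ch (W m)" "n \<le> m" "p \<noteq> q" for p q n m
    proof (cases "n = m")
      case True
      then have "disjnt (cball (fst p) (snd p)) (cball (fst q) (snd q))"
        using P[of n] that by (auto simp: P_def pairwise_def)
      then show ?thesis using cpb[OF that(1)] cpb[OF that(2)] by (auto simp: disjnt_def)
    next
      case False
      then have "?cp q \<subseteq> W (Suc n)" using cpW[OF that(2)] Wmono[of "Suc n" m] that(3) by auto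
      then show ?thesis using that(1) by (auto simp: WS)
    qed
    show "copy (fst p) (snd p) (closure K) \<inter> copy (fst q) (snd q) (closure K) = {}"
      if pC: "p \<in> C" and qC: "q \<in> C" and pq: "p \<noteq> q" for p q
    proof -
      obtain n p' where n: "p' \<in> ch (W n)" "p = (fst p', snd p' / b)"
        using pC unfolding C_def by blast
      obtain m q' where m: "q' \<in> ch (W m)" "q = (fst q', snd q' / b)"
        using qC unfolding C_def by blast
      have "p' \<noteq> q'" using n m pq by auto
      then show ?thesis using dis[OF n(1) m(1)] dis[OF m(1) n(1)] n m
        by (cases "n \<le> m") auto
    qed
    have "negligible (\<Inter>n. W n)"
    proof -
      have mI: "(\<Inter>n. W n) \<in> sets lebesgue" using Wm by (intro sets.countable_INT) auto
      then have I: "(\<Inter>n. W n) \<in> lmeasurable"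
        by (rule fmeasurableI2[OF Wm[of 0] _, rotated]) auto
      have "?\<mu> (\<Inter>n. W n) \<le> (1 - \<theta> / 2) ^ n * ?\<mu> U" for n
        using measure_mono_fmeasurable[of "\<Inter>n. W n" "W n" lebesgue] decay[of n] mI Wm[of n] by force
      moreover have "(\<lambda>n. (1 - \<theta> / 2) ^ n * ?\<mu> U) \<longlonglongrightarrow> 0"
        using \<theta> by (intro tendsto_mult_left_zero LIMSEQ_power_zero) auto
      ultimately have "?\<mu> (\<Inter>n. W n) \<le> 0"
        by (intro LIMSEQ_le_const[of _ 0 "?\<mu> (\<Inter>n. W n)"]) auto
      then have "?\<mu> (\<Inter>n. W n) = 0" using measure_nonneg[of lebesgue "\<Inter>n. W n"] by linarith
      with I show ?thesis by (simp add: negligible_iff_measure)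
    qed
    moreover have "negligible (\<Union>(c, r)\<in>C. copy c r (frontier K))"
    proof (rule negligible_countable_Union)
      show "countable ((\<lambda>(c, r). copy c r (frontier K)) ` C)" using cC by blast
      fix s assume "s \<in> (\<lambda>(c, r). copy c r (frontier K)) ` C"
      then obtain c r where s: "s = copy c r (frontier K)" by auto
      have cf: "compact (frontier K)" using K(4) by (simp add: compact_frontier_bounded)
      have "?\<mu> (frontier K) = 0" by (rule negligible_imp_measure0[OF negligible_convex_frontier[OF K(3)]])
      then have "?\<mu> s = 0" by (simp only: s measure_copy mult_zero_right)
      then show "negligible s" using lmeasurable_compact[OF compact_copy[OF cf]] unfolding s negligible_iff_measure by blast
    qed
    ultimately have "negligible ((\<Inter>n. W n) \<union> (\<Union>(c, r)\<in>C. copy c r (frontier K)))" by (rule negligible_Un)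
    then show "negligible (U - (\<Union>(c, r)\<in>C. copy c r K))"
    proof (rule negligible_subset, safe)
      fix x assume x: "x \<in> U" "x \<notin> (\<Union>(c, r)\<in>C. copy c r K)" "x \<notin> (\<Union>(c, r)\<in>C. copy c r (frontier K))"
      have "closure K = K \<union> frontier K" by (simp add: closure_Un_frontier)
      then have nc: "x \<notin> copy c r (closure K)" if "(c, r) \<in> C" for c r
        using x that by (auto simp: copy_def)
      fix n show "x \<in> W n"
      proof (induction n)
        case (Suc n)
        have "x \<notin> ?cp p" if "p \<in> ch (W n)" for p
          by (rule nc) (use that in \<open>auto simp: C_def\<close>)
        with Suc show ?case by (auto simp: WS)
      qed (simp add: W0 x)
    qed
  qed
qed

text \<open>The covering may be finite; an enumeration by all natural numbers is obtained by allowing ratio \<open>0\<close> as a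
marker for indices that carry no copy.\<close>

lemma vitali_covering_scaled_copies_sequence:
  fixes K U :: "'a::euclidean_space set"
  assumes K: "open K" "K \<noteq> {}" "convex K" "bounded K" and U: "open U" "bounded U" and \<rho>: "0 < \<rho>"
  obtains c :: "nat \<Rightarrow> 'a" and r :: "nat \<Rightarrow> real" where "\<And>n. 0 \<le> r n \<and> r n \<le> \<rho>"
    "\<And>n. 0 < r n \<Longrightarrow> copy (c n) (r n) K \<subseteq> U"
    "\<And>n m. 0 < r n \<Longrightarrow> 0 < r m \<Longrightarrow> n \<noteq> m \<Longrightarrow> copy (c n) (r n) K \<inter> copy (c m) (r m) K = {}"
    "negligible (U - (\<Union>n\<in>{n. 0 < r n}. copy (c n) (r n) K))"
proof -
  obtain C where C: "countable C" "\<And>c r. (c, r) \<in> C \<Longrightarrow> 0 < r \<and> r \<le> \<rho> \<and> copy c r (closure K) \<subseteq> U"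
    "\<And>p q. p \<in> C \<Longrightarrow> q \<in> C \<Longrightarrow> p \<noteq> q \<Longrightarrow>
        copy (fst p) (snd p) (closure K) \<inter> copy (fst q) (snd q) (closure K) = {}"
    "negligible (U - (\<Union>(c, r)\<in>C. copy c r K))"
    by (rule vitali_covering_scaled_copies[OF K U \<rho>]) blast
  let ?f = "to_nat_on C"
  have inj: "inj_on ?f C" by (rule inj_on_to_nat_on[OF C(1)])
  \<comment> \<open>Indices outside the range of the enumeration get ratio 0.\<close>
  define p where "p n = (if n \<in> ?f ` C then inv_into C ?f n else (0, 0))" for n
  have p1: "p n \<in> C" if "0 < snd (p n)" for n
    using that by (auto simp: p_def inv_into_into split: if_splits)
  have p2: "p (?f q) = q" if "q \<in> C" for q
    using that inj by (simp add: p_def)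
  have p3: "p n \<noteq> p m" if "0 < snd (p n)" "0 < snd (p m)" "n \<noteq> m" for n m
    using that by (auto simp: p_def split: if_splits dest: inv_into_injective)
  have cp: "copy c r K \<subseteq> copy c r (closure K)" for c r
    using closure_subset by (auto simp: copy_def)
  show ?thesis
  proof (rule that[of "\<lambda>n. snd (p n)" "\<lambda>n. fst (p n)"])
    show "0 \<le> snd (p n) \<and> snd (p n) \<le> \<rho>" for n
    proof (cases "n \<in> ?f ` C")
      case True
      then have "(fst (p n), snd (p n)) \<in> C" by (simp add: p_def inv_into_into)
      then show ?thesis using C(2) less_imp_le by blast
    qed (use \<rho> in \<open>simp add: p_def\<close>)
    show "copy (fst (p n)) (snd (p n)) K \<subseteq> U" if "0 < snd (p n)" for n
    proof -
      have "(fst (p n), snd (p n)) \<in> C" using p1[OF that] by simp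
      with C(2) cp show ?thesis by blast
    qed
    show "copy (fst (p n)) (snd (p n)) K \<inter> copy (fst (p m)) (snd (p m)) K = {}"
      if "0 < snd (p n)" "0 < snd (p m)" "n \<noteq> m" for n m
      using C(3)[OF p1[OF that(1)] p1[OF that(2)] p3[OF that]] cp by blast
    have "(\<Union>(c, r)\<in>C. copy c r K) \<subseteq> (\<Union>n\<in>{n. 0 < snd (p n)}. copy (fst (p n)) (snd (p n)) K)"
    proof safe
      fix c r x assume "(c, r) \<in> C" "x \<in> copy c r K"
      then show "x \<in> (\<Union>n\<in>{n. 0 < snd (p n)}. copy (fst (p n)) (snd (p n)) K)"
        using p2[of "(c, r)"] C(2) by (intro UN_I[of "?f (c, r)"]) auto
    qed
    then show "negligible (U - (\<Union>n\<in>{n. 0 < snd (p n)}. copy (fst (p n)) (snd (p n)) K))"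
      by (intro negligible_subset[OF C(4)]) blast
  qed
qed

section \<open>Tents over kites: splitting one gradient entry\<close>

text \<open>A pyramid whose base is a kite with its diagonals on the coordinate axes.  Its slope in direction \<open>i\<close> is exactly
\<open>s\<close> below and exactly \<open>- s'\<close> above the diagonal \<open>z\<^sub>i = 0\<close>; the small slope \<open>e\<close> in direction
\<open>j\<close> is the price for vanishing on the boundary.\<close>

definition tent :: "2 \<Rightarrow> 2 \<Rightarrow> real \<Rightarrow> real \<Rightarrow> real \<Rightarrow> real^2 \<Rightarrow> real" where
  "tent i j s s' e z = max 0 (min (1 + s * z $ i) (1 - s' * z $ i) - e * \<bar>z $ j\<bar>)"

definition kite :: "2 \<Rightarrow> 2 \<Rightarrow> real \<Rightarrow> real \<Rightarrow> real \<Rightarrow> (real^2) set" where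
  "kite i j s s' e = {z. 0 < tent i j s s' e z}"

definition tent_gradient :: "2 \<Rightarrow> 2 \<Rightarrow> real \<Rightarrow> real \<Rightarrow> real \<Rightarrow> real^2 \<Rightarrow> real^2" where
  "tent_gradient i j s s' e z = (if z \<in> kite i j s s' e
     then axis i (if z $ i < 0 then s else - s') - axis j (e * sgn (z $ j)) else 0)"

lemma UNIV_2_distinct: "(i::2) \<noteq> j \<Longrightarrow> UNIV = {i, j}"
  using exhaust_2[of i] exhaust_2[of j] UNIV_2 by auto

lemma norm_2_le:
  fixes z :: "real^2" assumes "i \<noteq> j" shows "norm z \<le> \<bar>z $ i\<bar> + \<bar>z $ j\<bar>"
  using norm_le_l1_cart[of z] assms by (simp add: UNIV_2_distinct[OF assms])

locale kite_shape =
  fixes i j :: 2 and s s' e :: real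
  assumes ij: "i \<noteq> j" and s: "0 < s" and s': "0 < s'" and e: "0 < e"
begin

abbreviation "T \<equiv> tent i j s s' e"
abbreviation "K \<equiv> kite i j s s' e"
abbreviation "DT \<equiv> tent_gradient i j s s' e"

lemma tent_bounds: "0 \<le> T z" "T z \<le> 1"
proof -
  have "min (1 + s * z $ i) (1 - s' * z $ i) \<le> 1"
    using s s' by (cases "z $ i \<le> 0") (auto simp: min_le_iff_disj mult_nonneg_nonpos)
  moreover have "0 \<le> e * \<bar>z $ j\<bar>" using e by simp
  ultimately show "T z \<le> 1" unfolding tent_def by linarith
qed (simp add: tent_def)

lemma tent_lipschitz: "\<bar>T z - T w\<bar> \<le> (s + s' + e) * norm (z - w)"
proof -
  have i: "\<bar>z $ i - w $ i\<bar> \<le> norm (z - w)" and j: "\<bar>\<bar>z $ j\<bar> - \<bar>w $ j\<bar>\<bar> \<le> norm (z - w)"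
    using component_le_norm_cart[of "z - w" i] component_le_norm_cart[of "z - w" j] by auto
  have 1: "\<bar>s * z $ i - s * w $ i\<bar> \<le> s * norm (z - w)"
    using mult_left_mono[OF i, of s] s by (simp add: abs_mult flip: right_diff_distrib)
  have 2: "\<bar>s' * z $ i - s' * w $ i\<bar> \<le> s' * norm (z - w)"
    using mult_left_mono[OF i, of s'] s' by (simp add: abs_mult flip: right_diff_distrib)
  have 3: "\<bar>e * \<bar>z $ j\<bar> - e * \<bar>w $ j\<bar>\<bar> \<le> e * norm (z - w)"
    using mult_left_mono[OF j, of e] e by (simp add: abs_mult flip: right_diff_distrib)
  have max: "\<bar>max 0 a - max 0 b\<bar> \<le> \<bar>a - b\<bar>" for a b :: real by (auto simp: max_def)
  have min: "\<bar>min a b - min a' b'\<bar> \<le> \<bar>a - a'\<bar> + \<bar>b - b'\<bar>" for a b a' b' :: real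
    by (auto simp: min_def abs_if)
  have diff: "\<bar>(a - b) - (a' - b')\<bar> \<le> \<bar>a - a'\<bar> + \<bar>b - b'\<bar>" for a b a' b' :: real by linarith
  let ?m = "\<lambda>z. min (1 + s * z $ i) (1 - s' * z $ i)"
  have "\<bar>T z - T w\<bar> \<le> \<bar>(?m z - e * \<bar>z $ j\<bar>) - (?m w - e * \<bar>w $ j\<bar>)\<bar>"
    unfolding tent_def by (rule max)
  also have "\<dots> \<le> \<bar>?m z - ?m w\<bar> + \<bar>e * \<bar>z $ j\<bar> - e * \<bar>w $ j\<bar>\<bar>" by (rule diff)
  also have "\<bar>?m z - ?m w\<bar> \<le> \<bar>s * z $ i - s * w $ i\<bar> + \<bar>s' * z $ i - s' * w $ i\<bar>"
    using min[of "1 + s * z $ i" "1 - s' * z $ i" "1 + s * w $ i" "1 - s' * w $ i"] by (simp add: abs_minus_commute)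
  finally show ?thesis using 1 2 3 by (simp add: distrib_right)
qed

lemma tent_continuous: "continuous_on A T"
  unfolding tent_def[abs_def] by (intro continuous_intros)

lemma open_kite: "open K"
  unfolding kite_def by (intro open_Collect_less tent_continuous continuous_intros)

lemma kite_nonempty: "0 \<in> K"
  by (simp add: kite_def tent_def)

lemma mem_kite: "z \<in> K \<longleftrightarrow> e * \<bar>z $ j\<bar> < 1 + s * z $ i \<and> e * \<bar>z $ j\<bar> < 1 - s' * z $ i"
  by (auto simp: kite_def tent_def)

text \<open>The four affine pieces of the tent are positive on four half-planes, and the kite is their intersection.\<close>

lemma convex_kite: "convex K"
proof -
  have "K = {z. (axis j e + axis i (- s)) \<bullet> z < 1} \<inter> {z. (axis j (- e) + axis i (- s)) \<bullet> z < 1}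
     \<inter> ({z. (axis j e + axis i s') \<bullet> z < 1} \<inter> {z. (axis j (- e) + axis i s') \<bullet> z < 1})"
  proof -
    have "e * \<bar>z $ j\<bar> = max (e * z $ j) (- (e * z $ j))" for z :: "real^2"
      using e by (cases "0 \<le> z $ j") (auto simp: max_def mult_le_0_iff zero_le_mult_iff)
    then show ?thesis by (auto simp: mem_kite inner_add_left inner_axis')
  qed
  then show ?thesis by (simp only: convex_halfspace_lt convex_Int)
qed

lemma kite_bounded: "bounded K"
proof -
  have "norm z \<le> 1 / s + 1 / s' + 1 / e" if z: "z \<in> K" for z
  proof -
    have "0 \<le> e * \<bar>z $ j\<bar>" using e by simp
    with z have "- 1 < s * z $ i" "s' * z $ i < 1" by (auto simp: mem_kite)
    then have zi: "- (1 / s) < z $ i" "z $ i < 1 / s'" using s s' by (auto simp: field_simps)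
    have "e * \<bar>z $ j\<bar> < 1"
      using z s s' by (cases "z $ i \<le> 0") (auto simp: mem_kite mult_nonneg_nonpos intro: less_le_trans)
    then have zj: "\<bar>z $ j\<bar> < 1 / e" using e by (simp add: field_simps)
    have "0 < 1 / s" "0 < 1 / s'" using s s' by auto
    with zi zj norm_2_le[OF ij, of z] show ?thesis by linarith
  qed
  then show ?thesis by (auto simp: bounded_iff)
qed

text \<open>The tent is affine on each of the four triangles into which the axes divide the kite, and zero outside the kite.\<close>

lemma tent_has_derivative:
  assumes "z \<notin> frontier K" "z $ i \<noteq> 0" "z $ j \<noteq> 0"
  shows "(T has_derivative (\<lambda>h. DT z \<bullet> h)) (at z)"
proof (cases "z \<in> K")
  case False
  then have "z \<notin> closure K" using assms(1) open_kite by (simp add: frontier_def interior_open)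
  moreover have "((\<lambda>z. 0) has_derivative (\<lambda>h. DT z \<bullet> h)) (at z)"
    using False by (simp add: tent_gradient_def)
  ultimately show ?thesis
  proof (elim has_derivative_transform_within_open)
    show "open (- closure K)" by auto
    fix w assume "w \<in> - closure K"
    then have "w \<notin> K" using closure_subset by blast
    then show "0 = T w" using tent_bounds(1)[of w] by (simp add: kite_def)
  qed auto
next
  case True
  define \<sigma> where "\<sigma> = (if z $ i < 0 then s else - s')"
  define A where "A = K \<inter> {w. 0 < w $ i * z $ i} \<inter> {w. 0 < w $ j * z $ j}"
  have "open A" unfolding A_def
    by (intro open_Int open_kite open_Collect_less continuous_intros)
  have "((\<lambda>w. 1 + \<sigma> * w $ i - e * sgn (z $ j) * w $ j) has_derivative (\<lambda>h. \<sigma> * h $ i - e * sgn (z $ j) * h $ j)) (at z)"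
    by (auto intro!: derivative_eq_intros bounded_linear_imp_has_derivative bounded_linear_vec_nth)
  moreover have "(\<lambda>h. \<sigma> * h $ i - e * sgn (z $ j) * h $ j) = (\<lambda>h. DT z \<bullet> h)"
    using True by (simp add: tent_gradient_def \<sigma>_def inner_diff_left inner_axis')
  ultimately have "((\<lambda>w. 1 + \<sigma> * w $ i - e * sgn (z $ j) * w $ j) has_derivative (\<lambda>h. DT z \<bullet> h)) (at z)"
    by simp
  then show ?thesis
  proof (rule has_derivative_transform_within_open[OF _ \<open>open A\<close>])
    show "z \<in> A" using True assms by (auto simp: A_def zero_less_mult_iff)
    fix w assume w: "w \<in> A"
    then have "0 < T w" by (simp add: A_def kite_def)
    then have T: "T w = min (1 + s * w $ i) (1 - s' * w $ i) - e * \<bar>w $ j\<bar>"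
      by (auto simp: tent_def)
    have j: "\<bar>w $ j\<bar> = sgn (z $ j) * w $ j"
      using w by (auto simp: A_def zero_less_mult_iff)
    have i: "min (1 + s * w $ i) (1 - s' * w $ i) = 1 + \<sigma> * w $ i"
    proof (cases "z $ i < 0")
      case True
      then have "w $ i < 0" using w by (auto simp: A_def zero_less_mult_iff)
      then have "s * w $ i < 0" "s' * w $ i < 0" using s s' by (auto simp: mult_pos_neg)
      then show ?thesis using True by (simp add: \<sigma>_def)
    next
      case False
      then have "0 < w $ i" using w by (auto simp: A_def zero_less_mult_iff)
      then have "0 < s * w $ i" "0 < s' * w $ i" using s s' by auto
      then show ?thesis using False by (simp add: \<sigma>_def)
    qed
    show "1 + \<sigma> * w $ i - e * sgn (z $ j) * w $ j = T w" unfolding T i j by simp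
  qed
qed

lemma tent_gradient_i: "z \<in> K \<Longrightarrow> DT z $ i = (if z $ i < 0 then s else - s')"
  using ij by (simp add: tent_gradient_def axis_def)

lemma tent_gradient_j: "\<bar>DT z $ j\<bar> \<le> e"
  using ij e by (auto simp: tent_gradient_def axis_def abs_mult sgn_if)

lemma tent_gradient_norm: "norm (DT z) \<le> s + s' + e"
proof -
  have "\<bar>DT z $ i\<bar> \<le> s + s'" using s s' ij by (auto simp: tent_gradient_def axis_def)
  with norm_2_le[OF ij, of "DT z"] tent_gradient_j[of z] show ?thesis by linarith
qed

lemma tent_gradient_measurable[measurable]: "DT \<in> borel_measurable borel"
proof -
  have K[measurable]: "K \<in> sets borel" using open_kite by simp
  have ax[measurable]: "(\<lambda>x. axis k (f x) :: real^2) \<in> borel_measurable borel"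
    if [measurable]: "f \<in> borel_measurable borel" for k :: 2 and f :: "real^2 \<Rightarrow> real"
  proof -
    have "(\<lambda>x. axis k (f x) :: real^2) = (\<lambda>x. f x *\<^sub>R axis k 1)"
      by (auto simp: axis_def vec_eq_iff)
    then show ?thesis by simp
  qed
  have c[measurable]: "(\<lambda>z::real^2. z $ k) \<in> borel_measurable borel" for k
    by (intro borel_measurable_continuous_onI continuous_intros)
  show ?thesis unfolding tent_gradient_def[abs_def] by measurable
qed

text \<open>For \<open>r = 0\<close>, the marker of an empty copy, this is the zero function by the convention \<open>0 * t = 0\<close>.\<close>

definition scaled_tent :: "real^2 \<Rightarrow> real \<Rightarrow> real^2 \<Rightarrow> real" where
  "scaled_tent c r z = r * T ((1 / r) *\<^sub>R (z - c))"

definition scaled_gradient :: "real^2 \<Rightarrow> real \<Rightarrow> real^2 \<Rightarrow> real^2" where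
  "scaled_gradient c r z = (if r = 0 then 0 else DT ((1 / r) *\<^sub>R (z - c)))"

lemma scaled_tent_lipschitz:
  assumes "0 \<le> r"
  shows "\<bar>scaled_tent c r z - scaled_tent c r w\<bar> \<le> (s + s' + e) * norm (z - w)"
proof (cases "r = 0")
  case True
  then show ?thesis using s s' e by (simp add: scaled_tent_def)
next
  case False
  then have r: "0 < r" using assms by simp
  let ?z = "(1 / r) *\<^sub>R (z - c)" and ?w = "(1 / r) *\<^sub>R (w - c)"
  have "?z - ?w = (1 / r) *\<^sub>R (z - w)" by (simp flip: scaleR_diff_right)
  then have n: "norm (?z - ?w) = norm (z - w) / r" using r by simp
  have "\<bar>scaled_tent c r z - scaled_tent c r w\<bar> = r * \<bar>T ?z - T ?w\<bar>"
    using r by (simp add: scaled_tent_def abs_mult flip: right_diff_distrib)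
  also have "\<dots> \<le> r * ((s + s' + e) * (norm (z - w) / r))"
    using mult_left_mono[OF tent_lipschitz[of ?z ?w], of r] r n by simp
  also have "\<dots> = (s + s' + e) * norm (z - w)" using r by simp
  finally show ?thesis .
qed

lemma scaled_tent_bounds: "0 \<le> r \<Longrightarrow> 0 \<le> scaled_tent c r z" "0 \<le> r \<Longrightarrow> scaled_tent c r z \<le> r"
  unfolding scaled_tent_def using tent_bounds by (auto intro: mult_left_le)

lemma scaled_zero:
  assumes "0 \<le> r" "0 < r \<Longrightarrow> z \<notin> copy c r K"
  shows "scaled_tent c r z = 0" "scaled_gradient c r z = 0"
  using assms tent_bounds(1)[of "(1 / r) *\<^sub>R (z - c)"]
  by (cases "r = 0"; simp add: scaled_tent_def scaled_gradient_def mem_copy kite_def tent_gradient_def)+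

lemma scaled_tent_weak_gradient:
  assumes r: "0 \<le> r"
  shows "whole_weak_gradient (scaled_tent c r) (scaled_gradient c r)"
proof (cases "r = 0")
  case True
  then show ?thesis by (simp add: whole_weak_gradient_def scaled_tent_def[abs_def] scaled_gradient_def[abs_def])
next
  case False
  with r have r: "0 < r" by simp
  have "bounded (copy c r K)"
    using compact_imp_bounded[OF compact_copy[of "closure K" c r]] kite_bounded closure_subset[of K]
    by (auto simp: copy_def intro: bounded_subset)
  then obtain R where R: "\<And>z. z \<in> copy c r K \<Longrightarrow> norm z \<le> R" by (auto simp: bounded_iff)
  show ?thesis
  proof (rule whole_weak_gradient_lipschitz[OF scaled_tent_lipschitz])
    show "\<bar>scaled_tent c r x\<bar> \<le> r + (s + s' + e)" for x
      using scaled_tent_bounds[of r c x] r s s' e by auto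
    show "norm (scaled_gradient c r x) \<le> r + (s + s' + e)" for x
      using tent_gradient_norm[of "(1 / r) *\<^sub>R (x - c)"] r by (simp add: scaled_gradient_def)
    show "scaled_tent c r x = 0" "scaled_gradient c r x = 0" if "R < norm x" for x
      using scaled_zero[of r x c] R[of x] that r by auto
    have "continuous_on UNIV (\<lambda>z. scaled_tent c r z)"
      unfolding scaled_tent_def
      by (intro continuous_intros continuous_on_compose2[OF tent_continuous[of UNIV]]) auto
    then show "scaled_tent c r \<in> borel_measurable borel" by (rule borel_measurable_continuous_onI)
    show "scaled_gradient c r \<in> borel_measurable borel"
      unfolding scaled_gradient_def[abs_def] by measurable
    let ?N = "frontier K \<union> {z. z $ i = 0} \<union> {z. z $ j = 0}"
    have "negligible ?N"
      using negligible_convex_frontier[OF convex_kite] by (intro negligible_Un negligible_standard_hyperplane_cart) auto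
    then have "negligible (copy c r ?N)" by (rule negligible_copy)
    then have "AE x in lebesgue. x \<notin> copy c r ?N"
      by (auto simp: negligible_iff_null_sets intro: AE_not_in)
    then have "AE x in lborel. x \<notin> copy c r ?N" by (simp add: AE_completion_iff)
    then show "AE x in lborel. (scaled_tent c r has_derivative (\<lambda>h. scaled_gradient c r x \<bullet> h)) (at x)"
    proof eventually_elim
      case (elim x)
      let ?y = "(1 / r) *\<^sub>R (x - c)"
      have "?y \<notin> ?N" using elim mem_copy[OF r, of x c ?N] by simp
      then have "(T has_derivative (\<lambda>h. DT ?y \<bullet> h)) (at ?y)" by (intro tent_has_derivative) auto
      then have "((\<lambda>z. T ((1 / r) *\<^sub>R (z - c))) has_derivative (\<lambda>h. DT ?y \<bullet> ((1 / r) *\<^sub>R h))) (at x)"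
        by (rule has_derivative_compose[rotated]) (auto intro!: derivative_eq_intros)
      then have "((\<lambda>z. r * T ((1 / r) *\<^sub>R (z - c))) has_derivative (\<lambda>h. r * (DT ?y \<bullet> ((1 / r) *\<^sub>R h)))) (at x)"
        by (rule has_derivative_mult_right)
      then show ?case using r by (simp add: scaled_tent_def[abs_def] scaled_gradient_def)
    qed
  qed (use r in auto)
qed

text \<open>Sum the scaled tents over a covering of \<open>U\<close> by scaled kites; \<open>V\<close> collects the lower halves of the kites.  Scaling a
tent leaves its gradient unchanged and multiplies its height by \<open>r\<close>, so small kites give a small function with the
same slopes.  The area of \<open>V\<close> follows from the mean value zero of the derivative in
direction \<open>i\<close>, that is, from \<open>s |V| = s' |U - V|\<close>.\<close>

lemma kite_splitting:
  assumes U: "open U" "bounded U" and \<eta>: "0 < \<eta>"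
  obtains \<phi> g V where "open V" "V \<subseteq> U" "\<And>z. 0 \<le> \<phi> z \<and> \<phi> z \<le> \<eta>"
    "\<And>z. z \<notin> U \<Longrightarrow> \<phi> z = 0" "\<And>z. z \<notin> U \<Longrightarrow> g z = 0"
    "\<And>z w. \<bar>\<phi> z - \<phi> w\<bar> \<le> (s + s' + e) * norm (z - w)"
    "whole_weak_gradient \<phi> g" "\<And>z. \<bar>g z $ j\<bar> \<le> e"
    "AE z in lborel. (z \<in> V \<longrightarrow> g z $ i = s) \<and> (z \<in> U - V \<longrightarrow> g z $ i = - s')"
    "measure lborel V = s' / (s + s') * measure lborel U"
proof -
  have Kne: "K \<noteq> {}" using kite_nonempty by blast
  obtain c :: "nat \<Rightarrow> real^2" and r :: "nat \<Rightarrow> real" where r: "\<And>n. 0 \<le> r n \<and> r n \<le> \<eta>"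
    and sub: "\<And>n. 0 < r n \<Longrightarrow> copy (c n) (r n) K \<subseteq> U"
    and dis: "\<And>n m. 0 < r n \<Longrightarrow> 0 < r m \<Longrightarrow> n \<noteq> m \<Longrightarrow> copy (c n) (r n) K \<inter> copy (c m) (r m) K = {}"
    and full: "negligible (U - (\<Union>n\<in>{n. 0 < r n}. copy (c n) (r n) K))"
    by (rule vitali_covering_scaled_copies_sequence[OF open_kite Kne convex_kite kite_bounded U \<eta>]) blast
  have r0: "0 \<le> r n" for n using r by blast
  define B where "B n = (if 0 < r n then copy (c n) (r n) K else {})" for n
  have oB: "open (B n)" for n using open_copy[OF open_kite, of "r n" "c n"] by (auto simp: B_def)
  then have mB[measurable]: "B n \<in> sets borel" for n by simp
  have BU: "B n \<subseteq> U" for n using sub by (auto simp: B_def)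
  have Bdis: "B n \<inter> B m = {}" if "n \<noteq> m" for n m using dis that by (auto simp: B_def)
  have Bfull: "negligible (U - (\<Union>n. B n))"
    by (rule negligible_subset[OF full]) (auto simp: B_def)
  let ?\<phi> = "\<lambda>n. scaled_tent (c n) (r n)" and ?g = "\<lambda>n. scaled_gradient (c n) (r n)"
  have zero: "?\<phi> n z = 0" "?g n z = 0" if "z \<notin> B n" for n z
    using that by (auto simp: B_def split: if_splits intro!: scaled_zero r0)
  have gn: "norm (?g n z) \<le> s + s' + e" for n z
    using tent_gradient_norm s s' e by (auto simp: scaled_gradient_def)
  have other: "z \<notin> B m" if "z \<in> B n" "m \<noteq> n" for z n m using Bdis that by blast
  define \<phi> where "\<phi> z = (\<Sum>n. ?\<phi> n z)" for z
  define g where "g z = (\<Sum>n. ?g n z)" for z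
  have on: "\<phi> z = ?\<phi> n z" "g z = ?g n z" if "z \<in> B n" for z n
  proof -
    have "(\<lambda>m. ?\<phi> m z) sums (\<Sum>m\<in>{n}. ?\<phi> m z)" "(\<lambda>m. ?g m z) sums (\<Sum>m\<in>{n}. ?g m z)"
      by (rule sums_finite; use zero other[OF that] in auto)+
    then show "\<phi> z = ?\<phi> n z" "g z = ?g n z" by (simp_all add: \<phi>_def g_def sums_iff)
  qed
  have off: "\<phi> z = 0" "g z = 0" if "z \<notin> (\<Union>n. B n)" for z
    using zero that by (simp_all add: \<phi>_def g_def)
  \<comment> \<open>Each tent lies below the sum, which reduces the Lipschitz bound for the sum to that for a single tent.\<close>
  have ge: "?\<phi> n z \<le> \<phi> z" for n z
  proof (cases "z \<in> (\<Union>m. B m)")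
    case True
    then obtain m where "z \<in> B m" by blast
    then show ?thesis using on[of z m] other[of z m n] zero(1)[of z n] scaled_tent_bounds(1)[OF r0[of m], of "c m" z]
      by (cases "n = m") auto
  next
    case False
    then show ?thesis using zero off by auto
  qed
  have mU: "emeasure lborel U < \<infinity>" using U(2) by (rule emeasure_bounded_finite)
  have sumB: "(\<lambda>n. measure lborel (B n)) sums measure lborel (\<Union>n. B n)"
  proof (rule measure_UNION)
    have "emeasure lborel (\<Union>n. B n) \<le> emeasure lborel U" by (rule emeasure_mono) (use BU U(1) in auto)
    then show "emeasure lborel (\<Union>n. B n) \<noteq> \<infinity>" using mU by (auto simp: top_unique)
  qed (auto simp: disjoint_family_on_def Bdis)
  have finB: "emeasure lborel (B n) < \<infinity>" for n
    by (rule emeasure_bounded_finite) (use bounded_subset[OF U(2) BU] in auto)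
  have w: "whole_weak_gradient (?\<phi> n) (?g n)" for n by (rule scaled_tent_weak_gradient[OF r0])
  have intB: "integrable lborel (\<lambda>z. M * indicator (B n) z :: real)" for M n
    using finB by (intro integrable_mult_right integrable_real_indicator) auto
  have ww: "whole_weak_gradient \<phi> g"
    unfolding \<phi>_def[abs_def] g_def[abs_def]
  proof (rule whole_weak_gradient_suminf[OF w])
    have fin: "finite {n. z \<in> B n}" for z
    proof (cases "\<exists>n. z \<in> B n")
      case True
      then obtain n where "z \<in> B n" by blast
      then have "{n. z \<in> B n} \<subseteq> {n}" using other by blast
      then show ?thesis by (rule finite_subset) simp
    qed auto
    show "AE z in lborel. summable (\<lambda>n. \<bar>?\<phi> n z\<bar>)"
      by (rule AE_I2, rule summable_finite[OF fin]) (use zero in auto)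
    show "AE z in lborel. summable (\<lambda>n. norm (?g n z))"
      by (rule AE_I2, rule summable_finite[OF fin]) (use zero in auto)
    have i: "integrable lborel (?\<phi> n)" "integrable lborel (?g n)" for n
      using w by (auto simp: whole_weak_gradient_def)
    show "summable (\<lambda>n. \<integral>z. \<bar>?\<phi> n z\<bar> \<partial>lborel)"
    proof (rule summable_comparison_test'[OF summable_mult[OF sums_summable[OF sumB], of \<eta>]])
      fix n
      have "(\<integral>z. \<bar>?\<phi> n z\<bar> \<partial>lborel) \<le> (\<integral>z. \<eta> * indicator (B n) z \<partial>lborel)"
      proof (rule integral_mono[OF integrable_abs[OF i(1)] intB])
        show "\<bar>?\<phi> n z\<bar> \<le> \<eta> * indicator (B n) z" for z
          using zero(1)[of z n] scaled_tent_bounds[OF r0[of n], of "c n" z] r[of n] by (auto simp: indicator_def)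
      qed
      then show "norm (\<integral>z. \<bar>?\<phi> n z\<bar> \<partial>lborel) \<le> \<eta> * measure lborel (B n)" by simp
    qed
    show "summable (\<lambda>n. \<integral>z. norm (?g n z) \<partial>lborel)"
    proof (rule summable_comparison_test'[OF summable_mult[OF sums_summable[OF sumB], of "s + s' + e"]])
      fix n
      have "(\<integral>z. norm (?g n z) \<partial>lborel) \<le> (\<integral>z. (s + s' + e) * indicator (B n) z \<partial>lborel)"
      proof (rule integral_mono[OF integrable_norm[OF i(2)] intB])
        show "norm (?g n z) \<le> (s + s' + e) * indicator (B n) z" for z
          using zero(2)[of z n] gn[of n z] by (auto simp: indicator_def)
      qed
      then show "norm (\<integral>z. norm (?g n z) \<partial>lborel) \<le> (s + s' + e) * measure lborel (B n)" by simp
    qed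
  qed
  define V where "V = (\<Union>n. B n \<inter> {z. z $ i < c n $ i})"
  have oV: "open V" unfolding V_def
    by (intro open_UN ballI open_Int oB open_Collect_less continuous_intros)
  have VU: "V \<subseteq> U" using BU by (auto simp: V_def)
  have gi: "g z $ i = (if z \<in> V then s else - s')" if zB: "z \<in> (\<Union>n. B n)" for z
  proof -
    obtain n where n: "z \<in> B n" using zB by blast
    then have rn: "0 < r n" by (auto simp: B_def split: if_splits)
    let ?y = "(1 / r n) *\<^sub>R (z - c n)"
    have "?y \<in> K" using n rn mem_copy[OF rn, of z "c n" K] by (simp add: B_def)
    then have "g z $ i = (if ?y $ i < 0 then s else - s')"
      using on(2)[OF n] rn tent_gradient_i[of ?y] by (simp add: scaled_gradient_def)
    moreover have "?y $ i < 0 \<longleftrightarrow> z $ i < c n $ i" using rn by (simp add: divide_less_0_iff)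
    moreover have "z \<in> V \<longleftrightarrow> z $ i < c n $ i" 
    proof -
      have "z \<in> V \<longleftrightarrow> (\<exists>m. z \<in> B m \<and> z $ i < c m $ i)" by (auto simp: V_def)
      then show ?thesis using n other[OF n] by metis
    qed
    ultimately show ?thesis by simp
  qed
  have ae: "AE z in lborel. z \<notin> U - (\<Union>n. B n)"
  proof -
    have "AE z in lebesgue. z \<notin> U - (\<Union>n. B n)" 
      using Bfull unfolding negligible_iff_null_sets by (rule AE_not_in)
    then show ?thesis by (simp only: AE_completion_iff)
  qed
  then have aeg: "AE z in lborel. (z \<in> V \<longrightarrow> g z $ i = s) \<and> (z \<in> U - V \<longrightarrow> g z $ i = - s')"

  proof eventually_elim
    case (elim z)
    show ?case
    proof (cases "z \<in> U")
      case True
      with elim have "z \<in> (\<Union>n. B n)" by blast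
      from gi[OF this] show ?thesis by simp
    qed (use VU in blast)
  qed
  have out: "\<phi> z = 0" "g z = 0" if "z \<notin> U" for z using off[of z] BU that by auto
  have gV: "measure lborel V = s' / (s + s') * measure lborel U"
  proof -
    have [measurable]: "U \<in> sets borel" "V \<in> sets borel" using U(1) oV by auto
    have finV: "emeasure lborel V < \<infinity>" by (rule emeasure_bounded_finite) (use bounded_subset[OF U(2) VU] in auto)
    have gint: "integrable lborel g" using ww by (simp add: whole_weak_gradient_def)
    have "0 = (\<integral>z. g z \<partial>lborel) $ i" using whole_weak_gradient_integral_0[OF ww] by simp
    also have "\<dots> = (\<integral>z. g z $ i \<partial>lborel)"
      by (rule integral_bounded_linear[OF bounded_linear_vec_nth gint, symmetric])
    also have "\<dots> = (\<integral>z. (s + s') * indicator V z - s' * indicator U z \<partial>lborel)"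
    proof (rule integral_cong_AE)
      show "(\<lambda>z. g z $ i) \<in> borel_measurable lborel"
        using integrable_bounded_linear[OF bounded_linear_vec_nth gint] by auto
      show "AE z in lborel. g z $ i = (s + s') * indicator V z - s' * indicator U z"
        using aeg by eventually_elim (use out VU in \<open>auto simp: indicator_def\<close>)
    qed measurable
    also have "\<dots> = (s + s') * measure lborel V - s' * measure lborel U"
      using mU finV by (subst Bochner_Integration.integral_diff) auto
    finally show ?thesis using s s' by (simp add: field_simps)
  qed
  have lip1: "\<phi> z - \<phi> w \<le> (s + s' + e) * norm (z - w)" for z w
  proof (cases "z \<in> (\<Union>n. B n)")
    case True
    then obtain n where n: "z \<in> B n" by blast
    have "\<phi> z - \<phi> w \<le> ?\<phi> n z - ?\<phi> n w" using on(1)[OF n] ge[of n w] by simp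
    also have "\<dots> \<le> (s + s' + e) * norm (z - w)" using scaled_tent_lipschitz[OF r0[of n], of "c n" z w] by simp
    finally show ?thesis .
  next
    case False
    have "0 \<le> ?\<phi> 0 w" by (rule scaled_tent_bounds(1)[OF r0])
    then have "\<phi> z - \<phi> w \<le> 0" using off(1)[OF False] ge[of 0 w] by simp
    also have "0 \<le> (s + s' + e) * norm (z - w)" using s s' e by simp
    finally show ?thesis .
  qed
  show ?thesis
  proof (rule that[of V \<phi> g])
    show "0 \<le> \<phi> z \<and> \<phi> z \<le> \<eta>" for z
    proof (cases "z \<in> (\<Union>n. B n)")
      case True
      then obtain n where n: "z \<in> B n" by blast
      show ?thesis using on(1)[OF n] scaled_tent_bounds[OF r0[of n], of "c n" z] r[of n] by simp
    qed (use off \<eta> in auto)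
    show "\<bar>\<phi> z - \<phi> w\<bar> \<le> (s + s' + e) * norm (z - w)" for z w
      using lip1[of z w] lip1[of w z] by (simp add: norm_minus_commute abs_le_iff)
    show "\<bar>g z $ j\<bar> \<le> e" for z
    proof (cases "z \<in> (\<Union>n. B n)")
      case True
      then obtain n where n: "z \<in> B n" by blast
      show ?thesis using on(2)[OF n] tent_gradient_j e by (simp add: scaled_gradient_def)
    qed (use off e in auto)
  qed (use oV VU out ww aeg gV in auto)
qed

end

section \<open>The staircase\<close>

text \<open>Bernoulli's inequality with a real exponent, from the weighted inequality of arithmetic and geometric means
applied to \<open>1 + q t\<close> and \<open>1\<close> with weights \<open>1/q\<close> and \<open>1 - 1/q\<close>.\<close>

lemma bernoulli_powr:
  fixes t q :: real
  assumes q: "1 \<le> q" and t: "- 1 < t"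
  shows "1 + q * t \<le> (1 + t) powr q"
proof (cases "0 < 1 + q * t")
  case True
  have "(1 + q * t) powr (1 / q) * 1 powr (1 - 1 / q) \<le> 1 / q * (1 + q * t) + (1 - 1 / q) * 1"
    by (rule Youngs_inequality_0) (use q True in auto)
  also have "\<dots> = 1 + t" using q by (simp add: field_simps)
  finally have "(1 + q * t) powr (1 / q) \<le> 1 + t" by simp
  then have "((1 + q * t) powr (1 / q)) powr q \<le> (1 + t) powr q"
    using q by (intro powr_mono2) auto
  then show ?thesis using q True by (simp add: powr_powr)
next
  case False
  then show ?thesis using powr_ge_zero[of "1 + t" q] by linarith
qed

text \<open>Both bounds telescope when multiplied along \<open>y, y + 1, y + 2, \<dots>\<close>, and both products decay like the power \<open>- p\<close>.
They are Bernoulli's inequality for the increments \<open>1 / y\<close> and \<open>- 1 / (y + p)\<close>.\<close>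

lemma retained_fraction_bounds:
  fixes y p :: real
  assumes "0 < y" "1 \<le> p"
  shows "(y / (y + 1)) powr p \<le> y / (y + p)" and "y / (y + p) \<le> ((y + p - 1) / (y + p)) powr p"
proof -
  have "1 + p * (1 / y) \<le> (1 + 1 / y) powr p"
    using assms by (intro bernoulli_powr) (auto intro: less_trans[of _ 0])
  then have "(y + p) / y \<le> ((y + 1) / y) powr p" using assms by (simp add: field_simps)
  moreover have "0 < (y + p) / y" using assms by simp
  ultimately have "inverse (((y + 1) / y) powr p) \<le> inverse ((y + p) / y)" by (intro le_imp_inverse_le)
  then show "(y / (y + 1)) powr p \<le> y / (y + p)"
    using assms by (simp add: powr_divide)
  have "1 + p * (- 1 / (y + p)) \<le> (1 + (- 1 / (y + p))) powr p"
    using assms by (intro bernoulli_powr) (auto simp: field_simps)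
  then show "y / (y + p) \<le> ((y + p - 1) / (y + p)) powr p"
    using assms by (simp add: field_simps)
qed

locale staircase_data =
  fixes \<Lambda> a b \<alpha> :: real and \<Omega> :: "(real^2) set"
  assumes \<Lambda>: "1 < \<Lambda>" and a: "\<Lambda> / (\<Lambda> - 1) < a" and b: "0 < b" and \<alpha>: "0 < \<alpha>" "\<alpha> < 1"
    and \<Omega>: "open \<Omega>" "bounded \<Omega>" "\<Omega> \<noteq> {}"
begin

definition \<kappa> :: real where "\<kappa> = \<Lambda> / (\<Lambda> - 1)"
definition p :: real where "p = 2 * \<Lambda> / (\<Lambda> - 1)"
text \<open>The values that \<open>u\<^sub>x\<close> and \<open>v\<^sub>y\<close> take alternately on the part that is still modified.\<close>

definition slope :: "nat \<Rightarrow> real" where "slope k = a + real k"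
text \<open>Lowering an entry from \<open>slope k\<close> by this amount, while the other entry is \<open>slope (Suc k)\<close>, makes the quotient of the
two entries extremal.\<close>

definition fall :: "nat \<Rightarrow> real" where "fall k = slope k - slope (Suc k) / \<Lambda>"
text \<open>Stage \<open>k\<close> keeps the fraction \<open>y k / (y k + p)\<close> of the area, by \<open>fall_fraction\<close> below.\<close>

definition y :: "nat \<Rightarrow> real" where "y k = slope k + 1 - \<kappa>"
text \<open>The relative deviation allowed for \<open>u\<^sub>y\<close> and \<open>- v\<^sub>x\<close>: it is the solution of \<open>(1 + \<theta>) / (1 - \<theta>) = \<Lambda>\<close>.\<close>

definition \<theta> :: real where "\<theta> = (\<Lambda> - 1) / (\<Lambda> + 1)"
definition \<epsilon> :: "nat \<Rightarrow> real" where "\<epsilon> k = b * \<theta> * (1 / 2) ^ Suc k"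
text \<open>Even stages modify \<open>u\<close> in the first direction, odd stages modify \<open>v\<close> in the second one.\<close>

definition dir :: "nat \<Rightarrow> 2" where "dir k = (if even k then 1 else 2)"
definition codir :: "nat \<Rightarrow> 2" where "codir k = (if even k then 2 else 1)"
definition lip :: "nat \<Rightarrow> real" where "lip k = 2 + fall k + \<epsilon> k"
text \<open>The amplitude of stage \<open>k\<close>.  The second entry of the minimum is the one for which interpolation between the
sup norm \<open>\<eta> k\<close> and the Lipschitz constant \<open>lip k\<close> gives the Hoelder constant \<open>2\<close> to the power \<open>- k\<close>.\<close>

definition \<eta> :: "nat \<Rightarrow> real" where
  "\<eta> k = min ((1 / 2) ^ k) (((1 / 2) ^ k / lip k powr \<alpha>) powr (1 / (1 - \<alpha>)))"

lemma p_eq: "p = 2 * \<kappa>" by (simp add: p_def \<kappa>_def)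

lemma \<kappa>: "1 < \<kappa>" using \<Lambda> by (simp add: \<kappa>_def)

lemma p: "2 < p" using \<kappa> p_eq by simp

lemma a_pos: "\<kappa> < a" "1 < a" using a \<kappa> by (auto simp: \<kappa>_def)

lemma y: "1 < y 0" "y (Suc k) = y k + 1" "y k = y 0 + real k"
  using a_pos by (auto simp: y_def slope_def)

lemma y_pos: "0 < y k" using y(1) y(3)[of k] by simp

lemma fall_eq: "fall k = y k / \<kappa>"
  using \<Lambda> by (simp add: fall_def y_def slope_def \<kappa>_def field_simps)

lemma fall_pos: "0 < fall k" using y_pos \<kappa> by (simp add: fall_eq)

lemma slope_fall: "slope k - fall k = slope (Suc k) / \<Lambda>" by (simp add: fall_def)

text \<open>This identity fixes the critical exponent: with slopes \<open>2\<close> and \<open>- fall k\<close>, the part that is raised has the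
fraction on the left of the area.\<close>

lemma fall_fraction: "fall k / (2 + fall k) = y k / (y k + p)"
  using \<kappa> y_pos[of k] by (simp add: fall_eq p_eq field_simps)

lemma \<theta>: "0 < \<theta>" "\<theta> < 1" using \<Lambda> by (auto simp: \<theta>_def)

lemma \<epsilon>_pos: "0 < \<epsilon> k" using \<theta> b by (simp add: \<epsilon>_def)

lemma \<epsilon>_sum: "(\<Sum>j\<in>A. \<epsilon> j) \<le> b * \<theta>" if "finite A" for A
proof -
  have "(\<Sum>j\<in>A. \<epsilon> j) \<le> (\<Sum>j. \<epsilon> j)"
    using \<epsilon>_pos that unfolding \<epsilon>_def
    by (intro sum_le_suminf summable_mult sums_summable[OF power_half_series]) (auto intro: less_imp_le)
  also have "(\<Sum>j. \<epsilon> j) = b * \<theta>"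
    unfolding \<epsilon>_def using sums_mult[OF power_half_series, of "b * \<theta>"] by (simp add: sums_iff)
  finally show ?thesis .
qed

lemma lip_pos: "0 < lip k" using fall_pos[of k] \<epsilon>_pos[of k] by (simp add: lip_def)

lemma \<eta>_pos: "0 < \<eta> k" using lip_pos[of k] by (simp add: \<eta>_def)

lemma \<eta>_le: "\<eta> k \<le> (1 / 2) ^ k" by (simp add: \<eta>_def)

lemma \<eta>_lip: "\<eta> k powr (1 - \<alpha>) * lip k powr \<alpha> \<le> (1 / 2) ^ k"
proof -
  have "\<eta> k powr (1 - \<alpha>) \<le> (((1 / 2) ^ k / lip k powr \<alpha>) powr (1 / (1 - \<alpha>))) powr (1 - \<alpha>)"
    using \<alpha> \<eta>_pos[of k] by (intro powr_mono2) (auto simp: \<eta>_def)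
  also have "\<dots> = (1 / 2) ^ k / lip k powr \<alpha>" using \<alpha> lip_pos[of k] by (simp add: powr_powr)
  finally show ?thesis using lip_pos[of k] by (simp add: pos_le_divide_eq)
qed

lemma dir_codir: "dir k \<noteq> codir k" by (simp add: dir_def codir_def)

definition step :: "nat \<Rightarrow> (real^2) set \<Rightarrow> (real^2 \<Rightarrow> real) \<Rightarrow> (real^2 \<Rightarrow> real^2) \<Rightarrow> (real^2) set \<Rightarrow> bool" where
  "step k U \<phi> g V \<longleftrightarrow> open V \<and> V \<subseteq> U \<and> (\<forall>z. 0 \<le> \<phi> z \<and> \<phi> z \<le> \<eta> k) \<and>
    (\<forall>z. z \<notin> U \<longrightarrow> \<phi> z = 0 \<and> g z = 0) \<and> (\<forall>z w. \<bar>\<phi> z - \<phi> w\<bar> \<le> lip k * norm (z - w)) \<and>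
    whole_weak_gradient \<phi> g \<and> (\<forall>z. \<bar>g z $ codir k\<bar> \<le> \<epsilon> k) \<and>
    (AE z in lborel. (z \<in> V \<longrightarrow> g z $ dir k = 2) \<and> (z \<in> U - V \<longrightarrow> g z $ dir k = - fall k)) \<and>
    measure lborel V = y k / (y k + p) * measure lborel U"

lemma step_exists:
  assumes "open U" "bounded U"
  shows "\<exists>\<phi> g V. step k U \<phi> g V"
proof -
  interpret kite_shape "dir k" "codir k" 2 "fall k" "\<epsilon> k"
    using dir_codir fall_pos \<epsilon>_pos by unfold_locales auto
  show ?thesis
  proof (rule kite_splitting[OF assms \<eta>_pos[of k]])
    fix \<phi> g V
    assume "open V" "V \<subseteq> U" "\<And>z. 0 \<le> \<phi> z \<and> \<phi> z \<le> \<eta> k"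
      "\<And>z. z \<notin> U \<Longrightarrow> \<phi> z = 0" "\<And>z. z \<notin> U \<Longrightarrow> g z = 0"
      "\<And>z w. \<bar>\<phi> z - \<phi> w\<bar> \<le> (2 + fall k + \<epsilon> k) * norm (z - w)"
      "whole_weak_gradient \<phi> g" "\<And>z. \<bar>g z $ codir k\<bar> \<le> \<epsilon> k"
      "AE z in lborel. (z \<in> V \<longrightarrow> g z $ dir k = 2) \<and> (z \<in> U - V \<longrightarrow> g z $ dir k = - fall k)"
      "measure lborel V = fall k / (2 + fall k) * measure lborel U"
    then have "step k U \<phi> g V" unfolding step_def fall_fraction lip_def by simp
    then show "\<exists>\<phi> g V. step k U \<phi> g V" by blast
  qed
qed

end

text \<open>A completed staircase: \<open>U k\<close> is the set that is still modified at stage \<open>k\<close>, and \<open>\<phi> k\<close> with gradient \<open>g k\<close> is the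
modification made there.\<close>

locale staircase = staircase_data +
  fixes U :: "nat \<Rightarrow> (real^2) set" and \<phi> :: "nat \<Rightarrow> real^2 \<Rightarrow> real" and g :: "nat \<Rightarrow> real^2 \<Rightarrow> real^2"
  assumes U0: "U 0 = \<Omega>" and step: "\<And>k. step k (U k) (\<phi> k) (g k) (U (Suc k))"

lemma (in staircase_data) staircase_exists: "\<exists>U \<phi> g. staircase \<Lambda> a b \<alpha> \<Omega> U \<phi> g"
proof -
  let ?P = "\<lambda>(n::nat) V. open V \<and> bounded V \<and> (n = 0 \<longrightarrow> V = \<Omega>)"
  have "\<exists>U. \<forall>n. ?P n (U n) \<and> (\<exists>\<phi> g. step n (U n) \<phi> g (U (Suc n)))"
  proof (rule dependent_nat_choice)
    show "\<exists>V. ?P 0 V" using \<Omega> by blast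
    fix V and n :: nat assume V: "?P n V"
    then obtain \<phi> g W where s: "step n V \<phi> g W" using step_exists by blast
    then have "open W" "W \<subseteq> V" by (auto simp: step_def)
    with V s show "\<exists>W. ?P (Suc n) W \<and> (\<exists>\<phi> g. step n V \<phi> g W)"
      using bounded_subset by blast
  qed
  then obtain U where U: "U 0 = \<Omega>" "\<And>n. \<exists>\<phi> g. step n (U n) \<phi> g (U (Suc n))" by blast
  then obtain \<phi> g where "\<And>n. step n (U n) (\<phi> n) (g n) (U (Suc n))" by metis
  with U have "staircase \<Lambda> a b \<alpha> \<Omega> U \<phi> g"
    by unfold_locales auto
  then show ?thesis by blast
qed

context staircase
begin

lemma stepD:
  shows "U (Suc k) \<subseteq> U k" and "0 \<le> \<phi> k z" and "\<phi> k z \<le> \<eta> k"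
    and "z \<notin> U k \<Longrightarrow> \<phi> k z = 0" and "z \<notin> U k \<Longrightarrow> g k z = 0"
    and "\<bar>\<phi> k z - \<phi> k w\<bar> \<le> lip k * norm (z - w)" and "whole_weak_gradient (\<phi> k) (g k)"
    and "\<bar>g k z $ codir k\<bar> \<le> \<epsilon> k"
    and "AE z in lborel. (z \<in> U (Suc k) \<longrightarrow> g k z $ dir k = 2) \<and> (z \<in> U k - U (Suc k) \<longrightarrow> g k z $ dir k = - fall k)"
    and "measure lborel (U (Suc k)) = y k / (y k + p) * measure lborel (U k)"
  using step[of k] unfolding step_def by blast+

lemma U_mono: "m \<le> n \<Longrightarrow> U n \<subseteq> U m"
  by (induction rule: dec_induct) (use stepD(1) in auto)

lemma U_sub: "U k \<subseteq> \<Omega>" using U_mono[of 0 k] U0 by simp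

lemma open_U: "open (U k)"
  using step U0 \<Omega>(1) by (cases k) (auto simp: step_def)

lemma U_sets[measurable]: "U k \<in> sets borel" using open_U by simp

lemma bounded_U: "bounded (U k)" using bounded_subset[OF \<Omega>(2) U_sub] .

lemma finite_U: "emeasure lborel (U k) < \<infinity>"
  using bounded_U by (rule emeasure_bounded_finite)

abbreviation mass :: "nat \<Rightarrow> real" where "mass k \<equiv> measure lborel (U k)"

lemma mass_0: "0 < mass 0"
proof -
  have "\<not> negligible \<Omega>" by (rule open_not_negligible[OF \<Omega>(1,3)])
  moreover have l: "\<Omega> \<in> lmeasurable" using \<Omega> lmeasurable_open by blast
  ultimately have "measure lebesgue \<Omega> \<noteq> 0" unfolding negligible_iff_measure by blast
  moreover have "measure lebesgue \<Omega> = mass 0" using U0 U_sets[of 0] by simp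
  ultimately show ?thesis using measure_nonneg[of lborel "U 0"] by linarith
qed

text \<open>The product of the retained fractions is compared with the telescoping product of \<open>(y k / (y k + 1)) powr p\<close>.\<close>

lemma mass_lower: "mass 0 * real (Suc k) powr (- p) \<le> mass k"
proof -
  have "mass 0 * (y 0 / y k) powr p \<le> mass k"
  proof (induction k)
    case 0
    show ?case using y_pos[of 0] by simp
  next
    case (Suc k)
    have "mass 0 * (y 0 / y (Suc k)) powr p = (mass 0 * (y 0 / y k) powr p) * (y k / (y k + 1)) powr p"
      using y_pos[of 0] y_pos[of k] y(2)[of k] by (simp add: powr_divide)
    also have "\<dots> \<le> mass k * (y k / (y k + p))"
      by (intro mult_mono Suc retained_fraction_bounds) (use y_pos[of k] p in auto)
    finally show ?case by (simp add: stepD(10) mult.commute)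
  qed
  moreover have "(real (Suc k)) powr (- p) \<le> (y 0 / y k) powr p"
  proof -
    have "y k \<le> y 0 * real (Suc k)" using y(1) y(3)[of k] mult_right_mono[of 1 "y 0" "real k"] by (simp add: algebra_simps)
    then have "inverse (real (Suc k)) \<le> y 0 / y k" using y_pos[of k] by (simp add: field_simps)
    then have "inverse (real (Suc k)) powr p \<le> (y 0 / y k) powr p" using p by (intro powr_mono2) auto
    then show ?thesis by (simp add: powr_minus inverse_powr)
  qed
  ultimately show ?thesis using mult_left_mono[of "real (Suc k) powr (- p)" "(y 0 / y k) powr p" "mass 0"] mass_0 by linarith
qed

definition upper_const :: real where "upper_const = mass 0 * (y 0 + p - 1) powr p"

lemma upper_const: "0 < upper_const" using mass_0 y_pos[of 0] p by (simp add: upper_const_def)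

text \<open>The other half of the two-sided estimate; it telescopes in the shifted sequence \<open>y k + p - 1\<close>.\<close>

lemma mass_upper: "mass k \<le> upper_const * real (Suc k) powr (- p)"
proof -
  let ?s = "\<lambda>k. y k + p - 1"
  have s: "0 < ?s k" for k using y_pos[of k] p by linarith
  have "mass k \<le> mass 0 * (?s 0 / ?s k) powr p"
  proof (induction k)
    case 0
    show ?case using s[of 0] by simp
  next
    case (Suc k)
    have "mass (Suc k) = mass k * (y k / (y k + p))" by (simp add: stepD(10) mult.commute)
    also have "\<dots> \<le> (mass 0 * (?s 0 / ?s k) powr p) * ((y k + p - 1) / (y k + p)) powr p"
      by (intro mult_mono Suc retained_fraction_bounds) (use y_pos[of k] p mass_0 in auto)
    also have "\<dots> = mass 0 * (?s 0 / ?s (Suc k)) powr p"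
      using s[of 0] s[of k] s[of "Suc k"] y(2)[of k] by (simp add: powr_divide)
    finally show ?case .
  qed
  also have "(?s 0 / ?s k) powr p \<le> (?s 0 / real (Suc k)) powr p"
    using s[of 0] y(1) y(3)[of k] p by (intro powr_mono2 divide_left_mono) auto
  also have "(?s 0 / real (Suc k)) powr p = ?s 0 powr p * real (Suc k) powr (- p)"
    unfolding powr_divide powr_minus by (simp only: divide_inverse)
  finally show ?thesis using mass_0 by (simp add: upper_const_def mult.assoc)
qed

lemma summable_mass: "summable mass"
proof (rule summable_comparison_test'[of _ 0])
  have "summable (\<lambda>k. real k powr (- p))" using p by (simp add: summable_real_powr_iff)
  then have "summable (\<lambda>k. real (Suc k) powr (- p))" by (subst summable_Suc_iff)
  then show "summable (\<lambda>k. upper_const * real (Suc k) powr (- p))" by (rule summable_mult)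
qed (use mass_upper in auto)

lemma mass_diff: "measure lborel (U k - U (Suc k)) = mass k - mass (Suc k)"
  by (rule measure_Diff) (use finite_U[of k] stepD(1) in auto)

text \<open>The masses are summable, so they tend to zero and almost every point leaves the sets \<open>U k\<close>.\<close>

lemma AE_stops: "AE z in lborel. \<exists>k. z \<notin> U k"
proof -
  have "(\<Inter>k. U k) \<in> null_sets lborel"
  proof (rule null_setsI)
    have "emeasure lborel (\<Inter>k. U k) \<le> ennreal (mass k)" for k
      using emeasure_mono[of "\<Inter>k. U k" "U k" lborel] finite_U[of k] by (auto simp: emeasure_eq_ennreal_measure)
    moreover have "(\<lambda>k. ennreal (mass k)) \<longlonglongrightarrow> ennreal 0"
      by (rule tendsto_ennrealI[OF summable_LIMSEQ_zero[OF summable_mass]])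
    ultimately have "emeasure lborel (\<Inter>k. U k) \<le> ennreal 0"
      by (intro LIMSEQ_le_const[of _ "ennreal 0" "emeasure lborel (\<Inter>k. U k)"]) auto
    then show "emeasure lborel (\<Inter>k. U k) = 0" by simp
  qed auto
  then have "AE z in lborel. z \<notin> (\<Inter>k. U k)" by (rule AE_not_in)
  then show ?thesis by eventually_elim auto
qed

text \<open>The modification stops at \<open>z\<close> after stage \<open>k\<close>, and all gradients up to there have at \<open>z\<close> the values they should have.\<close>

definition regular_at :: "real^2 \<Rightarrow> nat \<Rightarrow> bool" where
  "regular_at z k \<longleftrightarrow> z \<in> U k - U (Suc k) \<and> (\<forall>j<k. g j z $ dir j = 2) \<and> g k z $ dir k = - fall k"

lemma AE_regular: "AE z in lborel. z \<in> \<Omega> \<longrightarrow> (\<exists>k. regular_at z k)"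
proof -
  have "AE z in lborel. \<forall>k. (z \<in> U (Suc k) \<longrightarrow> g k z $ dir k = 2) \<and> (z \<in> U k - U (Suc k) \<longrightarrow> g k z $ dir k = - fall k)"
    unfolding AE_all_countable by (intro allI stepD(9))
  with AE_stops show ?thesis
  proof eventually_elim
    case (elim z)
    show ?case
    proof
      assume "z \<in> \<Omega>"
      define n where "n = (LEAST k. z \<notin> U k)"
      have n: "z \<notin> U n" using elim(1) unfolding n_def by (metis LeastI)
      have l: "z \<in> U k" if "k < n" for k using that not_less_Least unfolding n_def by blast
      obtain k where k: "n = Suc k" using n \<open>z \<in> \<Omega>\<close> U0 by (cases n) auto
      have "regular_at z k" unfolding regular_at_def using n l k elim(2) by auto
      then show "\<exists>k. regular_at z k" ..
    qed
  qed
qed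

lemma regular_at_notin: "regular_at z k \<Longrightarrow> k < j \<Longrightarrow> z \<notin> U j"
  using U_mono[of "Suc k" j] by (auto simp: regular_at_def)

text \<open>The flag selects the parity of the stages: \<open>True\<close> collects the modifications of \<open>u\<close> and \<open>False\<close> those of \<open>v\<close>.\<close>

definition \<Phi> :: "bool \<Rightarrow> real^2 \<Rightarrow> real" where
  "\<Phi> e z = (\<Sum>k. if even k = e then \<phi> k z else 0)"

definition \<Gamma> :: "bool \<Rightarrow> real^2 \<Rightarrow> real^2" where
  "\<Gamma> e z = (\<Sum>k. if even k = e then g k z else 0)"

lemma summable_half: "summable (\<lambda>k. (1 / 2 :: real) ^ k)" by (simp add: summable_geometric)

lemma \<phi>_le_half: "\<phi> k z \<le> (1 / 2) ^ k"
  using stepD(3)[of k z] \<eta>_le[of k] by linarith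

lemma summable_\<phi>: "summable (\<lambda>k. if even k = e then \<phi> k z else 0)"
  by (rule summable_comparison_test'[OF summable_half, of 0])
    (use stepD(2) \<phi>_le_half in auto)

lemma \<Phi>_outside: "z \<notin> \<Omega> \<Longrightarrow> \<Phi> e z = 0"
proof -
  assume "z \<notin> \<Omega>"
  then have "\<phi> k z = 0" for k using U_sub[of k] stepD(4)[of z k] by blast
  then have "(\<lambda>k. if even k = e then \<phi> k z else 0) = (\<lambda>k. 0)" by (auto simp: fun_eq_iff)
  then show ?thesis by (simp add: \<Phi>_def)
qed

lemma \<Phi>_bounded: "\<bar>\<Phi> e z\<bar> \<le> 2"
proof -
  have "0 \<le> \<Phi> e z" unfolding \<Phi>_def by (rule suminf_nonneg[OF summable_\<phi>]) (use stepD(2) in auto)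
  moreover have "\<Phi> e z \<le> (\<Sum>k. (1 / 2) ^ k)" unfolding \<Phi>_def
    by (rule suminf_le[OF _ summable_\<phi> summable_half]) (use stepD(2) \<phi>_le_half in auto)
  ultimately show ?thesis using suminf_geometric[of "1/2 :: real"] by simp
qed

text \<open>Interpolation: the difference is at most \<open>\<eta> k\<close> and at most \<open>lip k\<close> times the distance, hence at most the product of
the powers \<open>1 - \<alpha>\<close> and \<open>\<alpha>\<close> of these bounds.\<close>

lemma \<phi>_holder: "\<bar>\<phi> k z - \<phi> k w\<bar> \<le> (1 / 2) ^ k * norm (z - w) powr \<alpha>"
proof -
  let ?d = "\<bar>\<phi> k z - \<phi> k w\<bar>"
  have d1: "?d \<le> \<eta> k" using stepD(2)[of k z] stepD(2)[of k w] stepD(3)[of k z] stepD(3)[of k w] by linarith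
  have d2: "?d \<le> lip k * norm (z - w)" by (rule stepD(6))
  have "?d = ?d powr (1 - \<alpha>) * ?d powr \<alpha>" by (cases "?d = 0") (auto simp flip: powr_add)
  also have "\<dots> \<le> \<eta> k powr (1 - \<alpha>) * (lip k * norm (z - w)) powr \<alpha>"
    using \<alpha> by (intro mult_mono powr_mono2 d1 d2) auto
  also have "\<dots> = (\<eta> k powr (1 - \<alpha>) * lip k powr \<alpha>) * norm (z - w) powr \<alpha>"
    using lip_pos[of k] by (simp add: powr_mult)
  also have "\<dots> \<le> (1 / 2) ^ k * norm (z - w) powr \<alpha>" by (intro mult_right_mono \<eta>_lip) auto
  finally show ?thesis .
qed

lemma \<Phi>_holder: "\<bar>\<Phi> e z - \<Phi> e w\<bar> \<le> 2 * norm (z - w) powr \<alpha>"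
proof -
  have "\<Phi> e z - \<Phi> e w = (\<Sum>k. (if even k = e then \<phi> k z else 0) - (if even k = e then \<phi> k w else 0))"
    unfolding \<Phi>_def by (rule suminf_diff[OF summable_\<phi> summable_\<phi>])
  also have "\<bar>\<dots>\<bar> \<le> (\<Sum>k. (1 / 2) ^ k * norm (z - w) powr \<alpha>)"
    unfolding real_norm_def[symmetric]
    by (rule norm_suminf_le) (use \<phi>_holder summable_half in \<open>auto intro: summable_mult2\<close>)
  also have "\<dots> = 2 * norm (z - w) powr \<alpha>"
    using suminf_mult2[OF summable_half, of "norm (z - w) powr \<alpha>"] suminf_geometric[of "1/2 :: real"] by simp
  finally show ?thesis .
qed

lemma \<Phi>_continuous: "continuous_on UNIV (\<Phi> e)"
proof (rule continuous_onI)
  fix z :: "real^2" and r :: real assume r: "0 < r"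
  show "\<exists>d>0. \<forall>w\<in>UNIV. dist w z < d \<longrightarrow> dist (\<Phi> e w) (\<Phi> e z) \<le> r"
  proof (intro exI conjI ballI impI)
    show "0 < (r / 2) powr (1 / \<alpha>)" using r by simp
    fix w assume "dist w z < (r / 2) powr (1 / \<alpha>)"
    then have "norm (w - z) powr \<alpha> \<le> ((r / 2) powr (1 / \<alpha>)) powr \<alpha>"
      using \<alpha> by (intro powr_mono2) (auto simp: dist_norm)
    also have "\<dots> = r / 2" using \<alpha> r by (simp add: powr_powr)
    finally show "dist (\<Phi> e w) (\<Phi> e z) \<le> r" using \<Phi>_holder[of e w z] by (simp add: dist_real_def)
  qed
qed

text \<open>The gradient of stage \<open>k\<close> is large only on the part that falls, and that part is small: since
\<open>fall k |U\<^sub>k - U\<^sub>k\<^sub>+\<^sub>1| = 2 |U\<^sub>k\<^sub>+\<^sub>1|\<close>, the \<open>L\<^sup>1\<close> norm is bounded by a multiple of \<open>mass k\<close>, and the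
masses are summable.\<close>

lemma \<Phi>_weak_gradient: "whole_weak_gradient (\<Phi> e) (\<Gamma> e)"
proof -
  let ?f = "\<lambda>k. if even k = e then \<phi> k else (\<lambda>z. 0)" and ?h = "\<lambda>k. if even k = e then g k else (\<lambda>z. 0)"
  have i: "integrable lborel (\<phi> k)" "integrable lborel (g k)" for k
    using stepD(7) by (auto simp: whole_weak_gradient_def)
  have "whole_weak_gradient (\<lambda>z. \<Sum>k. ?f k z) (\<lambda>z. \<Sum>k. ?h k z)"
  proof (rule whole_weak_gradient_suminf)
    show "whole_weak_gradient (?f k) (?h k)" for k
      using stepD(7)[of k] by (auto simp: whole_weak_gradient_def)
    have fin: "finite {k. z \<in> U k}" if "z \<notin> U n" for z n
      by (rule finite_subset[of _ "{..<n}"]) (use that U_mono[of n] in \<open>force simp: not_less[symmetric]\<close>)+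
    show "AE z in lborel. summable (\<lambda>k. \<bar>?f k z\<bar>)"
      using AE_stops by eventually_elim (rule exE, assumption, rule summable_finite[OF fin], assumption, use stepD(4) in auto)
    show "AE z in lborel. summable (\<lambda>k. norm (?h k z))"
      using AE_stops by eventually_elim (rule exE, assumption, rule summable_finite[OF fin], assumption, use stepD(5) in auto)
    show "summable (\<lambda>k. \<integral>z. \<bar>?f k z\<bar> \<partial>lborel)"
    proof (rule summable_comparison_test'[OF summable_mass])
      fix k
      have "(\<integral>z. \<bar>?f k z\<bar> \<partial>lborel) \<le> (\<integral>z. indicator (U k) z \<partial>lborel)"
      proof (rule integral_mono)
        show "integrable lborel (\<lambda>z. \<bar>?f k z\<bar>)" using i by auto
        show "integrable lborel (indicator (U k) :: _ \<Rightarrow> real)" using finite_U by (auto intro: integrable_real_indicator)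
        have "\<eta> k \<le> 1" using \<eta>_le[of k] power_le_one[of "1/2 :: real" k] by simp
        then show "\<bar>?f k z\<bar> \<le> indicator (U k) z" for z
          using stepD(2,3)[of k z] stepD(4)[of z k] by (auto simp: indicator_def)
      qed
      then show "norm (\<integral>z. \<bar>?f k z\<bar> \<partial>lborel) \<le> mass k" by simp
    qed
    show "summable (\<lambda>k. \<integral>z. norm (?h k z) \<partial>lborel)"
    proof (rule summable_comparison_test')
      show "summable (\<lambda>k. (4 + b * \<theta>) * mass k)" by (rule summable_mult[OF summable_mass])
      fix k
      let ?r = "\<lambda>z. 2 * indicator (U (Suc k)) z + fall k * indicator (U k - U (Suc k)) z + b * \<theta> * indicator (U k) z :: real"
      have fin: "emeasure lborel (U k - U (Suc k)) < \<infinity>"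
        using emeasure_mono[of "U k - U (Suc k)" "U k" lborel] finite_U[of k] by (auto intro: le_less_trans)
      have ir: "integrable lborel ?r"
        using finite_U[of k] finite_U[of "Suc k"] fin by (auto intro!: Bochner_Integration.integrable_add integrable_mult_right integrable_real_indicator)
      have "(\<integral>z. norm (?h k z) \<partial>lborel) \<le> (\<integral>z. ?r z \<partial>lborel)"
      proof (rule integral_mono_AE)
        show "integrable lborel (\<lambda>z. norm (?h k z))" using i by auto
        have "\<epsilon> k \<le> b * \<theta>" using \<epsilon>_sum[of "{k}"] by simp
        show "AE z in lborel. norm (?h k z) \<le> ?r z"
          using stepD(9)[of k]
        proof eventually_elim
          case (elim z)
          have "norm (g k z) \<le> \<bar>g k z $ dir k\<bar> + \<bar>g k z $ codir k\<bar>" by (rule norm_2_le[OF dir_codir])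
          with elim stepD(1)[of k] stepD(5)[of z k] stepD(8)[of k z] \<open>\<epsilon> k \<le> b * \<theta>\<close> fall_pos[of k] b \<theta>
          show ?case by (auto simp: indicator_def)
        qed
      qed (rule ir)
      also have "(\<integral>z. ?r z \<partial>lborel) = 2 * mass (Suc k) + fall k * (mass k - mass (Suc k)) + b * \<theta> * mass k"
        using finite_U[of k] finite_U[of "Suc k"] fin mass_diff[of k]
        by (simp add: integrable_real_indicator)
      also have "\<dots> = 4 * mass (Suc k) + b * \<theta> * mass k"
      proof -
        have "mass (Suc k) = fall k / (2 + fall k) * mass k" by (simp add: fall_fraction stepD(10))
        then show ?thesis using fall_pos[of k] by (simp add: field_simps)
      qed
      also have "\<dots> \<le> (4 + b * \<theta>) * mass k"
      proof -
        have "mass (Suc k) \<le> mass k" using mass_diff[of k] measure_nonneg[of lborel "U k - U (Suc k)"] by linarith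
        then show ?thesis by (simp add: algebra_simps)
      qed
      finally show "norm (\<integral>z. norm (?h k z) \<partial>lborel) \<le> (4 + b * \<theta>) * mass k" by simp
    qed
  qed
  moreover have "(\<lambda>z. \<Sum>k. ?f k z) = \<Phi> e" "(\<lambda>z. \<Sum>k. ?h k z) = \<Gamma> e"
    by (auto simp: \<Phi>_def \<Gamma>_def fun_eq_iff intro!: arg_cong[where f=suminf])
  ultimately show ?thesis by simp
qed

lemma \<Gamma>_regular:
  assumes "regular_at z k"
  shows "\<Gamma> e z = (\<Sum>j\<le>k. if even j = e then g j z else 0)"
  unfolding \<Gamma>_def
  by (rule suminf_finite) (use regular_at_notin[OF assms] stepD(5) in auto)

text \<open>\<open>G\<close> will be the gradient of \<open>u\<close> and \<open>H\<close> that of the stream function \<open>v\<close>.\<close>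

definition G :: "real^2 \<Rightarrow> real^2" where "G z = vector [a, b] + \<Gamma> True z"
definition H :: "real^2 \<Rightarrow> real^2" where "H z = vector [- b, a + 1] + \<Gamma> False z"

lemma sum_even: "(\<Sum>j<k. if even j then 2 else 0) = (if even k then real k else real k + 1)"
  by (induction k) auto

lemma sum_odd: "(\<Sum>j<k. if even j then 0 else 2) = (if even k then real k else real k - 1)"
  by (induction k) auto

text \<open>Each stage of the right parity before \<open>k\<close> contributes \<open>2\<close>, and stage \<open>k\<close> contributes \<open>- fall k\<close> to the one entry it
modifies.  Hence one entry has reached \<open>slope (Suc k)\<close> and the other one has just been lowered to
\<open>slope (Suc k) / \<Lambda>\<close>.\<close>

lemma regular_longitudinal:
  assumes r: "regular_at z k"
  shows "G z $ 1 = (if even k then slope (Suc k) / \<Lambda> else slope (Suc k))"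
    and "H z $ 2 = (if even k then slope (Suc k) else slope (Suc k) / \<Lambda>)"
proof -
  have eq: "(\<Sum>j\<le>k. if even j = e then g j z else 0) $ (if e then 1 else 2)
     = (\<Sum>j<k. if even j = e then 2 else 0) + (if even k = e then - fall k else 0)" for e
  proof -
    have "(\<Sum>j\<le>k. if even j = e then g j z else 0) $ (if e then 1 else 2)
      = (\<Sum>j\<le>k. if even j = e then g j z $ dir j else 0)"
      by (auto simp: dir_def sum_component intro!: sum.cong)
    also have "\<dots> = (\<Sum>j<k. if even j = e then g j z $ dir j else 0) + (if even k = e then g k z $ dir k else 0)"
      by (simp add: lessThan_Suc_atMost[symmetric])
    also have "(\<Sum>j<k. if even j = e then g j z $ dir j else 0) = (\<Sum>j<k. if even j = e then 2 else 0)"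
      using r by (intro sum.cong) (auto simp: regular_at_def)
    finally show ?thesis using r by (simp add: regular_at_def)
  qed
  have "G z $ 1 = a + ((if even k then real k else real k + 1) + (if even k then - fall k else 0))"
    using eq[of True] \<Gamma>_regular[OF r, of True] by (simp add: G_def sum_even)
  then show "G z $ 1 = (if even k then slope (Suc k) / \<Lambda> else slope (Suc k))"
    using slope_fall[of k] by (auto simp: slope_def)
  have "(\<Sum>j<k. if even j = False then 2 else 0 :: real) = (\<Sum>j<k. if even j then 0 else 2)"
    by (intro sum.cong) auto
  then have "H z $ 2 = a + 1 + ((if even k then real k else real k - 1) + (if even k then 0 else - fall k))"
    using eq[of False] \<Gamma>_regular[OF r, of False] by (simp add: H_def sum_odd)
  then show "H z $ 2 = (if even k then slope (Suc k) else slope (Suc k) / \<Lambda>)"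
    using slope_fall[of k] by (auto simp: slope_def)
qed

lemma regular_transversal:
  assumes r: "regular_at z k"
  shows "\<bar>G z $ 2 - b\<bar> \<le> b * \<theta>" and "\<bar>H z $ 1 + b\<bar> \<le> b * \<theta>"
proof -
  have "\<bar>\<Gamma> e z $ (if e then 2 else 1)\<bar> \<le> b * \<theta>" for e
  proof -
    have "\<bar>\<Gamma> e z $ (if e then 2 else 1)\<bar> = \<bar>\<Sum>j\<le>k. if even j = e then g j z $ codir j else 0\<bar>"
      unfolding \<Gamma>_regular[OF r]
      by (rule arg_cong[where f=abs]) (auto simp: codir_def sum_component intro!: sum.cong)
    also have "\<dots> \<le> (\<Sum>j\<le>k. \<epsilon> j)"
      by (intro order_trans[OF sum_abs] sum_mono) (use stepD(8) \<epsilon>_pos in \<open>auto intro: less_imp_le\<close>)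
    also have "\<dots> \<le> b * \<theta>" by (rule \<epsilon>_sum) simp
    finally show ?thesis .
  qed
  from this[of True] this[of False] show "\<bar>G z $ 2 - b\<bar> \<le> b * \<theta>" "\<bar>H z $ 1 + b\<bar> \<le> b * \<theta>"
    by (simp_all add: G_def H_def)
qed

text \<open>The longitudinal quotient is \<open>\<Lambda>\<close> or \<open>1 / \<Lambda>\<close>; the transversal entries lie in
\<open>[b (1 - \<theta>), b (1 + \<theta>)]\<close>, whose end points have the quotient \<open>\<Lambda>\<close>.\<close>

lemma regular_ratios:
  assumes r: "regular_at z k"
  shows "0 < G z $ 1" "0 < G z $ 2" "1 / \<Lambda> \<le> H z $ 2 / G z $ 1" "H z $ 2 / G z $ 1 \<le> \<Lambda>"
    "1 / \<Lambda> \<le> - H z $ 1 / G z $ 2" "- H z $ 1 / G z $ 2 \<le> \<Lambda>"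
proof -
  have x: "0 < slope (Suc k)" using a_pos by (simp add: slope_def)
  have "1 / \<Lambda> \<le> \<Lambda>" using \<Lambda> by (simp add: divide_le_eq) (metis less_imp_le mult_mono' mult_1 zero_le_one)
  with x \<Lambda> show "0 < G z $ 1" "1 / \<Lambda> \<le> H z $ 2 / G z $ 1" "H z $ 2 / G z $ 1 \<le> \<Lambda>"
    unfolding regular_longitudinal[OF r] by auto
  have t: "1 - \<theta> = 2 / (\<Lambda> + 1)" "1 + \<theta> = \<Lambda> * (2 / (\<Lambda> + 1))" using \<Lambda> by (auto simp: \<theta>_def field_simps)
  let ?q = "b * (2 / (\<Lambda> + 1))"
  have q: "0 < ?q" using b \<Lambda> by simp
  have "b * (1 - \<theta>) = ?q" "b * (1 + \<theta>) = \<Lambda> * ?q" unfolding t by simp_all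
  then have G2: "?q \<le> G z $ 2" "G z $ 2 \<le> \<Lambda> * ?q" and H1: "?q \<le> - H z $ 1" "- H z $ 1 \<le> \<Lambda> * ?q"
    using regular_transversal[OF r] by (auto simp: algebra_simps abs_le_iff)
  show G2p: "0 < G z $ 2" using G2 q by linarith
  have "G z $ 2 \<le> \<Lambda> * (- H z $ 1)" using G2(2) mult_left_mono[OF H1(1), of \<Lambda>] \<Lambda> by linarith
  then show "1 / \<Lambda> \<le> - H z $ 1 / G z $ 2" using G2p \<Lambda> by (simp add: field_simps)
  have "- H z $ 1 \<le> \<Lambda> * G z $ 2" using H1(2) mult_left_mono[OF G2(1), of \<Lambda>] \<Lambda> by linarith
  then show "- H z $ 1 / G z $ 2 \<le> \<Lambda>" using G2p by (simp only: pos_divide_le_eq)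
qed

lemma regular_norm:
  assumes r: "regular_at z k"
  shows "slope (Suc k) / \<Lambda> \<le> norm (G z)" and "norm (G z) \<le> slope (Suc k) + 2 * b"
proof -
  have x: "0 < slope (Suc k)" using a_pos by (simp add: slope_def)
  then have xL: "slope (Suc k) / \<Lambda> \<le> slope (Suc k)" using \<Lambda> by (simp add: divide_le_eq mult_left_mono)
  have "slope (Suc k) / \<Lambda> \<le> G z $ 1" using regular_longitudinal(1)[OF r] xL by simp
  also have "\<dots> \<le> norm (G z)" using component_le_norm_cart[of "G z" 1] by linarith
  finally show "slope (Suc k) / \<Lambda> \<le> norm (G z)" .
  have "0 < slope (Suc k) / \<Lambda>" using x \<Lambda> by simp
  then have "\<bar>G z $ 1\<bar> \<le> slope (Suc k)" using regular_longitudinal(1)[OF r] xL x by (simp add: abs_le_iff)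
  moreover have "\<bar>G z $ 2\<bar> \<le> 2 * b"
  proof -
    have "b * \<theta> \<le> b" using \<theta> b by (intro mult_left_le) auto
    with regular_transversal(1)[OF r] b show ?thesis by linarith
  qed
  moreover have "norm (G z) \<le> \<bar>G z $ 1\<bar> + \<bar>G z $ 2\<bar>" by (rule norm_2_le) simp
  ultimately show "norm (G z) \<le> slope (Suc k) + 2 * b" by linarith
qed

section \<open>Integrability of the gradient\<close>

lemma \<Gamma>_measurable[measurable]: "\<Gamma> e \<in> borel_measurable borel"
  using \<Phi>_weak_gradient[of e] by (auto simp: whole_weak_gradient_def dest: borel_measurable_integrable)

lemma \<Phi>_measurable[measurable]: "\<Phi> e \<in> borel_measurable borel"
  by (rule borel_measurable_continuous_onI[OF \<Phi>_continuous])

lemma GH_measurable[measurable]: "G \<in> borel_measurable borel" "H \<in> borel_measurable borel"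
  unfolding G_def[abs_def] H_def[abs_def] by measurable

lemma \<Omega>_sets[measurable]: "\<Omega> \<in> sets borel" using \<Omega> by simp

definition level :: "real \<Rightarrow> (real^2) set" where "level t = {z \<in> \<Omega>. t < norm (G z)}"

lemma level_sets[measurable]: "level t \<in> sets borel"
proof -
  have "level t = \<Omega> \<inter> {z \<in> space borel. t < norm (G z)}" by (auto simp: level_def)
  then show ?thesis by simp
qed

lemma finite_level: "emeasure lborel (level t) < \<infinity>"
  by (rule emeasure_bounded_finite) (use \<Omega>(2) in \<open>auto simp: level_def intro: bounded_subset\<close>)

lemma slope_mono: "i \<le> j \<Longrightarrow> slope i \<le> slope j" by (simp add: slope_def)

text \<open>A point that stops before stage \<open>k\<close> has gradient at most \<open>slope k + 2 * b\<close>.\<close>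

lemma level_upper:
  assumes "slope k + 2 * b \<le> t"
  shows "measure lborel (level t) \<le> mass k"
proof -
  have "AE z in lborel. z \<in> level t \<longrightarrow> z \<in> U k"
    using AE_regular
  proof eventually_elim
    case (elim z)
    show ?case
    proof
      assume z: "z \<in> level t"
      then obtain j where j: "regular_at z j" using elim by (auto simp: level_def)
      have "\<not> Suc j \<le> k"
        using regular_norm(2)[OF j] slope_mono[of "Suc j" k] assms z by (auto simp: level_def)
      then have "U j \<subseteq> U k" by (intro U_mono) auto
      with j show "z \<in> U k" by (auto simp: regular_at_def)
    qed
  qed
  then have "emeasure lborel (level t) \<le> emeasure lborel (U k)" by (rule emeasure_mono_AE) simp
  then show ?thesis unfolding measure_def using finite_U[of k] by (intro enn2real_mono) auto
qed

lemma AE_norm_lower: "AE z in lborel. z \<in> U k \<longrightarrow> slope k / \<Lambda> \<le> norm (G z)"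
  using AE_regular
proof eventually_elim
  case (elim z)
  show ?case
  proof
    assume z: "z \<in> U k"
    then obtain j where j: "regular_at z j" using elim U_sub by blast
    have "k \<le> j" using regular_at_notin[OF j, of k] z by (cases "j < k") auto
    then have "slope k / \<Lambda> \<le> slope (Suc j) / \<Lambda>" using \<Lambda> slope_mono[of k "Suc j"] by (intro divide_right_mono) auto
    with regular_norm(1)[OF j] show "slope k / \<Lambda> \<le> norm (G z)" by linarith
  qed
qed

text \<open>A point of \<open>U k\<close> stops at stage \<open>k\<close> or later, with gradient at least \<open>slope k / \<Lambda>\<close>.\<close>

lemma level_lower:
  assumes "t < slope k / \<Lambda>"
  shows "mass k \<le> measure lborel (level t)"
proof -
  have "AE z in lborel. z \<in> U k \<longrightarrow> z \<in> level t"
    using AE_norm_lower[of k] by eventually_elim (use assms U_sub in \<open>auto simp: level_def\<close>)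
  then have "emeasure lborel (U k) \<le> emeasure lborel (level t)" by (rule emeasure_mono_AE) simp
  then show ?thesis unfolding measure_def using finite_level[of t] by (intro enn2real_mono) auto
qed

lemma tail_upper: "\<exists>C. \<forall>t>0. t powr p * measure lborel (level t) \<le> C"
proof -
  \<comment> \<open>Beyond \<open>T\<close> the offset \<open>a + 2 * b\<close> is at most half of \<open>t\<close>, so \<open>Suc k\<close> below exceeds \<open>t / 2\<close>.\<close>
  define T where "T = 2 * (a + 2 * b)"
  have T: "0 < T" using a_pos b by (simp add: T_def)
  have "t powr p * measure lborel (level t) \<le> max (T powr p * mass 0) (2 powr p * upper_const)" if t: "0 < t" for t
  proof (cases "t \<le> T")
    case True
    have "level t \<subseteq> U 0" using U0 by (auto simp: level_def)
    then have "measure lborel (level t) \<le> mass 0"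
      using finite_U[of 0] emeasure_mono[of "level t" "U 0" lborel] unfolding measure_def by (intro enn2real_mono) auto
    then have "t powr p * measure lborel (level t) \<le> T powr p * mass 0"
      using t True p T by (intro mult_mono powr_mono2) auto
    then show ?thesis by simp
  next
    case False
    \<comment> \<open>The last stage before which points that stop still have gradient at most \<open>t\<close>.\<close>
    define k where "k = nat \<lfloor>t - a - 2 * b\<rfloor>"
    have pos: "0 \<le> t - a - 2 * b" using False a_pos b by (simp add: T_def)
    then have k: "real k \<le> t - a - 2 * b" "t - a - 2 * b < real k + 1" by (auto simp: k_def)
    have "measure lborel (level t) \<le> mass k" by (rule level_upper) (use k in \<open>simp add: slope_def\<close>)
    also have "\<dots> \<le> upper_const * real (Suc k) powr (- p)" by (rule mass_upper)
    also have "\<dots> \<le> upper_const * (t / 2) powr (- p)"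
      using k(2) False t p upper_const by (intro mult_left_mono powr_mono2') (auto simp: T_def)
    finally have "t powr p * measure lborel (level t) \<le> t powr p * (upper_const * (t / 2) powr (- p))"
      by (intro mult_left_mono) auto
    also have "\<dots> = 2 powr p * upper_const" using t by (simp add: powr_minus powr_divide)
    finally show ?thesis by simp
  qed
  then show ?thesis by blast
qed

lemma tail_lower:
  assumes t: "1 \<le> t"
  shows "mass 0 * ((\<Lambda> + 2) * t) powr (- p) \<le> measure lborel (level t)"
proof -
  \<comment> \<open>A stage that every point with gradient at most \<open>t\<close> has stopped before, up to a null set; it is at most linear in \<open>t\<close>.\<close>
  define k where "k = nat \<lceil>\<Lambda> * t\<rceil>"
  have Lt: "0 < \<Lambda> * t" using t \<Lambda> by simp
  then have k: "\<Lambda> * t \<le> real k" "real k < \<Lambda> * t + 1" by (auto simp: k_def) linarith+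
  have "\<Lambda> * t < slope k" using k(1) a_pos by (simp add: slope_def)
  then have "t < slope k / \<Lambda>" using \<Lambda> by (simp add: field_simps)
  have "mass 0 * ((\<Lambda> + 2) * t) powr (- p) \<le> mass 0 * real (Suc k) powr (- p)"
    using k(2) t p mass_0 by (intro mult_left_mono powr_mono2') (auto simp: algebra_simps)
  also have "\<dots> \<le> mass k" by (rule mass_lower)
  also have "\<dots> \<le> measure lborel (level t)" by (rule level_lower) fact
  finally show ?thesis .
qed

lemma emeasure_level: "emeasure lebesgue {z \<in> \<Omega>. t < norm (G z)} = ennreal (measure lborel (level t))"
  and measure_level: "measure lebesgue {z \<in> \<Omega>. t < norm (G z)} = measure lborel (level t)"
proof -
  show "emeasure lebesgue {z \<in> \<Omega>. t < norm (G z)} = ennreal (measure lborel (level t))"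
    using finite_level[of t] level_sets[of t] by (simp add: level_def[symmetric] emeasure_eq_ennreal_measure)
  show "measure lebesgue {z \<in> \<Omega>. t < norm (G z)} = measure lborel (level t)"
    using level_sets[of t] by (simp add: level_def[symmetric])
qed

lemma G_set_measurable: "set_borel_measurable lebesgue \<Omega> G"
  by (rule set_integrable_lebesgue_borel(3)) measurable

lemma G_weak_Lp: "in_weak_Lp p \<Omega> G"
proof -
  obtain C where C: "\<And>t. 0 < t \<Longrightarrow> t powr p * measure lborel (level t) \<le> C" using tail_upper by blast
  have "(SUP t\<in>{0<..}. ennreal (t powr p) * emeasure lebesgue {z \<in> \<Omega>. t < norm (G z)}) \<le> ennreal C"
  proof (rule SUP_least)
    fix t :: real assume "t \<in> {0<..}"
    then have "ennreal (t powr p * measure lborel (level t)) \<le> ennreal C" using C by (intro ennreal_leI) auto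
    then show "ennreal (t powr p) * emeasure lebesgue {z \<in> \<Omega>. t < norm (G z)} \<le> ennreal C"
      by (simp add: emeasure_level ennreal_mult)
  qed
  also have "\<dots> < \<infinity>" by simp
  finally show ?thesis using G_set_measurable unfolding in_weak_Lp_def by blast
qed

text \<open>The lower bound for the level sets makes the integrand at least \<open>c / t\<close> for \<open>t \<ge> 1\<close>, whatever \<open>r\<close> is, and the
integral of \<open>c / t\<close> diverges.\<close>

lemma G_not_Lorentz:
  assumes r: "0 < r"
  shows "\<not> in_Lorentz p r \<Omega> G"
proof
  assume "in_Lorentz p r \<Omega> G"
  then have fin: "(\<integral>\<^sup>+ t\<in>{0<..}. ennreal (measure lborel (level t) powr (r / p) * t powr r / t) \<partial>lborel) < \<infinity>"
    by (simp add: in_Lorentz_def measure_level)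
  define c where "c = (mass 0 * (\<Lambda> + 2) powr (- p)) powr (r / p)"
  have c: "0 < c" using mass_0 \<Lambda> by (simp add: c_def)
  have low: "c / t \<le> measure lborel (level t) powr (r / p) * t powr r / t" if t: "1 \<le> t" for t
  proof -
    have "c * t powr (- r) = (mass 0 * ((\<Lambda> + 2) * t) powr (- p)) powr (r / p)"
      using \<Lambda> t p mass_0 by (simp add: c_def powr_mult powr_powr)
    also have "\<dots> \<le> measure lborel (level t) powr (r / p)"
      using tail_lower[OF t] mass_0 r p by (intro powr_mono2) auto
    finally have "c * t powr (- r) * t powr r / t \<le> measure lborel (level t) powr (r / p) * t powr r / t"
      using t by (intro divide_right_mono mult_right_mono) auto
    moreover have "t powr (- r) * t powr r = 1" using t by (simp flip: powr_add)
    ultimately show ?thesis by (simp add: mult.assoc)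
  qed
  obtain K where K: "(\<integral>\<^sup>+ t\<in>{0<..}. ennreal (measure lborel (level t) powr (r / p) * t powr r / t) \<partial>lborel) = ennreal K" "0 \<le> K"
    using fin by (cases "\<integral>\<^sup>+ t\<in>{0<..}. ennreal (measure lborel (level t) powr (r / p) * t powr r / t) \<partial>lborel") auto
  \<comment> \<open>Chosen such that the integral of \<open>c / t\<close> over \<open>[1, R]\<close> is \<open>K + 1\<close>.\<close>
  define R where "R = exp ((K + 1) / c)"
  have R: "1 \<le> R" using K c by (simp add: R_def)
  have "ennreal (c * ln R - c * ln 1) = (\<integral>\<^sup>+ t. ennreal (c / t) * indicator {1..R} t \<partial>lborel)"
    by (rule nn_integral_FTC_Icc[symmetric]) (use c R in \<open>auto intro!: derivative_eq_intros\<close>)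
  also have "\<dots> \<le> (\<integral>\<^sup>+ t\<in>{0<..}. ennreal (measure lborel (level t) powr (r / p) * t powr r / t) \<partial>lborel)"
    by (rule nn_integral_mono) (use low in \<open>auto simp: indicator_def intro!: ennreal_leI\<close>)
  finally have "ennreal (K + 1) \<le> ennreal K" using c by (simp add: K R_def)
  then show False using K(2) by (simp add: ennreal_le_iff)
qed

text \<open>If the \<open>p\<close>-th power of the norm were integrable, its integrals over \<open>U k\<close> would tend to zero with the measure of \<open>U k\<close>.
But they are bounded below, by \<open>mass k\<close> times the \<open>p\<close>-th power of \<open>slope k / \<Lambda>\<close>.\<close>

lemma G_not_Lp: "\<not> in_Lp p \<Omega> G"
proof
  assume "in_Lp p \<Omega> G"
  then have "set_integrable lebesgue \<Omega> (\<lambda>z. norm (G z) powr p)" by (simp add: in_Lp_def)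
  then have int: "integrable lborel (\<lambda>z. indicator \<Omega> z *\<^sub>R norm (G z) powr p)"
    by (subst (asm) set_integrable_lebesgue_borel) measurable
  let ?f = "\<lambda>k z. indicator (U k) z * norm (G z) powr p"
  have if': "integrable lborel (?f k)" for k
    by (rule Bochner_Integration.integrable_bound[OF int])
      (use U_sub in \<open>auto intro!: AE_I2 simp: indicator_def\<close>)
  have "(\<lambda>k. \<integral>z. ?f k z \<partial>lborel) \<longlonglongrightarrow> (\<integral>z. 0 \<partial>(lborel :: (real^2) measure))"
  proof (rule integral_dominated_convergence[OF _ _ int])
    show "AE z in lborel. (\<lambda>k. ?f k z) \<longlonglongrightarrow> 0"
      using AE_stops
    proof eventually_elim
      case (elim z)
      then obtain n where n: "z \<notin> U n" by blast
      have "\<forall>\<^sub>F k in sequentially. ?f k z = 0"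
        using eventually_ge_at_top[of n] by eventually_elim (use n U_mono[of n] in \<open>auto simp: indicator_def\<close>)
      then show ?case by (simp add: tendsto_eventually)
    qed
    show "AE z in lborel. norm (?f k z) \<le> indicator \<Omega> z *\<^sub>R norm (G z) powr p" for k
      using U_sub[of k] by (auto intro!: AE_I2 simp: indicator_def)
  qed measurable
  moreover have "mass 0 * \<Lambda> powr (- p) \<le> (\<integral>z. ?f k z \<partial>lborel)" for k
  proof -
    have "real (Suc k) \<le> slope k" using a_pos by (simp add: slope_def)
    then have "(real (Suc k) / \<Lambda>) powr p \<le> (slope k / \<Lambda>) powr p"
      using \<Lambda> p by (intro powr_mono2 divide_right_mono) auto
    then have "mass 0 * real (Suc k) powr (- p) * (real (Suc k) / \<Lambda>) powr p \<le> mass k * (slope k / \<Lambda>) powr p"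
      by (intro mult_mono mass_lower) auto
    moreover have "real (Suc k) powr (- p) * (real (Suc k) / \<Lambda>) powr p = \<Lambda> powr (- p)"
      unfolding powr_divide powr_minus using \<Lambda> by (simp add: field_simps del: of_nat_Suc)
    ultimately have "mass 0 * \<Lambda> powr (- p) \<le> mass k * (slope k / \<Lambda>) powr p" by (simp add: mult.assoc)
    also have "\<dots> = (\<integral>z. (slope k / \<Lambda>) powr p * indicator (U k) z \<partial>lborel)" by (simp add: mult.commute)
    also have "\<dots> \<le> (\<integral>z. ?f k z \<partial>lborel)"
    proof (rule integral_mono_AE[OF _ if'])
      show "integrable lborel (\<lambda>z. (slope k / \<Lambda>) powr p * indicator (U k) z)"
        using finite_U[of k] by (intro integrable_mult_right integrable_real_indicator) auto
      show "AE z in lborel. (slope k / \<Lambda>) powr p * indicator (U k) z \<le> ?f k z"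
        using AE_norm_lower[of k]
      proof eventually_elim
        case (elim z)
        have "0 \<le> slope k / \<Lambda>" using a_pos \<Lambda> by (simp add: slope_def)
        with elim p show ?case by (auto simp: indicator_def intro!: powr_mono2)
      qed
    qed
    finally show ?thesis .
  qed
  ultimately have "mass 0 * \<Lambda> powr (- p) \<le> 0"
    by (intro LIMSEQ_le_const[of "\<lambda>k. \<integral>z. ?f k z \<partial>lborel"]) auto
  then show False using mass_0 \<Lambda> by (simp add: mult_le_0_iff)
qed

text \<open>On the part that stops at stage \<open>k\<close> the squared norm is at most of order \<open>k\<^sup>2\<close>, and this part has measure at most of order \<open>k powr (- p - 1)\<close>.
The sum converges because \<open>p > 2\<close>.\<close>

lemma G_L2: "in_Lp 2 \<Omega> G"
proof -
  define w where "w k = (slope (Suc k) + 2 * b)\<^sup>2" for k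
  let ?D = "\<lambda>k. U k - U (Suc k)"
  have md: "emeasure lborel (?D k) = ennreal (mass k - mass (Suc k))" for k
  proof -
    have "emeasure lborel (?D k) < \<infinity>"
      using emeasure_mono[of "?D k" "U k" lborel] finite_U[of k] by (auto intro: le_less_trans)
    then show ?thesis by (simp add: emeasure_eq_ennreal_measure mass_diff[symmetric])
  qed
  have mdn: "0 \<le> mass k - mass (Suc k)" for k using mass_diff[of k] by (metis measure_nonneg)
  define W where "W = a + 1 + 2 * b"
  have bd: "w k * (mass k - mass (Suc k)) \<le> W\<^sup>2 * p * upper_const * real (Suc k) powr (1 - p)" for k
  proof -
    have "mass k - mass (Suc k) = mass k * (p / (y k + p))"
      using y_pos[of k] p by (simp add: stepD(10) field_simps)
    also have "\<dots> \<le> (upper_const * real (Suc k) powr (- p)) * (p / real (Suc k))"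
      using y(1) y(3)[of k] p upper_const by (intro mult_mono mass_upper divide_left_mono) auto
    finally have m: "mass k - mass (Suc k) \<le> upper_const * real (Suc k) powr (- p) * (p / real (Suc k))" .
    have W0: "0 \<le> (a + 2 * b) * real k" using a_pos b by simp
    have "slope (Suc k) + 2 * b \<le> W * real (Suc k)" using W0 by (simp add: slope_def W_def algebra_simps)
    then have "w k \<le> (W * real (Suc k))\<^sup>2" unfolding w_def using a_pos b by (intro power_mono) (auto simp: slope_def)
    then have "w k * (mass k - mass (Suc k)) \<le> (W * real (Suc k))\<^sup>2 * (upper_const * real (Suc k) powr (- p) * (p / real (Suc k)))"
      using m mdn by (intro mult_mono) auto
    also have "\<dots> = W\<^sup>2 * p * upper_const * (real (Suc k) powr (- p) * real (Suc k))"
      by (simp add: power2_eq_square field_simps del: of_nat_Suc)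
    also have "real (Suc k) powr (- p) * real (Suc k) = real (Suc k) powr (1 - p)"
      using powr_add[of "real (Suc k)" 1 "- p"] by (simp add: mult.commute)
    finally show ?thesis .
  qed
  have sm: "summable (\<lambda>k. w k * (mass k - mass (Suc k)))"
  proof (rule summable_comparison_test'[of _ 0])
    have "summable (\<lambda>k. real k powr (1 - p))" using p by (simp add: summable_real_powr_iff)
    then have "summable (\<lambda>k. real (Suc k) powr (1 - p))" by (subst summable_Suc_iff)
    then show "summable (\<lambda>k. W\<^sup>2 * p * upper_const * real (Suc k) powr (1 - p))" by (rule summable_mult)
    show "norm (w k * (mass k - mass (Suc k))) \<le> W\<^sup>2 * p * upper_const * real (Suc k) powr (1 - p)" for k
      using bd[of k] mdn[of k] by (simp add: w_def abs_mult)
  qed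
  have "(\<integral>\<^sup>+z. ennreal (norm (indicator \<Omega> z *\<^sub>R norm (G z) powr 2)) \<partial>lborel)
     \<le> (\<integral>\<^sup>+z. (\<Sum>k. ennreal (w k) * indicator (?D k) z) \<partial>lborel)"
  proof (rule nn_integral_mono_AE)
    show "AE z in lborel. ennreal (norm (indicator \<Omega> z *\<^sub>R norm (G z) powr 2)) \<le> (\<Sum>k. ennreal (w k) * indicator (?D k) z)"
      using AE_regular
    proof eventually_elim
      case (elim z)
      show ?case
      proof (cases "z \<in> \<Omega>")
        case True
        then obtain k where k: "regular_at z k" using elim by blast
        have "norm (G z) powr 2 \<le> w k"
          using power_mono[OF regular_norm(2)[OF k], of 2] by (simp add: w_def powr_numeral)
        then have "ennreal (norm (indicator \<Omega> z *\<^sub>R norm (G z) powr 2)) \<le> ennreal (w k) * indicator (?D k) z"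
          using True k by (auto simp: regular_at_def intro!: ennreal_leI)
        also have "\<dots> \<le> (\<Sum>k. ennreal (w k) * indicator (?D k) z)"
        proof -
          define f where "f j = ennreal (w j) * indicator (?D j) z" for j
          have "sum f {k} \<le> suminf f" by (rule sum_le_suminf) (auto intro: summableI)
          then have "f k \<le> suminf f" by simp
          then show ?thesis unfolding f_def .
        qed
        finally show ?thesis .
      qed auto
    qed
  qed
  also have "\<dots> = (\<Sum>k. \<integral>\<^sup>+z. ennreal (w k) * indicator (?D k) z \<partial>lborel)"
    by (rule nn_integral_suminf) measurable
  also have "\<dots> = (\<Sum>k. ennreal (w k * (mass k - mass (Suc k))))"
    using mdn by (simp add: nn_integral_cmult_indicator md ennreal_mult w_def)
  also have "\<dots> = ennreal (\<Sum>k. w k * (mass k - mass (Suc k)))"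
    by (rule suminf_ennreal2[OF _ sm]) (use mdn in \<open>simp add: w_def\<close>)
  also have "\<dots> < \<infinity>" by simp
  finally have "integrable lborel (\<lambda>z. indicator \<Omega> z *\<^sub>R norm (G z) powr 2)"
    by (intro integrableI_bounded) measurable
  then show ?thesis using G_set_measurable unfolding in_Lp_def
    by (subst set_integrable_lebesgue_borel) measurable
qed

section \<open>The equation\<close>

text \<open>The truncation makes the bounds hold at every point; at regular points the quotients are already in \<open>[1/\<Lambda>, \<Lambda>]\<close>
and are not changed.\<close>

definition lam1 :: "real^2 \<Rightarrow> real" where "lam1 z = max (1 / \<Lambda>) (min \<Lambda> (H z $ 2 / G z $ 1))"
definition lam2 :: "real^2 \<Rightarrow> real" where "lam2 z = max (1 / \<Lambda>) (min \<Lambda> (- H z $ 1 / G z $ 2))"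
definition A :: "real^2 \<Rightarrow> real^2^2" where "A z = mat2 (lam1 z) 0 0 (lam2 z)"
definition u :: "real \<Rightarrow> real^2 \<Rightarrow> real" where "u c z = vector [a, b] \<bullet> z + c + \<Phi> True z"

lemma lam_bounds: "1 / \<Lambda> \<le> lam1 z" "lam1 z \<le> \<Lambda>" "1 / \<Lambda> \<le> lam2 z" "lam2 z \<le> \<Lambda>"
proof -
  have "1 / \<Lambda> \<le> 1" using \<Lambda> by simp
  then have "1 / \<Lambda> \<le> \<Lambda>" using \<Lambda> by linarith
  then show "1 / \<Lambda> \<le> lam1 z" "lam1 z \<le> \<Lambda>" "1 / \<Lambda> \<le> lam2 z" "lam2 z \<le> \<Lambda>"
    by (auto simp: lam1_def lam2_def)
qed

lemma lam_measurable[measurable]: "lam1 \<in> borel_measurable borel" "lam2 \<in> borel_measurable borel"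
proof -
  note [measurable] = component_measurable[OF GH_measurable(1)] component_measurable[OF GH_measurable(2)]
  show "lam1 \<in> borel_measurable borel" unfolding lam1_def[abs_def] by measurable
  show "lam2 \<in> borel_measurable borel" unfolding lam2_def[abs_def] by measurable
qed

lemma A_eq: "A z = lam1 z *\<^sub>R mat2 1 0 0 0 + lam2 z *\<^sub>R mat2 0 0 0 1"
  by (simp add: A_def mat2_def vec_eq_iff forall_2)

lemma A_mult: "A z *v v = vector [lam1 z * v $ 1, lam2 z * v $ 2]"
  by (simp add: A_def mat2_def vec_eq_iff forall_2 matrix_vector_mult_def sum_2)

lemma A_bounded: "bounded (A ` \<Omega>)"
proof -
  have "norm (A z) \<le> \<Lambda> * norm (mat2 1 0 0 0) + \<Lambda> * norm (mat2 0 0 0 1)" for z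
  proof -
    have "\<bar>lam1 z\<bar> \<le> \<Lambda>" "\<bar>lam2 z\<bar> \<le> \<Lambda>"
      using lam_bounds[of z] \<Lambda> by (smt (verit) divide_pos_pos)+
    then show ?thesis unfolding A_eq
      by (intro order_trans[OF norm_triangle_ineq] add_mono) (auto intro: mult_right_mono)
  qed
  then show ?thesis by (auto simp: bounded_iff)
qed

lemma A_measurable: "set_borel_measurable lebesgue \<Omega> A"
  by (rule set_integrable_lebesgue_borel(3)) (unfold A_eq[abs_def], measurable)

lemma A_gradient: "AE z in lborel. z \<in> \<Omega> \<longrightarrow> A z *v G z = vector [H z $ 2, - H z $ 1]"
  using AE_regular
proof eventually_elim
  case (elim z)
  show ?case
  proof
    assume "z \<in> \<Omega>"
    then obtain k where k: "regular_at z k" using elim by blast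
    note r = regular_ratios[OF k]
    have "lam1 z = H z $ 2 / G z $ 1" "lam2 z = - H z $ 1 / G z $ 2"
      unfolding lam1_def lam2_def using r(3-6) by simp_all
    with r(1,2) show "A z *v G z = vector [H z $ 2, - H z $ 1]"
      by (simp add: A_mult)
  qed
qed

text \<open>Almost everywhere \<open>A \<nabla>u\<close> is the rotation of \<open>H\<close>, a constant vector plus the weak gradient of \<open>\<Phi> False\<close>.  The
constant contributes nothing since the gradient of a test function has mean zero, and the rest
vanishes because weak gradients are curl free.\<close>

lemma A_gradient_divergence_free: "distributional_div \<Omega> (\<lambda>z. A z *v G z) (\<lambda>z. 0)"
  unfolding distributional_div_def
proof (intro conjI allI impI)
  note cm[measurable] = component_measurable[OF GH_measurable(1)] component_measurable[OF GH_measurable(2)]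
  have AG: "A z *v G z = (lam1 z * G z $ 1) *\<^sub>R axis 1 1 + (lam2 z * G z $ 2) *\<^sub>R axis 2 1" for z
    by (simp add: A_mult vec_eq_iff forall_2 axis_def)
  have AGm[measurable]: "(\<lambda>z. A z *v G z) \<in> borel_measurable borel" unfolding AG by measurable
  have nAG: "norm (A z *v G z) \<le> norm ((2 * \<Lambda>) *\<^sub>R G z)" for z
  proof -
    have l: "\<bar>lam1 z\<bar> \<le> \<Lambda>" "\<bar>lam2 z\<bar> \<le> \<Lambda>"
      using lam_bounds[of z] \<Lambda> by (smt (verit) divide_pos_pos)+
    have "norm (A z *v G z) \<le> \<bar>lam1 z * G z $ 1\<bar> + \<bar>lam2 z * G z $ 2\<bar>"
      using norm_2_le[of 1 2 "A z *v G z"] by (simp add: A_mult)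
    also have "\<dots> \<le> \<Lambda> * norm (G z) + \<Lambda> * norm (G z)"
      unfolding abs_mult using l \<Lambda> by (intro add_mono mult_mono component_le_norm_cart) auto
    finally show ?thesis using \<Lambda> by simp
  qed
  have wG: "weak_gradient \<Omega> (\<lambda>z. vector [a, b] \<bullet> z + 0 + \<Phi> True z) (\<lambda>z. vector [a, b] + \<Gamma> True z)"
    by (rule weak_gradient_affine_plus[OF \<Phi>_weak_gradient _ _ \<Omega>(1)]) measurable
  show "locally_integrable \<Omega> (\<lambda>z. A z *v G z)"
    unfolding locally_integrable_def
  proof (intro allI impI)
    fix K assume K: "compact K \<and> K \<subseteq> \<Omega>"
    then have [measurable]: "K \<in> sets borel" by (simp add: borel_compact)
    have "set_integrable lebesgue K G" using wG K by (auto simp: weak_gradient_def locally_integrable_def G_def[abs_def])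
    then have "integrable lborel (\<lambda>z. indicator K z *\<^sub>R G z)" by (subst (asm) set_integrable_lebesgue_borel) auto
    then have "integrable lborel (\<lambda>z. (2 * \<Lambda>) *\<^sub>R (indicator K z *\<^sub>R G z))"
      by (rule integrable_scaleR_right)
    then have "integrable lborel (\<lambda>z. indicator K z *\<^sub>R (A z *v G z))"
      by (rule Bochner_Integration.integrable_bound) (use nAG in \<open>auto simp: indicator_def\<close>)
    then show "set_integrable lebesgue K (\<lambda>z. A z *v G z)"
      by (subst set_integrable_lebesgue_borel) auto
  qed
  show "locally_integrable \<Omega> (\<lambda>z. 0 :: real)" by (simp add: locally_integrable_def set_integrable_def)
  fix \<psi> assume t: "test_function \<Omega> \<psi>"
  have tm: "tame \<psi>" by (rule test_function_tame[OF t])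
  note tmm[measurable] = tame_measurable[OF tm]
  note pm[measurable] = component_measurable[OF tmm(2)]
  obtain B where B: "\<And>x. \<bar>\<psi> x\<bar> \<le> B" "\<And>x. norm (gradient \<psi> x) \<le> B"
    by (rule tame_lipschitz[OF tm]) blast
  have out: "z \<notin> \<Omega> \<Longrightarrow> gradient \<psi> z = 0" for z
    by (rule test_function_support[OF t]) blast
  have wt: "whole_weak_gradient \<psi> (gradient \<psi>)" by (rule test_function_weak_gradient[OF t])
  then have ig: "integrable lborel (gradient \<psi>)" by (simp add: whole_weak_gradient_def)
  have d0: "(\<integral>z. gradient \<psi> z $ i \<partial>lborel) = 0" and di: "integrable lborel (\<lambda>z. gradient \<psi> z $ i)" for i
    using integral_bounded_linear[OF bounded_linear_vec_nth ig, of i] whole_weak_gradient_integral_0[OF wt]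
      integrable_bounded_linear[OF bounded_linear_vec_nth ig, of i] by auto
  let ?\<Gamma> = "\<Gamma> False"
  have i\<Gamma>: "integrable lborel ?\<Gamma>" using \<Phi>_weak_gradient[of False] by (simp add: whole_weak_gradient_def)
  have ip: "integrable lborel (\<lambda>z. ?\<Gamma> z $ i * gradient \<psi> z $ j)" for i j
  proof -
    have "\<bar>gradient \<psi> z $ j\<bar> \<le> B" for z using component_le_norm_cart[of "gradient \<psi> z" j] B(2)[of z] by linarith
    then show ?thesis
      using integrable_bounded_scaleR[OF integrable_bounded_linear[OF bounded_linear_vec_nth i\<Gamma>, of i] pm(1)[of j], of B]
      by simp
  qed
  have curl: "(\<integral>z. ?\<Gamma> z $ 2 * gradient \<psi> z $ 1 \<partial>lborel) = (\<integral>z. ?\<Gamma> z $ 1 * gradient \<psi> z $ 2 \<partial>lborel)"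
    by (rule whole_weak_gradient_curl_free[OF \<Phi>_weak_gradient tm test_function_tame[OF test_function_gradient[OF t]]])
  have "(LINT z:\<Omega>|lebesgue. (A z *v G z) \<bullet> gradient \<psi> z) = (\<integral>z. indicator \<Omega> z *\<^sub>R ((A z *v G z) \<bullet> gradient \<psi> z) \<partial>lborel)"
    by (rule set_integrable_lebesgue_borel(2)) measurable
  also have "\<dots> = (\<integral>z. ((a + 1) * gradient \<psi> z $ 1 + b * gradient \<psi> z $ 2)
      + (?\<Gamma> z $ 2 * gradient \<psi> z $ 1 - ?\<Gamma> z $ 1 * gradient \<psi> z $ 2) \<partial>lborel)"
  proof (rule integral_cong_AE)
    note [measurable] = component_measurable[OF \<Gamma>_measurable]
    show "(\<lambda>z. ((a + 1) * gradient \<psi> z $ 1 + b * gradient \<psi> z $ 2)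
      + (?\<Gamma> z $ 2 * gradient \<psi> z $ 1 - ?\<Gamma> z $ 1 * gradient \<psi> z $ 2)) \<in> borel_measurable lborel" by measurable
    show "AE z in lborel. indicator \<Omega> z *\<^sub>R ((A z *v G z) \<bullet> gradient \<psi> z) = ((a + 1) * gradient \<psi> z $ 1 + b * gradient \<psi> z $ 2)
      + (?\<Gamma> z $ 2 * gradient \<psi> z $ 1 - ?\<Gamma> z $ 1 * gradient \<psi> z $ 2)"
      using A_gradient
    proof eventually_elim
      case (elim z)
      show ?case
      proof (cases "z \<in> \<Omega>")
        case True
        then show ?thesis using elim by (simp add: inner_vec_def sum_2 H_def algebra_simps)
      qed (simp add: out)
    qed
  qed measurable
  also have "\<dots> = 0"
    using ip di by (simp add: d0 curl)
  finally show "(LINT z:\<Omega>|lebesgue. (A z *v G z) \<bullet> gradient \<psi> z) = - (LINT z:\<Omega>|lebesgue. 0 * \<psi> z)"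
    by simp
qed

lemma u_measurable[measurable]: "u c \<in> borel_measurable borel"
  unfolding u_def[abs_def] by measurable

lemma u_weak_gradient: "weak_gradient \<Omega> (u c) G"
  unfolding u_def[abs_def] G_def[abs_def]
  by (rule weak_gradient_affine_plus[OF \<Phi>_weak_gradient _ _ \<Omega>(1)]) measurable

lemma u_boundary: "z \<notin> \<Omega> \<Longrightarrow> u c z = vector [a, b] \<bullet> z + c"
  by (simp add: u_def \<Phi>_outside)

lemma u_bounded: "bounded S \<Longrightarrow> \<exists>M. \<forall>z\<in>S. \<bar>u c z\<bar> \<le> M"
proof -
  assume "bounded S"
  then obtain R where R: "\<And>z. z \<in> S \<Longrightarrow> norm z \<le> R" by (auto simp: bounded_iff)
  have "\<bar>u c z\<bar> \<le> norm (vector [a, b] :: real^2) * R + \<bar>c\<bar> + 2" if "z \<in> S" for z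
  proof -
    have "\<bar>vector [a, b] \<bullet> z\<bar> \<le> norm (vector [a, b] :: real^2) * R"
      using Cauchy_Schwarz_ineq2[of "vector [a, b]" z] mult_left_mono[OF R[OF that], of "norm (vector [a, b] :: real^2)"]
        norm_ge_zero[of "vector [a, b] :: real^2"] by linarith
    then show ?thesis using \<Phi>_bounded[of True z] unfolding u_def by linarith
  qed
  then show ?thesis by blast
qed

lemma u_holder: "bounded S \<Longrightarrow> holder_on \<alpha> S (u c)"
  unfolding holder_on_def
proof (intro conjI)
  assume S: "bounded S"
  show "bounded (u c ` S)" using u_bounded[OF S, of c] by (auto simp: bounded_iff)
  obtain R where R: "0 < R" "\<And>z. z \<in> S \<Longrightarrow> norm z \<le> R" using S by (auto simp: bounded_pos)
  let ?N = "norm (vector [a, b] :: real^2)"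
  have "\<bar>u c z - u c w\<bar> \<le> (?N * (2 * R) powr (1 - \<alpha>) + 2) * dist z w powr \<alpha>" if "z \<in> S" "w \<in> S" for z w
  proof -
    have d: "dist z w \<le> 2 * R" using R(2)[OF that(1)] R(2)[OF that(2)] norm_triangle_ineq4[of z w] by (simp add: dist_norm)
    have "dist z w = dist z w powr (1 - \<alpha>) * dist z w powr \<alpha>" by (cases "dist z w = 0") (auto simp flip: powr_add)
    also have "\<dots> \<le> (2 * R) powr (1 - \<alpha>) * dist z w powr \<alpha>"
      using \<alpha> d by (intro mult_right_mono powr_mono2) auto
    finally have "?N * dist z w \<le> ?N * ((2 * R) powr (1 - \<alpha>) * dist z w powr \<alpha>)" by (rule mult_left_mono) simp
    moreover have "\<bar>vector [a, b] \<bullet> (z - w)\<bar> \<le> ?N * dist z w"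
      unfolding dist_norm by (rule Cauchy_Schwarz_ineq2)
    moreover have "u c z - u c w = vector [a, b] \<bullet> (z - w) + (\<Phi> True z - \<Phi> True w)"
      by (simp add: u_def inner_diff_right)
    moreover have "\<bar>\<Phi> True z - \<Phi> True w\<bar> \<le> 2 * dist z w powr \<alpha>"
      using \<Phi>_holder[of True z w] by (simp add: dist_norm)
    ultimately show ?thesis by (simp add: algebra_simps)
  qed
  then show "\<exists>C. \<forall>z\<in>S. \<forall>w\<in>S. \<bar>u c z - u c w\<bar> \<le> C * dist z w powr \<alpha>" by blast
qed

lemma u_W12: "in_W1p 2 \<Omega> (u c)"
proof -
  obtain M where M: "\<And>z. z \<in> \<Omega> \<Longrightarrow> \<bar>u c z\<bar> \<le> M" using u_bounded[OF \<Omega>(2)] by blast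
  have fin: "emeasure lborel \<Omega> < \<infinity>" by (rule emeasure_bounded_finite[OF \<Omega>(2)])
  have "integrable lborel (\<lambda>z. indicator \<Omega> z *\<^sub>R norm (u c z) powr 2)"
  proof (rule Bochner_Integration.integrable_bound[of _ "\<lambda>z. \<bar>M\<bar> powr 2 * indicator \<Omega> z"])
    show "integrable lborel (\<lambda>z. \<bar>M\<bar> powr 2 * indicator \<Omega> z)"
      using fin by (intro integrable_mult_right integrable_real_indicator) auto
    show "AE z in lborel. norm (indicator \<Omega> z *\<^sub>R norm (u c z) powr 2) \<le> norm (\<bar>M\<bar> powr 2 * indicator \<Omega> z)"
    proof (rule AE_I2)
      fix z
      have "\<bar>u c z\<bar> powr 2 \<le> \<bar>M\<bar> powr 2" if "z \<in> \<Omega>"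
        using M[OF that] by (intro powr_mono2) auto
      then show "norm (indicator \<Omega> z *\<^sub>R norm (u c z) powr 2) \<le> norm (\<bar>M\<bar> powr 2 * indicator \<Omega> z)"
        by (auto simp: indicator_def)
    qed
  qed measurable
  then have "set_integrable lebesgue \<Omega> (\<lambda>z. norm (u c z) powr 2)"
    by (subst set_integrable_lebesgue_borel) measurable
  moreover have "set_borel_measurable lebesgue \<Omega> (u c)"
    by (rule set_integrable_lebesgue_borel(3)) measurable
  ultimately show ?thesis
    using u_weak_gradient G_L2 unfolding in_W1p_def in_Lp_def[of _ _ "u c"] by blast
qed

end

theorem theorem4p3:
  fixes \<Lambda> abar \<delta> \<gamma> b \<alpha> :: real
    and Xbar :: "real^2^2"
    and l :: "real^2 \<Rightarrow> real"
    and \<Omega> :: "(real^2) set"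
  assumes "\<Lambda> > 1" and "abar > 0" and "\<delta> > 0" and "\<gamma> > 0"
    and "1 - \<delta> > 1 / \<Lambda>"
    and "\<gamma> < (\<Lambda> - 1) / (\<Lambda> + 1)"
    and "abar > \<Lambda> / (\<Lambda> - 1) + 10"
    and "1 / abar < \<delta>"
    and "Xbar \<in> U_set abar \<delta> \<gamma>"
    and "\<And>x. l x = row 1 Xbar \<bullet> x + b"
    and "0 < \<alpha>" and "\<alpha> < 1"
    and "regular_domain \<Omega>"
  shows "\<exists>(u :: real^2 \<Rightarrow> real) (G :: real^2 \<Rightarrow> real^2) (A :: real^2 \<Rightarrow> real^2^2)
      (lam1 :: real^2 \<Rightarrow> real) (lam2 :: real^2 \<Rightarrow> real).
    in_W1p 2 \<Omega> u \<and> holder_on \<alpha> (closure \<Omega>) u \<and> weak_gradient \<Omega> u G \<and>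
    bounded (A ` \<Omega>) \<and> set_borel_measurable lebesgue \<Omega> A \<and>
    (\<forall>x\<in>\<Omega>. A x = mat2 (lam1 x) 0 0 (lam2 x)) \<and>
    (AE x in lebesgue. x \<in> \<Omega> \<longrightarrow>
       1 / \<Lambda> \<le> lam1 x \<and> lam1 x \<le> \<Lambda> \<and> 1 / \<Lambda> \<le> lam2 x \<and> lam2 x \<le> \<Lambda>) \<and>
    (\<forall>x\<in>frontier \<Omega>. u x = l x) \<and>
    distributional_div \<Omega> (\<lambda>x. A x *v G x) (\<lambda>x. 0) \<and>
    in_weak_Lp (2 * \<Lambda> / (\<Lambda> - 1)) \<Omega> G \<and>
    (\<forall>r>0. \<not> in_Lorentz (2 * \<Lambda> / (\<Lambda> - 1)) r \<Omega> G) \<and>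
    \<not> in_Lp (2 * \<Lambda> / (\<Lambda> - 1)) \<Omega> G"
proof -
  obtain a\<^sub>0 b\<^sub>0 c\<^sub>0 d\<^sub>0 where X: "Xbar = mat2 a\<^sub>0 b\<^sub>0 (- c\<^sub>0) d\<^sub>0" and a\<^sub>0: "abar < a\<^sub>0" and b\<^sub>0: "\<bar>1 - b\<^sub>0\<bar> < \<gamma>"
    using assms(9) unfolding U_set_def by blast
  have "(\<Lambda> - 1) / (\<Lambda> + 1) < 1" using assms(1) by simp
  then have b\<^sub>0_pos: "0 < b\<^sub>0" using b\<^sub>0 assms(6) by linarith
  interpret D: staircase_data \<Lambda> a\<^sub>0 b\<^sub>0 \<alpha> \<Omega>
    using assms a\<^sub>0 b\<^sub>0_pos by unfold_locales (auto simp: regular_domain_def)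
  obtain U \<phi> g where "staircase \<Lambda> a\<^sub>0 b\<^sub>0 \<alpha> \<Omega> U \<phi> g" using D.staircase_exists by blast
  then interpret staircase \<Lambda> a\<^sub>0 b\<^sub>0 \<alpha> \<Omega> U \<phi> g .
  have "row 1 Xbar = vector [a\<^sub>0, b\<^sub>0]" by (simp add: X mat2_def row_def vec_eq_iff forall_2)
  then have l: "l z = vector [a\<^sub>0, b\<^sub>0] \<bullet> z + b" for z using assms(10) by simp
  have boundary: "\<forall>z\<in>frontier \<Omega>. u b z = l z"
    using D.\<Omega>(1) by (auto simp: l frontier_def interior_open intro: u_boundary)
  have "holder_on \<alpha> (closure \<Omega>) (u b)" using D.\<Omega>(2) by (intro u_holder bounded_closure)
  then show ?thesis
    using u_W12[of b] u_weak_gradient[of b] A_bounded A_measurable lam_bounds boundary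
      A_gradient_divergence_free G_weak_Lp G_not_Lorentz G_not_Lp
    unfolding D.p_def
    by (intro exI[of _ "u b"] exI[of _ G] exI[of _ A] exI[of _ lam1] exI[of _ lam2]) (simp add: A_def)
qed

end
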